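(* Assume that $R$ is a rational map of degree at least $2$ which is not a Lattès map, satisfies the $M$-condition, and has $P_R\neq\overline{\mathbb C}$. Then there is no non-zero fixed point of the Ruelle operator $R^*$ in $L_1(J_R)$.
   Context: $J_R$ is the Julia set and $P_R=\overline{\bigcup_c\bigcup_{i>0}R^i(c)}$ ($c$ ranging over critical points) is the postcritical set. The Ruelle operator is $R^*(\phi)=\sum_i\phi(\zeta_i)(\zeta_i')^2$, sum over the branches $\zeta_i$ of $R^{-1}$, acting on $L_1(J_R)$ (planar Lebesgue measure). A set $M\subset\overline{\mathbb C}$ of positive Lebesgue measure is weakly wandering if there is a sequence $0=k_0<k_1<\dots$ such that the sets $R^{-k_i}(M)$ are pairwise disjoint up to null sets; $W(R)$ is the union of all weakly wandering sets and $SC(R)=\mathbb C\setminus W(R)$ is the strongly conservative set (up to null sets). $R$ satisfies the $M$-condition if for every invariant ergodic probability measure $\nu$, absolutely continuous with respect to Lebesgue measure and supported on $J_R$: (1) for all $\nu$-measurable $A,B\subset SC(R)\cap J_R$, $\lim_n\nu(B\cap R^{-n}(A))=\nu(A)\nu(B)$; (2) there is a $\nu$-measurable set $A_\nu\subset SC(R)\cap J_R$ with $\nu(A_\nu)>0$ such that the sequence of functions $x\mapsto\overline{(R^n)'(x)}/(R^n)'(x)$ is precompact in the topology of convergence in measure on $A_\nu$. If there is no such measure, the $M$-condition is vacuously satisfied. A Lattès map is a rational map $R$ of degree at least 2 such that $R\circ\Theta=\Theta\circ L$ for some affine self-map $L$ of a complex torus $\mathbb T$ and some non-constant holomorphic $\Theta:\mathbb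 T\to\overline{\mathbb C}$. *)

theory Defs
  imports
    "HOL-Complex_Analysis.Complex_Analysis"
    "HOL-Computational_Algebra.Polynomial"
    "HOL-Probability.Probability"
begin

section \<open>The Riemann sphere\<close>

datatype csphere = Fin complex | Infty

fun stereo :: "csphere \<Rightarrow> complex \<times> real" where
  "stereo (Fin z) = (2 * z / of_real (1 + (norm z)\<^sup>2), ((norm z)\<^sup>2 - 1) / ((norm z)\<^sup>2 + 1))"
| "stereo Infty = (0, 1)"

lemma stereo_height_neq_1: "((norm (z::complex))\<^sup>2 - 1) / ((norm z)\<^sup>2 + 1) \<noteq> 1"
proof -
  have "(norm z)\<^sup>2 + 1 > 0" by (simp add: add_nonneg_pos)
  then show ?thesis by (simp add: divide_eq_eq)
qed

lemma stereo_inject: "stereo x = stereo y \<longleftrightarrow> x = y"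
proof
  assume eq: "stereo x = stereo y"
  show "x = y"
  proof (cases x; cases y)
    fix z w assume x: "x = Fin z" and y: "y = Fin w"
    have pos: "(norm z)\<^sup>2 + 1 > 0" "(norm w)\<^sup>2 + 1 > 0" by (simp_all add: add_nonneg_pos)
    have "((norm z)\<^sup>2 - 1) / ((norm z)\<^sup>2 + 1) = ((norm w)\<^sup>2 - 1) / ((norm w)\<^sup>2 + 1)"
      using eq x y by simp
    then have n: "(norm z)\<^sup>2 = (norm w)\<^sup>2"
      using pos by (simp add: frac_eq_eq algebra_simps)
    have "2 * z / of_real (1 + (norm z)\<^sup>2) = 2 * w / of_real (1 + (norm z)\<^sup>2)"
      using eq x y n by simp
    moreover have "(of_real (1 + (norm z)\<^sup>2) :: complex) \<noteq> 0"
      using pos by (metis add.commute less_irrefl of_real_eq_0_iff)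
    ultimately have "z = w" by (metis divide_cancel_right mult_cancel_left zero_neq_numeral)
    then show "x = y" using x y by simp
  qed (use eq stereo_height_neq_1 in \<open>auto dest: sym\<close>)
qed simp

text \<open>The distance is the chordal metric.\<close>

instantiation csphere :: metric_space
begin

definition dist_csphere :: "csphere \<Rightarrow> csphere \<Rightarrow> real" where
  "dist_csphere x y = dist (stereo x) (stereo y)"

definition uniformity_csphere :: "(csphere \<times> csphere) filter" where
  "uniformity_csphere = (INF e\<in>{0 <..}. principal {(x, y). dist x y < e})"

definition open_csphere :: "csphere set \<Rightarrow> bool" where
  "open_csphere U \<longleftrightarrow> (\<forall>x\<in>U. eventually (\<lambda>(x', y). x' = x \<longrightarrow> y \<in> U) uniformity)"

instance
proof
  fix x y z :: csphere
  show "dist x y = 0 \<longleftrightarrow> x = y"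
    by (simp add: dist_csphere_def stereo_inject)
  show "dist x y \<le> dist x z + dist y z"
    unfolding dist_csphere_def by (rule dist_triangle2)
qed (simp_all add: uniformity_csphere_def open_csphere_def)

end

fun sphere_inversion :: "csphere \<Rightarrow> csphere" where
  "sphere_inversion Infty = Fin 0"
| "sphere_inversion (Fin z) = (if z = 0 then Infty else Fin (1 / z))"

text \<open>The value at \<open>Infty\<close> is irrelevant.\<close>

fun fin_part :: "csphere \<Rightarrow> complex" where
  "fin_part (Fin z) = z"
| "fin_part Infty = 0"

definition sphere_lborel :: "csphere measure" where
  "sphere_lborel = distr lborel borel Fin"

lemma continuous_on_Fin: "continuous_on UNIV Fin"
proof -
  have ne: "1 + (cmod z)\<^sup>2 \<noteq> 0" "(cmod z)\<^sup>2 + 1 \<noteq> 0" for z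
    using zero_le_power2[of "cmod z"] by linarith+
  have ne': "of_real (1 + (cmod z)\<^sup>2) \<noteq> (0 :: complex)" for z
    using ne by (metis of_real_eq_0_iff)
  have "continuous_on UNIV (\<lambda>z. stereo (Fin z))"
    unfolding stereo.simps by (intro continuous_intros ballI ne ne')
  then show ?thesis
    by (simp add: continuous_on_iff dist_csphere_def)
qed

lemma emeasure_sphere_lborel:
  "A \<in> sets borel \<Longrightarrow> emeasure sphere_lborel A = emeasure lborel {z. Fin z \<in> A}"
  unfolding sphere_lborel_def
  by (subst emeasure_distr)
     (auto simp: vimage_def intro: borel_measurable_continuous_onI continuous_on_Fin)

definition sphere_lebesgue :: "csphere measure" where
  "sphere_lebesgue = completion sphere_lborel"


section \<open>Rational maps, Julia set and postcritical set\<close>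

definition rat_map :: "complex poly \<Rightarrow> complex poly \<Rightarrow> csphere \<Rightarrow> csphere" where
  "rat_map p q x =
     (case x of
        Fin z \<Rightarrow> (if poly q z = 0 then Infty else Fin (poly p z / poly q z))
      | Infty \<Rightarrow> (let n = max (degree p) (degree q) in
                   if coeff q n = 0 then Infty else Fin (coeff p n / coeff q n)))"

definition rational_map_of_degree :: "nat \<Rightarrow> (csphere \<Rightarrow> csphere) \<Rightarrow> bool" where
  "rational_map_of_degree d R \<longleftrightarrow>
     (\<exists>p q. coprime p q \<and> R = rat_map p q \<and> d = max (degree p) (degree q))"

definition normal_family_on :: "csphere set \<Rightarrow> (csphere \<Rightarrow> csphere) set \<Rightarrow> bool" where
  "normal_family_on U F \<longleftrightarrow>
     (\<forall>s :: nat \<Rightarrow> csphere \<Rightarrow> csphere. range s \<subseteq> F \<longrightarrow>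
        (\<exists>r g. strict_mono r \<and>
           (\<forall>K. compact K \<and> K \<subseteq> U \<longrightarrow> uniform_limit K (\<lambda>j. s (r j)) g sequentially)))"

definition fatou_set :: "(csphere \<Rightarrow> csphere) \<Rightarrow> csphere set" where
  "fatou_set R = \<Union>{U. open U \<and> normal_family_on U (range (\<lambda>n. R ^^ n))}"

definition julia_set :: "(csphere \<Rightarrow> csphere) \<Rightarrow> csphere set" where
  "julia_set R = - fatou_set R"

definition chart_at :: "csphere \<Rightarrow> csphere \<Rightarrow> csphere" where
  "chart_at x = (if x = Infty then sphere_inversion else id)"

text \<open>The derivative is taken in the coordinate \<open>z\<close> at finite points and \<open>1 / z\<close> at
  \<open>Infty\<close>, in the source as well as in the target.\<close>

definition critical_point :: "(csphere \<Rightarrow> csphere) \<Rightarrow> csphere \<Rightarrow> bool" where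
  "critical_point R x \<longleftrightarrow>
     ((\<lambda>z. fin_part (chart_at (R x) (R (chart_at x (Fin z)))))
        has_field_derivative 0) (at (fin_part (chart_at x x)))"

definition postcritical_set :: "(csphere \<Rightarrow> csphere) \<Rightarrow> csphere set" where
  "postcritical_set R = closure (\<Union>c\<in>{c. critical_point R c}. \<Union>i\<in>{0<..}. {(R ^^ i) c})"


section \<open>The Ruelle operator\<close>

definition julia_plane :: "(csphere \<Rightarrow> csphere) \<Rightarrow> complex set" where
  "julia_plane R = {z. Fin z \<in> julia_set R}"

text \<open>A local holomorphic branch of the inverse of \<open>R\<close> near \<open>z\<close> is determined by its value
  at \<open>z\<close>, so summing over the pairs of value and derivative at \<open>z\<close> is summing over the
  branches. Only critical values and \<open>R Infty\<close>, a finite set, have fewer than \<open>deg R\<close> such pairs.\<close>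

definition inverse_branch_jets :: "(csphere \<Rightarrow> csphere) \<Rightarrow> complex \<Rightarrow> (complex \<times> complex) set" where
  "inverse_branch_jets R z =
     {(\<zeta> z, deriv \<zeta> z) | \<zeta>.
        \<exists>r>0. \<zeta> holomorphic_on ball z r \<and> (\<forall>u\<in>ball z r. R (Fin (\<zeta> u)) = Fin u)}"

definition ruelle :: "(csphere \<Rightarrow> csphere) \<Rightarrow> (complex \<Rightarrow> complex) \<Rightarrow> complex \<Rightarrow> complex" where
  "ruelle R \<phi> z = (\<Sum>(w, d)\<in>inverse_branch_jets R z. \<phi> w * d\<^sup>2)"


section \<open>The strongly conservative set\<close>

definition weakly_wandering :: "(csphere \<Rightarrow> csphere) \<Rightarrow> csphere set \<Rightarrow> bool" where
  "weakly_wandering R M \<longleftrightarrow>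
     M \<in> sets sphere_lebesgue \<and> emeasure sphere_lebesgue M > 0 \<and>
     (\<exists>k :: nat \<Rightarrow> nat. k 0 = 0 \<and> strict_mono k \<and>
        (\<forall>i j. i \<noteq> j \<longrightarrow> ((R ^^ k i) -` M) \<inter> ((R ^^ k j) -` M) \<in> null_sets sphere_lebesgue))"

text \<open>Adding a null set to a weakly wandering set gives a weakly wandering set, so the pointwise
  union of all of them would be empty or everything. The union is therefore the measurable
  (essential) one, i.e. the supremum in the algebra of measurable sets modulo null sets;
  it exists since the measure is \<open>\<sigma>\<close>-finite and is unique up to a null set.\<close>

definition is_essential_union :: "'a measure \<Rightarrow> 'a set set \<Rightarrow> 'a set \<Rightarrow> bool" where
  "is_essential_union \<mu> F W \<longleftrightarrow>
     W \<in> sets \<mu> \<and> (\<forall>M\<in>F. M - W \<in> null_sets \<mu>) \<and>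
     (\<forall>W'\<in>sets \<mu>. (\<forall>M\<in>F. M - W' \<in> null_sets \<mu>) \<longrightarrow> W - W' \<in> null_sets \<mu>)"

definition W_set :: "(csphere \<Rightarrow> csphere) \<Rightarrow> csphere set" where
  "W_set R = (SOME W. is_essential_union sphere_lebesgue {M. weakly_wandering R M} W)"

definition SC_set :: "(csphere \<Rightarrow> csphere) \<Rightarrow> csphere set" where
  "SC_set R = range Fin - W_set R"


section \<open>The M-condition\<close>

definition invariant_ergodic_prob :: "(csphere \<Rightarrow> csphere) \<Rightarrow> csphere measure \<Rightarrow> bool" where
  "invariant_ergodic_prob R \<nu> \<longleftrightarrow>
     prob_space \<nu> \<and> sets \<nu> = sets borel \<and>
     (\<forall>A\<in>sets \<nu>. R -` A \<in> sets \<nu> \<and> emeasure \<nu> (R -` A) = emeasure \<nu> A) \<and>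
     (\<forall>A\<in>sets \<nu>. R -` A = A \<longrightarrow> emeasure \<nu> A = 0 \<or> emeasure \<nu> A = 1)"

definition open_in_measure :: "'a measure \<Rightarrow> ('a \<Rightarrow> complex) set \<Rightarrow> bool" where
  "open_in_measure \<mu> U \<longleftrightarrow>
     U \<subseteq> borel_measurable \<mu> \<and>
     (\<forall>f\<in>U. \<exists>\<epsilon>>0. \<forall>g\<in>borel_measurable \<mu>.
        emeasure \<mu> {x\<in>space \<mu>. \<epsilon> \<le> dist (f x) (g x)} < ennreal \<epsilon> \<longrightarrow> g \<in> U)"

definition topology_in_measure :: "'a measure \<Rightarrow> ('a \<Rightarrow> complex) topology" where
  "topology_in_measure \<mu> = topology (open_in_measure \<mu>)"

lemma istopology_in_measure: "istopology (open_in_measure \<mu>)"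
  unfolding istopology_def
proof (intro conjI allI impI)
  fix S T assume S: "open_in_measure \<mu> S" and T: "open_in_measure \<mu> T"
  show "open_in_measure \<mu> (S \<inter> T)"
    unfolding open_in_measure_def
  proof (intro conjI ballI)
    show "S \<inter> T \<subseteq> borel_measurable \<mu>" using S by (auto simp: open_in_measure_def)
    fix f assume f: "f \<in> S \<inter> T"
    then have fm: "f \<in> borel_measurable \<mu>" using S by (auto simp: open_in_measure_def)
    obtain a where a: "a > 0" and aS: "\<And>g. g \<in> borel_measurable \<mu> \<Longrightarrow>
        emeasure \<mu> {x\<in>space \<mu>. a \<le> dist (f x) (g x)} < ennreal a \<Longrightarrow> g \<in> S"
      using S f unfolding open_in_measure_def by blast
    obtain b where b: "b > 0" and bT: "\<And>g. g \<in> borel_measurable \<mu> \<Longrightarrow>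
        emeasure \<mu> {x\<in>space \<mu>. b \<le> dist (f x) (g x)} < ennreal b \<Longrightarrow> g \<in> T"
      using T f unfolding open_in_measure_def by blast
    have "g \<in> S \<inter> T" if g: "g \<in> borel_measurable \<mu>"
      and lt: "emeasure \<mu> {x\<in>space \<mu>. min a b \<le> dist (f x) (g x)} < ennreal (min a b)" for g
    proof -
      have le: "emeasure \<mu> {x\<in>space \<mu>. c \<le> dist (f x) (g x)} < ennreal c"
        if c: "min a b \<le> c" for c
      proof -
        have "emeasure \<mu> {x\<in>space \<mu>. c \<le> dist (f x) (g x)}
            \<le> emeasure \<mu> {x\<in>space \<mu>. min a b \<le> dist (f x) (g x)}"
          by (rule emeasure_mono) (use c fm g in \<open>auto intro: order_trans\<close>)
        also note lt
        also have "ennreal (min a b) \<le> ennreal c" using c by (rule ennreal_leI)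
        finally show ?thesis .
      qed
      show ?thesis using aS[OF g le[of a]] bT[OF g le[of b]] by simp
    qed
    then show "\<exists>\<epsilon>>0. \<forall>g\<in>borel_measurable \<mu>.
        emeasure \<mu> {x\<in>space \<mu>. \<epsilon> \<le> dist (f x) (g x)} < ennreal \<epsilon> \<longrightarrow> g \<in> S \<inter> T"
      using a b by (intro exI[of _ "min a b"]) auto
  qed
next
  fix K assume K: "\<forall>S\<in>K. open_in_measure \<mu> S"
  show "open_in_measure \<mu> (\<Union>K)"
    unfolding open_in_measure_def
  proof (intro conjI ballI)
    show "\<Union>K \<subseteq> borel_measurable \<mu>" using K by (auto simp: open_in_measure_def)
    fix f assume "f \<in> \<Union>K"
    then obtain S where S: "S \<in> K" "f \<in> S" by blast
    then obtain a where "a > 0" "\<forall>g\<in>borel_measurable \<mu>.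
        emeasure \<mu> {x\<in>space \<mu>. a \<le> dist (f x) (g x)} < ennreal a \<longrightarrow> g \<in> S"
      using K unfolding open_in_measure_def by blast
    then show "\<exists>\<epsilon>>0. \<forall>g\<in>borel_measurable \<mu>.
        emeasure \<mu> {x\<in>space \<mu>. \<epsilon> \<le> dist (f x) (g x)} < ennreal \<epsilon> \<longrightarrow> g \<in> \<Union>K"
      using S(1) by blast
  qed
qed

lemma openin_topology_in_measure: "openin (topology_in_measure \<mu>) = open_in_measure \<mu>"
  by (simp add: topology_in_measure_def istopology_in_measure topology_inverse')

definition precompact_in_measure :: "'a measure \<Rightarrow> ('a \<Rightarrow> complex) set \<Rightarrow> bool" where
  "precompact_in_measure \<mu> F \<longleftrightarrow>
     F \<subseteq> borel_measurable \<mu> \<and>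
     compactin (topology_in_measure \<mu>) (topology_in_measure \<mu> closure_of F)"

definition iterate_deriv :: "(csphere \<Rightarrow> csphere) \<Rightarrow> nat \<Rightarrow> csphere \<Rightarrow> complex" where
  "iterate_deriv R n x = deriv (\<lambda>z. fin_part ((R ^^ n) (Fin z))) (fin_part x)"

text \<open>\<open>\<nu>\<close> is a Borel measure, so the \<open>\<nu>\<close>-measurable sets are those of its completion.\<close>

definition M_condition :: "(csphere \<Rightarrow> csphere) \<Rightarrow> bool" where
  "M_condition R \<longleftrightarrow>
     (\<forall>\<nu>. invariant_ergodic_prob R \<nu> \<and> absolutely_continuous sphere_lborel \<nu> \<and>
          emeasure \<nu> (- julia_set R) = 0 \<longrightarrow>
        (\<forall>A\<in>sets (completion \<nu>). \<forall>B\<in>sets (completion \<nu>).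
           A \<subseteq> SC_set R \<inter> julia_set R \<and> B \<subseteq> SC_set R \<inter> julia_set R \<longrightarrow>
           (\<lambda>n. measure (completion \<nu>) (B \<inter> (R ^^ n) -` A))
             \<longlonglongrightarrow> measure (completion \<nu>) A * measure (completion \<nu>) B) \<and>
        (\<exists>A\<in>sets (completion \<nu>).
           A \<subseteq> SC_set R \<inter> julia_set R \<and> measure (completion \<nu>) A > 0 \<and>
           precompact_in_measure (restrict_space (completion \<nu>) A)
             (range (\<lambda>n x. cnj (iterate_deriv R n x) / iterate_deriv R n x))))"


section \<open>Lattes maps\<close>

definition lattice :: "complex \<Rightarrow> complex \<Rightarrow> complex set" where
  "lattice \<omega>1 \<omega>2 = {of_int m * \<omega>1 + of_int n * \<omega>2 | m n :: int. True}"

definition is_lattice :: "complex set \<Rightarrow> bool" where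
  "is_lattice \<Lambda> \<longleftrightarrow> (\<exists>\<omega>1 \<omega>2. \<omega>1 \<noteq> 0 \<and> \<omega>2 / \<omega>1 \<notin> \<real> \<and> \<Lambda> = lattice \<omega>1 \<omega>2)"

definition torus_proj :: "complex set \<Rightarrow> complex \<Rightarrow> complex set" where
  "torus_proj \<Lambda> z = (\<lambda>l. z + l) ` \<Lambda>"

definition torus :: "complex set \<Rightarrow> complex set set" where
  "torus \<Lambda> = range (torus_proj \<Lambda>)"

definition affine_torus_map :: "complex set \<Rightarrow> (complex set \<Rightarrow> complex set) \<Rightarrow> bool" where
  "affine_torus_map \<Lambda> L \<longleftrightarrow>
     (\<exists>a b. \<forall>z. L (torus_proj \<Lambda> z) = torus_proj \<Lambda> (a * z + b))"

definition holomorphic_to_sphere :: "(complex \<Rightarrow> csphere) \<Rightarrow> bool" where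
  "holomorphic_to_sphere F \<longleftrightarrow>
     (\<forall>z0. \<exists>r>0. \<exists>f. f holomorphic_on ball z0 r \<and>
        ((\<forall>z\<in>ball z0 r. F z = Fin (f z)) \<or>
         (\<forall>z\<in>ball z0 r. sphere_inversion (F z) = Fin (f z))))"

text \<open>The projection is a local biholomorphism, so holomorphy on the torus is holomorphy
  of the lift to the plane.\<close>

definition holomorphic_torus_map :: "complex set \<Rightarrow> (complex set \<Rightarrow> csphere) \<Rightarrow> bool" where
  "holomorphic_torus_map \<Lambda> \<Theta> \<longleftrightarrow> holomorphic_to_sphere (\<Theta> \<circ> torus_proj \<Lambda>)"

definition lattes_map :: "(csphere \<Rightarrow> csphere) \<Rightarrow> bool" where
  "lattes_map R \<longleftrightarrow>
     (\<exists>d\<ge>2. rational_map_of_degree d R) \<and>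
     (\<exists>\<Lambda> L \<Theta>. is_lattice \<Lambda> \<and> affine_torus_map \<Lambda> L \<and> holomorphic_torus_map \<Lambda> \<Theta> \<and>
        \<not> \<Theta> constant_on torus \<Lambda> \<and> (\<forall>x\<in>torus \<Lambda>. R (\<Theta> x) = \<Theta> (L x)))"

end

theory Submission
  imports Defs "HOL-Computational_Algebra.Fundamental_Theorem_Algebra"
begin

text \<open>Let \<open>\<phi>\<close> be a non-zero integrable fixed point of the Ruelle operator on the Julia set \<open>J\<close>.
By change of variables the operator \<open>\<Sum>\<^sub>i |\<phi>(\<zeta>\<^sub>i)| |\<zeta>\<^sub>i'|\<^sup>2\<close> preserves the integral of
\<open>|\<phi>|\<close>, so the triangle inequality for the fixed point equation is an equality almost everywhere:
all terms of the sum have the argument of \<open>\<phi>\<close>. Consequently \<open>|\<phi>|\<close> is the density of an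
\<open>R\<close>-invariant measure, and the unimodular function \<open>\<mu> = cnj \<phi> / |\<phi>|\<close> satisfies
\<open>\<mu> = (\<mu> \<circ> R) cnj R' / R'\<close> on the support of \<open>\<phi>\<close>; such \<open>\<phi>\<close> are called aligned here
(\<open>ruelle_fixed_imp_aligned\<close>). Two independent arguments then give a contradiction.

\<^bold>\<open>There is an ergodic component.\<close> If not, the support splits into arbitrarily many disjoint
invariant sets of positive measure, and restricting \<open>\<mu>\<close> (extended to the grand orbit of the
support) to them gives arbitrarily many linearly independent invariant Beltrami coefficients
supported on \<open>J\<close>. But these form a finite-dimensional space
(\<open>invariant_beltrami_dependent\<close>). Indeed, a bounded \<open>m\<close> has a potential, a continuous vector
field \<open>v\<close> of growth \<open>O(|z|\<^sup>2)\<close> whose derivative with respect to \<open>cnj z\<close> is \<open>-\<pi> m\<close> in the weak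
sense. Invariance of \<open>m\<close> makes \<open>v \<circ> R - R' v\<close> holomorphic where \<open>R\<close> is finite; clearing
denominators gives a polynomial whose degree is bounded in terms of \<open>R\<close> only
(\<open>variation_polynomial\<close>). So, in a space of large dimension, some \<open>m\<close> other than \<open>0\<close> has
\<open>v \<circ> R = R' v\<close>. Near a point where \<open>v \<noteq> 0\<close> this equation bounds the spherical derivatives of all
iterates, which are then equicontinuous; hence \<open>v = 0\<close> on \<open>J\<close>
(\<open>invariant_field_zero_on_julia\<close>). Off \<open>J\<close> the field is holomorphic, and three further linear
conditions on \<open>m\<close> let the maximum principle give \<open>v = 0\<close> everywhere
(\<open>zero_outside_imp_zero\<close>), so \<open>m = 0\<close> (\<open>potential_eq_0_imp_AE_0\<close>).

\<^bold>\<open>There is no ergodic component.\<close> Let \<open>\<nu>\<close> be the normalised restriction of \<open>|\<phi>|\<close> to one. Iterating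
the invariance of \<open>\<mu>\<close> gives \<open>\<mu> \<circ> R\<^sup>n = \<mu> (R\<^sup>n)' / cnj (R\<^sup>n)'\<close>. By the M-condition the right
hand sides cluster, in measure on a set \<open>A\<close>, at some function \<open>H\<close>, whereas by mixing
\<open>\<mu> \<circ> R\<^sup>n\<close> takes on any subset of \<open>A\<close> of positive measure all the essential values that \<open>\<mu>\<close> has on
\<open>A\<close>. So \<open>\<mu>\<close> is constant on \<open>A\<close> (\<open>mixing_precompact_imp_constant\<close>). Therefore
\<open>(R\<^sup>n)'\<close> is real at the points of \<open>A\<close> that return to \<open>A\<close> at time \<open>n\<close>, a set of positive area for
large \<open>n\<close> by mixing again. A holomorphic function that is real on a set of positive area is
constant, so \<open>R\<^sup>n\<close> is affine, hence injective, which a map of degree at least two is not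
(\<open>orb_deriv_real_null\<close>, \<open>ergodic_contradiction\<close>).\<close>

section \<open>Change of variables for holomorphic maps\<close>

text \<open>The measure-preserving identification of \<open>\<complex>\<close> with \<open>\<real>\<^sup>2\<close> makes the change of variables
formula for maps of \<open>\<real>\<^sup>n\<close> applicable to functions of a complex variable.\<close>

definition c2v :: "complex \<Rightarrow> real^2" where "c2v z = vector [Re z, Im z]"
definition v2c :: "real^2 \<Rightarrow> complex" where "v2c v = Complex (v$1) (v$2)"

lemma v2c_c2v [simp]: "v2c (c2v z) = z" and c2v_v2c [simp]: "c2v (v2c v) = v"
  by (simp_all add: c2v_def v2c_def vec_eq_iff forall_2)

lemma linear_c2v: "linear c2v"
  by (rule linearI) (simp_all add: c2v_def vec_eq_iff forall_2)

lemma linear_v2c: "linear v2c"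
  by (rule linearI) (simp_all add: v2c_def complex_eq_iff)

lemma bounded_linear_c2v: "bounded_linear c2v" and bounded_linear_v2c: "bounded_linear v2c"
  using linear_c2v linear_v2c linear_conv_bounded_linear by blast+

lemma measurable_c2v [measurable]: "c2v \<in> borel_measurable borel"
  and measurable_v2c [measurable]: "v2c \<in> borel_measurable borel"
  using bounded_linear_c2v bounded_linear_v2c
  by (auto intro!: borel_measurable_continuous_onI linear_continuous_on)

lemma inj_c2v: "inj c2v"
  by (metis injI v2c_c2v)

lemma c2v_image: "c2v ` A = v2c -` A"
  by (force simp: image_iff)

lemma lborel_distr_c2v: "distr lborel borel c2v = lborel"
proof (rule sym, rule lborel_eqI)
  fix l u :: "real^2" assume le: "\<And>b. b \<in> Basis \<Longrightarrow> l \<bullet> b \<le> u \<bullet> b"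
  have B: "(Basis :: (real^2) set) = {axis 1 1, axis 2 1}"
    unfolding Basis_vec_def by (auto simp: exhaust_2) (metis exhaust_2)
  have ne: "axis (1::2) (1::real) \<noteq> axis 2 1"
    by (simp add: axis_eq_axis)
  have le': "l$1 \<le> u$1" "l$2 \<le> u$2"
    using le[of "axis 1 1"] le[of "axis 2 1"] by (auto simp: B inner_axis)
  have pre: "c2v -` box l u = box (v2c l) (v2c u)"
    by (auto simp: box_def B inner_axis c2v_def v2c_def Basis_complex_def)
  have "emeasure (distr lborel borel c2v) (box l u) = emeasure lborel (box (v2c l) (v2c u))"
    by (subst emeasure_distr) (auto simp: pre)
  also have "\<dots> = ennreal (\<Prod>b\<in>Basis. (v2c u - v2c l) \<bullet> b)"
    by (rule emeasure_lborel_box) (use le' in \<open>auto simp: Basis_complex_def v2c_def\<close>)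
  also have "(\<Prod>b\<in>Basis. (v2c u - v2c l) \<bullet> b) = (\<Prod>b\<in>Basis. (u - l) \<bullet> b)"
    using ne by (simp add: B Basis_complex_def v2c_def inner_axis)
  finally show "emeasure (distr lborel borel c2v) (box l u) = ennreal (\<Prod>b\<in>Basis. (u - l) \<bullet> b)" .
qed simp

lemma emeasure_lborel_c2v_image:
  assumes "A \<in> sets borel" shows "emeasure lborel (c2v ` A) = emeasure lborel A"
proof -
  have "v2c -` A \<in> sets borel" using assms measurable_sets_borel[OF measurable_v2c] by simp
  moreover have "c2v -` (v2c -` A) = A" by auto
  ultimately show ?thesis
    unfolding c2v_image by (subst lborel_distr_c2v[symmetric]) (simp add: emeasure_distr)
qed

text \<open>The Jacobian of multiplication by \<open>d\<close>, and so of a holomorphic map with derivative \<open>d\<close>.\<close>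

lemma det_complex_mult: "det (matrix (\<lambda>h. c2v (d * v2c h))) = (cmod d)\<^sup>2"
  unfolding cmod_power2 by (simp add: det_2 matrix_def c2v_def v2c_def axis_def power2_eq_square)

lemma emeasure_holomorphic_image:
  fixes r r' :: "complex \<Rightarrow> complex"
  assumes S: "S \<in> sets borel" and bS: "bounded S"
    and der: "\<And>z. z \<in> S \<Longrightarrow> (r has_field_derivative r' z) (at z)"
    and inj: "inj_on r S" and r'm[measurable]: "r' \<in> borel_measurable borel"
    and bd: "\<And>z. z \<in> S \<Longrightarrow> cmod (r' z) \<le> M" and rS: "r ` S \<in> sets borel"
  shows "emeasure lborel (r ` S) = (\<integral>\<^sup>+z\<in>S. ennreal ((cmod (r' z))\<^sup>2) \<partial>lborel)"
proof -
  note [measurable] = S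
  define S' where "S' = c2v ` S"
  have S'm[measurable]: "S' \<in> sets borel"
    unfolding S'_def c2v_image using measurable_sets_borel[OF measurable_v2c S] by simp
  define f where "f = (\<lambda>x. c2v (r (v2c x)))"
  define f' where "f' = (\<lambda>x h. c2v (r' (v2c x) * v2c h))"
  have derf: "(f has_derivative f' x) (at x within S')" if "x \<in> S'" for x
  proof -
    have "v2c x \<in> S" using that by (auto simp: S'_def)
    then have "(r has_derivative (\<lambda>h. r' (v2c x) * h)) (at (v2c x))"
      using der by (simp add: has_field_derivative_def)
    from bounded_linear.has_derivative[OF bounded_linear_c2v
        has_derivative_compose[OF bounded_linear_imp_has_derivative[OF bounded_linear_v2c] this]]
    show ?thesis unfolding f_def f'_def by (rule has_derivative_at_withinI)
  qed
  have det: "\<bar>det (matrix (f' x))\<bar> = (cmod (r' (v2c x)))\<^sup>2" for x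
    unfolding f'_def det_complex_mult by simp
  have injf: "inj_on f S'"
    using inj by (auto simp: inj_on_def f_def S'_def) (metis v2c_c2v)
  have fS': "f ` S' = c2v ` (r ` S)" by (simp add: S'_def f_def image_image)
  let ?I = "\<integral>\<^sup>+z\<in>S. ennreal ((cmod (r' z))\<^sup>2) \<partial>lborel"
  have I2: "?I = (\<integral>\<^sup>+x\<in>S'. ennreal ((cmod (r' (v2c x)))\<^sup>2) \<partial>lborel)"
  proof -
    have "(\<lambda>x. ennreal ((cmod (r' (v2c x)))\<^sup>2) * indicator S' x) \<in> borel_measurable borel"
      by measurable
    then show ?thesis
      by (subst lborel_distr_c2v[symmetric], subst nn_integral_distr)
         (auto intro!: nn_integral_cong simp: S'_def indicator_def inj_image_mem_iff[OF inj_c2v])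
  qed
  have fin: "?I < \<infinity>"
  proof -
    have "?I \<le> (\<integral>\<^sup>+z. ennreal (M\<^sup>2) * indicator S z \<partial>lborel)"
      by (intro nn_integral_mono) (auto split: split_indicator intro!: ennreal_leI power_mono bd)
    also have "\<dots> = ennreal (M\<^sup>2) * emeasure lborel S" by (simp add: nn_integral_cmult_indicator)
    also have "\<dots> < \<infinity>" using emeasure_bounded_finite[OF bS] by (simp add: ennreal_mult_less_top)
    finally show ?thesis .
  qed
  define h where "h = (\<lambda>x. (cmod (r' (v2c x)))\<^sup>2 * indicator S' x)"
  have hI: "(\<integral>\<^sup>+x. ennreal (h x) \<partial>lborel) = ?I"
    unfolding I2 h_def by (intro nn_integral_cong) (auto split: split_indicator)
  have "integrable lborel h"
    by (rule integrableI_nonneg) (use fin hI in \<open>auto simp: h_def\<close>)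
  then have hi: "(h has_integral (integral\<^sup>L lborel h)) UNIV"
    by (rule has_integral_integral_lborel)
  then have "((\<lambda>x. \<bar>det (matrix (f' x))\<bar>) has_integral (integral\<^sup>L lborel h)) S'"
    unfolding det h_def
    by (subst has_integral_restrict_UNIV[symmetric]) (simp add: indicator_def of_bool_def if_distrib cong: if_cong)
  then have "f ` S' \<in> lmeasurable \<and> measure lebesgue (f ` S') = integral\<^sup>L lborel h"
    using has_measure_differentiable_image[of S' f f', OF _ derf injf] S'm by simp
  then have "emeasure lebesgue (f ` S') = ennreal (integral\<^sup>L lborel h)"
    using emeasure_eq_measure2 by metis
  also have "\<dots> = (\<integral>\<^sup>+x. ennreal (h x) \<partial>lborel)"
    using \<open>integrable lborel h\<close> by (subst nn_integral_eq_integral) (auto simp: h_def)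
  also have "\<dots> = ?I" by (rule hI)
  finally have "emeasure lebesgue (f ` S') = ?I" .
  moreover have "emeasure lebesgue (f ` S') = emeasure lborel (r ` S)"
  proof -
    have "c2v ` (r ` S) \<in> sets borel"
      unfolding c2v_image using measurable_sets_borel[OF measurable_v2c rS] by simp
    then show ?thesis unfolding fS' using emeasure_lborel_c2v_image[OF rS] by simp
  qed
  ultimately show ?thesis by simp
qed

text \<open>The second form says that \<open>r\<close> pushes the density \<open>|r'|\<^sup>2\<close> on \<open>B\<close> forward to Lebesgue
measure on the image. It also serves for integrals of complex-valued functions.\<close>

lemma nn_integral_holomorphic_image:
  fixes r r' :: "complex \<Rightarrow> complex"
  assumes B: "open B" and bB: "bounded B"
    and der: "\<And>z. z \<in> B \<Longrightarrow> (r has_field_derivative r' z) (at z)"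
    and inj: "inj_on r B" and rm[measurable]: "r \<in> borel_measurable borel"
    and r'm[measurable]: "r' \<in> borel_measurable borel"
    and bd: "\<And>z. z \<in> B \<Longrightarrow> cmod (r' z) \<le> M"
    and F[measurable]: "F \<in> borel_measurable borel"
  shows "(\<integral>\<^sup>+z\<in>B. F (r z) * ennreal ((cmod (r' z))\<^sup>2) \<partial>lborel) = (\<integral>\<^sup>+s\<in>r ` B. F s \<partial>lborel)"
    and "distr (density lborel (\<lambda>z. ennreal ((cmod (r' z))\<^sup>2) * indicator B z)) borel r
       = density lborel (indicator (r ` B))"
proof -
  have hol: "r holomorphic_on B" using der B by (metis holomorphic_on_open)
  have op: "open (r ` B)" using open_mapping_thm3[OF hol B inj] .
  then have [measurable]: "r ` B \<in> sets borel" and [measurable]: "B \<in> sets borel" using B by auto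
  show eq: "distr (density lborel (\<lambda>z. ennreal ((cmod (r' z))\<^sup>2) * indicator B z)) borel r
       = density lborel (indicator (r ` B))" (is "?L = ?R")
  proof (rule measure_eqI)
    fix A assume "A \<in> sets ?L"
    then have A[measurable]: "A \<in> sets borel" by simp
    have rA[measurable]: "r -` A \<in> sets borel" using measurable_sets_borel[OF rm A] .
    have im: "r ` (B \<inter> r -` A) = r ` B \<inter> A" by auto
    have "emeasure ?L A = (\<integral>\<^sup>+z\<in>r -` A. ennreal ((cmod (r' z))\<^sup>2) * indicator B z \<partial>lborel)"
      by (simp add: emeasure_distr emeasure_density)
    also have "\<dots> = (\<integral>\<^sup>+z\<in>B \<inter> r -` A. ennreal ((cmod (r' z))\<^sup>2) \<partial>lborel)"
      by (intro nn_integral_cong) (auto split: split_indicator)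
    also have "\<dots> = emeasure lborel (r ` (B \<inter> r -` A))"
    proof (rule emeasure_holomorphic_image[symmetric])
      show "bounded (B \<inter> r -` A)" using bB by (meson Int_lower1 bounded_subset)
      show "inj_on r (B \<inter> r -` A)" using inj by (meson Int_lower1 inj_on_subset)
      show "cmod (r' z) \<le> M" if "z \<in> B \<inter> r -` A" for z using bd that by blast
      show "r ` (B \<inter> r -` A) \<in> sets borel" unfolding im by measurable
    qed (use der in auto)
    also have "\<dots> = (\<integral>\<^sup>+s. indicator (r ` B \<inter> A) s \<partial>lborel)"
      unfolding im by simp
    also have "\<dots> = (\<integral>\<^sup>+s\<in>A. indicator (r ` B) s \<partial>lborel)"
      by (intro nn_integral_cong) (auto split: split_indicator)
    also have "\<dots> = emeasure ?R A"
      by (simp add: emeasure_density)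
    finally show "emeasure ?L A = emeasure ?R A" .
  qed simp
  have "(\<integral>\<^sup>+s\<in>r ` B. F s \<partial>lborel) = (\<integral>\<^sup>+s. F s \<partial>?R)"
    by (simp add: nn_integral_density mult.commute)
  also have "\<dots> = (\<integral>\<^sup>+z\<in>B. F (r z) * ennreal ((cmod (r' z))\<^sup>2) \<partial>lborel)"
    unfolding eq[symmetric] by (simp add: nn_integral_distr nn_integral_density mult_ac)
  finally show "(\<integral>\<^sup>+z\<in>B. F (r z) * ennreal ((cmod (r' z))\<^sup>2) \<partial>lborel) = (\<integral>\<^sup>+s\<in>r ` B. F s \<partial>lborel)" ..
qed

text \<open>Integration along the fibres of a map that is not injective: the domain is cut into countably
many disjoint Borel pieces on which \<open>r\<close> is injective, the local formula is applied to each piece,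
and a fibre meets each piece at most once.\<close>

lemma nn_integral_fibres:
  fixes r r' :: "complex \<Rightarrow> complex" and f :: "complex \<Rightarrow> ennreal"
  assumes X: "open X" and Xn: "- X \<in> null_sets lborel"
    and der: "\<And>z. z \<in> X \<Longrightarrow> (r has_field_derivative r' z) (at z)"
    and nz: "\<And>z. z \<in> X \<Longrightarrow> r' z \<noteq> 0"
    and rm[measurable]: "r \<in> borel_measurable borel"
    and r'm[measurable]: "r' \<in> borel_measurable borel"
    and fin: "\<And>s. finite {w \<in> X. r w = s}"
    and f[measurable]: "f \<in> borel_measurable borel"
  shows "(\<lambda>s. \<Sum>w\<in>{w \<in> X. r w = s}. f w / ennreal ((cmod (r' w))\<^sup>2)) \<in> borel_measurable borel"
    and "(\<integral>\<^sup>+z. f z \<partial>lborel)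
       = (\<integral>\<^sup>+s. (\<Sum>w\<in>{w \<in> X. r w = s}. f w / ennreal ((cmod (r' w))\<^sup>2)) \<partial>lborel)"
proof -
  have hol: "r holomorphic_on X" using der X by (metis holomorphic_on_open)
  have dr: "deriv r z = r' z" if "z \<in> X" for z using der[OF that] by (rule DERIV_imp_deriv)
  have ex: "\<exists>e>0. cball z e \<subseteq> X \<and> inj_on r (ball z e)" if z: "z \<in> X" for z
  proof -
    obtain e where "e > 0" "ball z e \<subseteq> X" "inj_on r (ball z e)"
      using has_complex_derivative_locally_invertible[OF hol z X] dr[OF z] nz[OF z] by metis
    then show ?thesis
      by (intro exI[of _ "e/2"]) (auto intro: inj_on_subset)
  qed
  define \<F> where "\<F> = {ball z e |z e. 0 < e \<and> cball z e \<subseteq> X \<and> inj_on r (ball z e)}"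
  have "\<And>S. S \<in> \<F> \<Longrightarrow> open S" by (auto simp: \<F>_def)
  then obtain \<F>' where F': "\<F>' \<subseteq> \<F>" "countable \<F>'" "\<Union>\<F>' = \<Union>\<F>"
    using Lindelof by metis
  have UF: "\<Union>\<F> = X"
  proof
    show "\<Union>\<F> \<subseteq> X" unfolding \<F>_def using ball_subset_cball by fastforce
    show "X \<subseteq> \<Union>\<F>"
    proof
      fix z assume "z \<in> X"
      with ex obtain e where "e > 0" "cball z e \<subseteq> X" "inj_on r (ball z e)" by blast
      then show "z \<in> \<Union>\<F>" unfolding \<F>_def by (auto intro!: exI[of _ "ball z e"])
    qed
  qed
  have "X \<noteq> {}" using Xn by (auto simp: null_sets_def)
  then have ne: "\<F>' \<noteq> {}" using F'(3) UF by auto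
  define B where "B = from_nat_into \<F>'"
  have BF: "B k \<in> \<F>" for k using from_nat_into[OF ne] F'(1) by (auto simp: B_def)
  have UB: "(\<Union>k. B k) = X"
    using range_from_nat_into[OF ne F'(2)] F'(3) UF by (simp add: B_def)
  have B: "open (B k)" "bounded (B k)" "B k \<subseteq> X" "inj_on r (B k)" for k
    using BF[of k] ball_subset_cball unfolding \<F>_def by auto
  have Bbd: "\<exists>M. \<forall>z\<in>B k. cmod (r' z) \<le> M" for k
  proof -
    obtain z e where ze: "B k = ball z e" "cball z e \<subseteq> X" using BF[of k] unfolding \<F>_def by auto
    have "continuous_on X (deriv r)"
      using holomorphic_deriv[OF hol X] by (rule holomorphic_on_imp_continuous_on)
    then have "compact (deriv r ` cball z e)"
      using ze(2) by (intro compact_continuous_image) (auto intro: continuous_on_subset)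
    then obtain M where M: "\<forall>x\<in>deriv r ` cball z e. norm x \<le> M"
      using compact_imp_bounded bounded_iff by metis
    then have "cmod (r' w) \<le> M" if "w \<in> B k" for w
    proof -
      have w: "w \<in> cball z e" using that ze ball_subset_cball by blast
      then have "w \<in> X" using ze by blast
      then show ?thesis using M w dr[of w] by force
    qed
    then show ?thesis by blast
  qed
  define D where "D = disjointed B"
  have D: "disjoint_family D" "(\<Union>k. D k) = X" "D k \<subseteq> B k" for k
    by (auto simp: D_def disjoint_family_disjointed UN_disjointed_eq UB disjointed_subset)
  have [measurable]: "B k \<in> sets borel" for k using B(1) by auto
  have [measurable]: "D k \<in> sets borel" for k
  proof -
    have "range B \<subseteq> sets borel" using B(1) by auto
    then have "range (disjointed B) \<subseteq> sets borel" by (rule sets.range_disjointed_sets)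
    then show ?thesis unfolding D_def by blast
  qed
  have [measurable]: "X \<in> sets borel" using X by auto
  define c where "c w = f w / ennreal ((cmod (r' w))\<^sup>2)" for w
  have cm[measurable]: "c \<in> borel_measurable borel" unfolding c_def by measurable
  define g where "g k s = (\<Sum>w\<in>{w \<in> X. r w = s}. c w * indicator (D k) w)" for k s
  have opim: "open (r ` B k)" for k
    using open_mapping_thm3[OF holomorphic_on_subset[OF hol B(3)] B(1) B(4)] .
  have [measurable]: "r ` B k \<in> sets borel" for k using opim by auto
  have piece: "g k \<in> borel_measurable borel \<and> (\<integral>\<^sup>+z\<in>D k. f z \<partial>lborel) = (\<integral>\<^sup>+s. g k s \<partial>lborel)" for k
  proof -
    obtain h where h: "h holomorphic_on (r ` B k)" "\<And>z. z \<in> B k \<Longrightarrow> h (r z) = z"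
      using holomorphic_has_inverse[OF holomorphic_on_subset[OF hol B(3)] B(1) B(4)] by metis
    define h' where "h' s = (if s \<in> r ` B k then h s else 0)" for s
    have hm[measurable]: "h' \<in> borel_measurable borel"
      unfolding h'_def
      by (rule borel_measurable_continuous_on_if)
         (use opim holomorphic_on_imp_continuous_on[OF h(1)] in auto)
    define F where "F s = c (h' s) * indicator (D k) (h' s)" for s
    have Fm[measurable]: "F \<in> borel_measurable borel" unfolding F_def by measurable
    have gF: "g k s = F s * indicator (r ` B k) s" for s
    proof (cases "\<exists>w0\<in>D k. r w0 = s")
      case True
      then obtain w0 where w0: "w0 \<in> D k" "r w0 = s" by blast
      then have w0B: "w0 \<in> B k" "w0 \<in> X" using D(2,3) by blast+
      have "g k s = (\<Sum>w\<in>{w \<in> X. r w = s}. if w = w0 then c w0 else 0)"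
        unfolding g_def
      proof (rule sum.cong[OF refl])
        fix w assume "w \<in> {w \<in> X. r w = s}"
        then show "c w * indicator (D k) w = (if w = w0 then c w0 else 0)"
          using w0 w0B B(4)[of k] D(3)[of k] by (auto simp: indicator_def inj_on_def)
      qed
      also have "\<dots> = c w0" using w0 w0B fin[of s] by (simp add: sum.delta)
      also have "\<dots> = F s * indicator (r ` B k) s"
        using w0 w0B h(2)[OF w0B(1)] by (auto simp: F_def h'_def indicator_def)
      finally show ?thesis .
    next
      case False
      then have "g k s = 0" unfolding g_def by (intro sum.neutral) (auto simp: indicator_def)
      moreover have "F s * indicator (r ` B k) s = 0"
        using False h(2) by (auto simp: F_def h'_def indicator_def)
      ultimately show ?thesis by simp
    qed
    have gm: "g k \<in> borel_measurable borel" unfolding gF by measurable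
    obtain M where M: "\<And>z. z \<in> B k \<Longrightarrow> cmod (r' z) \<le> M" using Bbd by blast
    have "(\<integral>\<^sup>+s. g k s \<partial>lborel) = (\<integral>\<^sup>+z\<in>B k. F (r z) * ennreal ((cmod (r' z))\<^sup>2) \<partial>lborel)"
      unfolding gF
      by (rule nn_integral_holomorphic_image(1)[symmetric, OF B(1,2) _ B(4) rm r'm M Fm])
         (use der B(3) in auto)
    also have "\<dots> = (\<integral>\<^sup>+z\<in>D k. f z \<partial>lborel)"
    proof (rule nn_integral_cong)
      fix z
      show "F (r z) * ennreal ((cmod (r' z))\<^sup>2) * indicator (B k) z = f z * indicator (D k) z"
      proof (cases "z \<in> D k")
        case True
        then have zB: "z \<in> B k" "z \<in> X" using D(2,3) by blast+
        have "r' z \<noteq> 0" using nz zB by auto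
        then have p: "ennreal ((cmod (r' z))\<^sup>2) \<noteq> 0" "ennreal ((cmod (r' z))\<^sup>2) \<noteq> \<infinity>" by auto
        have "F (r z) = c z" using True zB h(2)[OF zB(1)] by (simp add: F_def h'_def)
        then show ?thesis using True zB p
          by (simp add: c_def ennreal_divide_times ennreal_divide_self)
      next
        case z: False
        show ?thesis
        proof (cases "z \<in> B k")
          case True
          then have "h' (r z) = z" using h(2)[OF True] by (simp add: h'_def)
          then show ?thesis using z by (simp add: F_def)
        qed (use z in simp)
      qed
    qed
    finally show ?thesis using gm by simp
  qed
  have gsum: "(\<Sum>k. g k s) = (\<Sum>w\<in>{w \<in> X. r w = s}. c w)" for s
  proof -
    have "(\<Sum>k. g k s) = (\<Sum>w\<in>{w \<in> X. r w = s}. \<Sum>k. c w * indicator (D k) w)"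
      unfolding g_def by (rule suminf_sum) auto
    also have "\<dots> = (\<Sum>w\<in>{w \<in> X. r w = s}. c w)"
    proof (rule sum.cong[OF refl])
      fix w assume "w \<in> {w \<in> X. r w = s}"
      then obtain i where "w \<in> D i" using D(2) by blast
      then show "(\<Sum>k. c w * indicator (D k) w) = c w"
        using suminf_cmult_indicator[OF D(1), of w i "\<lambda>_. c w"] by simp
    qed
    finally show ?thesis .
  qed
  show "(\<lambda>s. \<Sum>w\<in>{w \<in> X. r w = s}. f w / ennreal ((cmod (r' w))\<^sup>2)) \<in> borel_measurable borel"
  proof -
    have [measurable]: "g k \<in> borel_measurable borel" for k using piece by blast
    have "(\<lambda>s. \<Sum>k. g k s) \<in> borel_measurable borel" by measurable
    then show ?thesis unfolding gsum c_def .
  qed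
  have "(\<integral>\<^sup>+z. f z \<partial>lborel) = (\<integral>\<^sup>+z\<in>X. f z \<partial>lborel)"
    by (rule nn_integral_cong_AE)
       (use AE_not_in[OF Xn] in \<open>auto elim!: eventually_mono\<close>)
  also have "\<dots> = (\<integral>\<^sup>+z. (\<Sum>k. f z * indicator (D k) z) \<partial>lborel)"
  proof (rule nn_integral_cong)
    fix z
    show "f z * indicator X z = (\<Sum>k. f z * indicator (D k) z)"
    proof (cases "z \<in> X")
      case True
      then obtain i where "z \<in> D i" using D(2) by blast
      then show ?thesis
        using True suminf_cmult_indicator[OF D(1), of z i "\<lambda>_. f z"] by simp
    next
      case False
      then have "z \<notin> D k" for k using D(2) by blast
      then show ?thesis using False by simp
    qed
  qed
  also have "\<dots> = (\<Sum>k. (\<integral>\<^sup>+z\<in>D k. f z \<partial>lborel))"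
    by (rule nn_integral_suminf) auto
  also have "\<dots> = (\<Sum>k. (\<integral>\<^sup>+s. g k s \<partial>lborel))" using piece by simp
  also have "\<dots> = (\<integral>\<^sup>+s. (\<Sum>k. g k s) \<partial>lborel)"
    by (rule nn_integral_suminf[symmetric]) (use piece in auto)
  finally show "(\<integral>\<^sup>+z. f z \<partial>lborel)
       = (\<integral>\<^sup>+s. (\<Sum>w\<in>{w \<in> X. r w = s}. f w / ennreal ((cmod (r' w))\<^sup>2)) \<partial>lborel)"
    unfolding gsum c_def .
qed

section \<open>Estimates for the Cauchy kernel\<close>

lemma ball_borel [measurable]: "ball (c::complex) r \<in> sets borel"
  by simp

lemma emeasure_ball_complex: "0 \<le> r \<Longrightarrow> emeasure lborel (ball (c::complex) r) = ennreal (pi * r\<^sup>2)"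
  by (simp add: emeasure_ball unit_ball_vol_2)

lemma term_le_suminf_ennreal: "(f k :: ennreal) \<le> (\<Sum>k. f k)"
  using sum_le_suminf[of f "{k}"] by simp

text \<open>The dyadic balls \<open>|t - a| < \<delta> / 2\<^sup>k\<close> have area \<open>\<pi> \<delta>\<^sup>2 / 4\<^sup>k\<close>, and on the annulus between two
consecutive ones the integrand is at most \<open>2\<^sup>k\<^sup>+\<^sup>1 / \<delta>\<close>, so a geometric series bounds the
integral.\<close>

lemma nn_integral_inverse_norm_ball:
  fixes a :: complex assumes "0 < \<delta>"
  shows "(\<integral>\<^sup>+t\<in>ball a \<delta>. ennreal (1 / cmod (t - a)) \<partial>lborel) \<le> ennreal (4 * pi * \<delta>)"
proof -
  have "(\<integral>\<^sup>+t\<in>ball a \<delta>. ennreal (1 / cmod (t - a)) \<partial>lborel)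
     \<le> (\<integral>\<^sup>+t. (\<Sum>k. ennreal (2^(k+1) / \<delta>) * indicator (ball a (\<delta> / 2^k)) t) \<partial>lborel)"
  proof (rule nn_integral_mono)
    fix t :: complex
    show "ennreal (1 / cmod (t - a)) * indicator (ball a \<delta>) t
       \<le> (\<Sum>k. ennreal (2^(k+1) / \<delta>) * indicator (ball a (\<delta> / 2^k)) t)"
    proof (cases "t \<in> ball a \<delta> \<and> t \<noteq> a")
      case True
      then have pos: "0 < cmod (t - a)" by simp
      define P where "P n \<longleftrightarrow> \<delta> / 2^n \<le> cmod (t - a)" for n :: nat
      have "\<exists>n. P n"
      proof -
        obtain n where "\<delta> / cmod (t - a) < 2 ^ n"
          using real_arch_pow[of 2 "\<delta> / cmod (t - a)"] by auto
        then show ?thesis unfolding P_def using pos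
          by (intro exI[of _ n]) (simp add: field_simps)
      qed
      then have P: "P (LEAST n. P n)" by (rule LeastI_ex)
      have "\<not> P 0" using True by (simp add: P_def dist_norm norm_minus_commute)
      then obtain k where k: "(LEAST n. P n) = Suc k" using P by (metis not0_implies_Suc)
      then have nk: "\<not> P k" and Pk: "P (Suc k)" using not_less_Least[of k P] P by simp_all
      have "t \<in> ball a (\<delta> / 2^k)" using nk by (simp add: P_def dist_norm norm_minus_commute)
      moreover have "1 / cmod (t - a) \<le> 2^(k+1) / \<delta>"
        using Pk pos assms unfolding P_def by (simp add: field_simps)
      ultimately have "ennreal (1 / cmod (t - a)) * indicator (ball a \<delta>) t
          \<le> ennreal (2^(k+1) / \<delta>) * indicator (ball a (\<delta> / 2^k)) t"
        using True by (simp add: ennreal_leI)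
      also have "\<dots> \<le> (\<Sum>k. ennreal (2^(k+1) / \<delta>) * indicator (ball a (\<delta> / 2^k)) t)"
        by (rule term_le_suminf_ennreal)
      finally show ?thesis .
    qed auto
  qed
  also have "\<dots> = (\<Sum>k. ennreal (2^(k+1) / \<delta>) * emeasure lborel (ball a (\<delta> / 2^k)))"
    by (subst nn_integral_suminf) (auto simp: nn_integral_cmult_indicator)
  also have "\<dots> = (\<Sum>k. ennreal (2 * pi * \<delta> * (1/2)^k))"
    using assms
    by (simp add: emeasure_ball_complex ennreal_mult[symmetric])
       (simp add: field_simps power2_eq_square)
  also have "\<dots> = ennreal (4 * pi * \<delta>)"
  proof (rule suminf_ennreal_eq)
    have "(\<lambda>k. 2 * pi * \<delta> * (1/2)^k) sums (2 * pi * \<delta> * (1 / (1 - 1/2)))"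
      by (intro sums_mult geometric_sums) auto
    then show "(\<lambda>k. 2 * pi * \<delta> * (1/2)^k) sums (4 * pi * \<delta>)" by (simp add: field_simps)
  qed (use assms in auto)
  finally show ?thesis .
qed

lemma nn_integral_inverse_norm_cube:
  fixes a :: complex
  shows "(\<integral>\<^sup>+t\<in>- ball a 1. ennreal (1 / cmod (t - a)^3) \<partial>lborel) \<le> ennreal (8 * pi)"
proof -
  have "(\<integral>\<^sup>+t\<in>- ball a 1. ennreal (1 / cmod (t - a)^3) \<partial>lborel)
     \<le> (\<integral>\<^sup>+t. (\<Sum>k. ennreal (1 / 8^k) * indicator (ball a (2^(k+1))) t) \<partial>lborel)"
  proof (rule nn_integral_mono)
    fix t :: complex
    show "ennreal (1 / cmod (t - a)^3) * indicator (- ball a 1) t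
       \<le> (\<Sum>k. ennreal (1 / 8^k) * indicator (ball a (2^(k+1))) t)"
    proof (cases "t \<in> - ball a 1")
      case True
      then have ge1: "1 \<le> cmod (t - a)" by (simp add: dist_norm norm_minus_commute)
      define P where "P n \<longleftrightarrow> cmod (t - a) < 2^n" for n :: nat
      have "\<exists>n. P n" unfolding P_def by (rule real_arch_pow) simp
      then have P: "P (LEAST n. P n)" by (rule LeastI_ex)
      have "\<not> P 0" using ge1 by (simp add: P_def)
      then obtain k where k: "(LEAST n. P n) = Suc k" using P by (metis not0_implies_Suc)
      then have nk: "\<not> P k" using not_less_Least[of k P] by simp
      have "t \<in> ball a (2^(k+1))" using P k by (simp add: P_def dist_norm norm_minus_commute)
      moreover have "1 / cmod (t - a)^3 \<le> 1 / 8^k"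
      proof -
        have "(2^k)^3 \<le> cmod (t - a)^3" using nk by (intro power_mono) (auto simp: P_def)
        moreover have "(2^k)^3 = ((2::real)^3)^k" by (metis power_mult mult.commute)
        then have "(2^k)^3 = (8::real)^k" by simp
        moreover have "(0::real) < 8^k" by simp
        ultimately show ?thesis using frac_le[of 1 1 "8^k" "cmod (t - a)^3"] by simp
      qed
      ultimately have "ennreal (1 / cmod (t - a)^3) * indicator (- ball a 1) t
          \<le> ennreal (1 / 8^k) * indicator (ball a (2^(k+1))) t"
        using True by (simp add: ennreal_leI)
      also have "\<dots> \<le> (\<Sum>k. ennreal (1 / 8^k) * indicator (ball a (2^(k+1))) t)"
        by (rule term_le_suminf_ennreal)
      finally show ?thesis .
    qed auto
  qed
  also have "\<dots> = (\<Sum>k. ennreal (1 / 8^k) * emeasure lborel (ball a (2^(k+1))))"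
    by (subst nn_integral_suminf) (auto simp: nn_integral_cmult_indicator)
  also have "\<dots> = (\<Sum>k. ennreal (4 * pi * (1/2)^k))"
  proof -
    have "1 / 8^k * (pi * (2^(k+1))\<^sup>2) = 4 * pi * (1/2)^k" for k :: nat
    proof -
      have "((2::real)^(k+1))\<^sup>2 = 4 * 4^k" by (simp add: power2_eq_square power_mult_distrib[symmetric])
      moreover have "(8::real)^k = 4^k * 2^k" by (simp add: power_mult_distrib[symmetric])
      ultimately show ?thesis by (simp add: field_simps)
    qed
    then show ?thesis
      by (simp only: emeasure_ball_complex ennreal_mult[symmetric] zero_le_power zero_le_numeral pi_ge_zero
            divide_nonneg_nonneg mult_nonneg_nonneg zero_le_one)
  qed
  also have "\<dots> = ennreal (8 * pi)"
  proof (rule suminf_ennreal_eq)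
    have "(\<lambda>k. 4 * pi * (1/2)^k) sums (4 * pi * (1 / (1 - 1/2)))"
      by (intro sums_mult geometric_sums) auto
    then show "(\<lambda>k. 4 * pi * (1/2)^k) sums (8 * pi)" by (simp add: field_simps)
  qed auto
  finally show ?thesis .
qed

text \<open>The bound is uniform in \<open>a\<close>. Away from \<open>a\<close> it comes from \<open>x\<^sup>2 y \<le> x\<^sup>3 + y\<^sup>3\<close> with
\<open>x = 1 / |t|\<close> and \<open>y = 1 / |t - a|\<close>, which separates the two singularities.\<close>

lemma nn_integral_inverse_norm_far:
  fixes a :: complex
  shows "(\<integral>\<^sup>+t\<in>- ball 0 1. ennreal (1 / (cmod t ^ 2 * cmod (t - a))) \<partial>lborel) \<le> ennreal (20 * pi)"
proof -
  have "(\<integral>\<^sup>+t\<in>- ball 0 1. ennreal (1 / (cmod t ^ 2 * cmod (t - a))) \<partial>lborel)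
     \<le> (\<integral>\<^sup>+t. (ennreal (1 / cmod (t - a)) * indicator (ball a 1) t
          + (ennreal (1 / cmod (t - 0)^3) * indicator (- ball 0 1) t
          + ennreal (1 / cmod (t - a)^3) * indicator (- ball a 1) t)) \<partial>lborel)"
  proof (rule nn_integral_mono)
    fix t :: complex
    show "ennreal (1 / (cmod t ^ 2 * cmod (t - a))) * indicator (- ball 0 1) t
       \<le> ennreal (1 / cmod (t - a)) * indicator (ball a 1) t
          + (ennreal (1 / cmod (t - 0)^3) * indicator (- ball 0 1) t
          + ennreal (1 / cmod (t - a)^3) * indicator (- ball a 1) t)"
    proof (cases "t \<in> - ball 0 1")
      case t: True
      then have t1: "1 \<le> cmod t" by simp
      show ?thesis
      proof (cases "t \<in> ball a 1")
        case True
        have "1 / (cmod t ^ 2 * cmod (t - a)) \<le> 1 / cmod (t - a)"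
          using t1 by (cases "t = a") (auto simp: divide_simps mult_le_cancel_right1 one_le_power)
        then have "ennreal (1 / (cmod t ^ 2 * cmod (t - a))) \<le> ennreal (1 / cmod (t - a))"
          by (rule ennreal_leI)
        then show ?thesis using t True by (simp add: add_increasing2)
      next
        case False
        then have a1: "1 \<le> cmod (t - a)" by (simp add: dist_norm norm_minus_commute)
        define x y where "x = 1 / cmod t" and "y = 1 / cmod (t - a)"
        have xy: "0 \<le> x" "0 \<le> y" by (auto simp: x_def y_def)
        have "x^2 * y \<le> x^3 + y^3"
        proof (cases "x \<le> y")
          case True
          then have "x^2 * y \<le> y^2 * y" using xy by (intro mult_right_mono power_mono) auto
          also have "\<dots> \<le> x^3 + y^3" using xy by (simp add: power3_eq_cube power2_eq_square)
          finally show ?thesis .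
        next
          case False
          then have "x^2 * y \<le> x^2 * x" using xy by (intro mult_left_mono) auto
          also have "\<dots> \<le> x^3 + y^3" using xy by (simp add: power3_eq_cube power2_eq_square)
          finally show ?thesis .
        qed
        then have "1 / (cmod t ^ 2 * cmod (t - a)) \<le> 1 / cmod t^3 + 1 / cmod (t - a)^3"
          by (simp add: x_def y_def power_divide)
        then have "ennreal (1 / (cmod t ^ 2 * cmod (t - a))) \<le> ennreal (1 / cmod t^3) + ennreal (1 / cmod (t - a)^3)"
          by (metis ennreal_leI ennreal_plus divide_nonneg_nonneg norm_ge_zero zero_le_one zero_le_power)
        then show ?thesis using t False by (simp add: add_increasing)
      qed
    qed auto
  qed
  also have "\<dots> = (\<integral>\<^sup>+t\<in>ball a 1. ennreal (1 / cmod (t - a)) \<partial>lborel)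
      + ((\<integral>\<^sup>+t\<in>- ball 0 1. ennreal (1 / cmod (t - 0)^3) \<partial>lborel)
      + (\<integral>\<^sup>+t\<in>- ball a 1. ennreal (1 / cmod (t - a)^3) \<partial>lborel))"
  proof -
    have [measurable]: "(\<lambda>t. ennreal (1 / cmod (t - b)^3) * indicator (- ball b 1) t) \<in> borel_measurable borel" for b
      by measurable
    have [measurable]: "(\<lambda>t. ennreal (1 / cmod (t - a)) * indicator (ball a 1) t) \<in> borel_measurable borel"
      by measurable
    show ?thesis by (simp add: nn_integral_add)
  qed
  also have "\<dots> \<le> ennreal (4 * pi * 1) + (ennreal (8 * pi) + ennreal (8 * pi))"
    by (intro add_mono nn_integral_inverse_norm_ball nn_integral_inverse_norm_cube) auto
  also have "\<dots> = ennreal (20 * pi)" by (simp add: ennreal_plus[symmetric] del: ennreal_plus)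
  finally show ?thesis .
qed

lemma nn_integral_inverse_norm_near:
  fixes a :: complex assumes "0 \<le> \<rho>"
  shows "(\<integral>\<^sup>+t\<in>ball c \<rho>. ennreal (1 / cmod (t - a)) \<partial>lborel) \<le> ennreal (4 * pi + pi * \<rho>\<^sup>2)"
proof -
  have "(\<integral>\<^sup>+t\<in>ball c \<rho>. ennreal (1 / cmod (t - a)) \<partial>lborel)
     \<le> (\<integral>\<^sup>+t. (ennreal (1 / cmod (t - a)) * indicator (ball a 1) t + indicator (ball c \<rho>) t) \<partial>lborel)"
  proof (rule nn_integral_mono)
    fix t :: complex
    show "ennreal (1 / cmod (t - a)) * indicator (ball c \<rho>) t
       \<le> ennreal (1 / cmod (t - a)) * indicator (ball a 1) t + indicator (ball c \<rho>) t"
    proof (cases "t \<in> ball a 1")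
      case False
      then have "1 \<le> cmod (t - a)" by (simp add: dist_norm norm_minus_commute)
      then have "1 / cmod (t - a) \<le> 1" using frac_le[of 1 1 1 "cmod (t - a)"] by simp
      then have "ennreal (1 / cmod (t - a)) \<le> 1" using ennreal_leI by fastforce
      then show ?thesis using False by (auto split: split_indicator)
    qed (auto split: split_indicator)
  qed
  also have "\<dots> = (\<integral>\<^sup>+t\<in>ball a 1. ennreal (1 / cmod (t - a)) \<partial>lborel) + emeasure lborel (ball c \<rho>)"
    by (subst nn_integral_add) auto
  also have "\<dots> \<le> ennreal (4 * pi * 1) + ennreal (pi * \<rho>\<^sup>2)"
    using assms by (intro add_mono nn_integral_inverse_norm_ball) (auto simp: emeasure_ball_complex)
  also have "\<dots> = ennreal (4 * pi + pi * \<rho>\<^sup>2)" by simp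
  finally show ?thesis .
qed

text \<open>Cauchy's inequality turns the uniform bound \<open>g\<close> on the integrand into a bound on its difference
quotients, so dominated convergence differentiates under the integral sign.\<close>

lemma holomorphic_on_lebesgue_integral:
  fixes f :: "complex \<Rightarrow> 'a \<Rightarrow> complex"
  assumes U: "open U" and meas: "\<And>z. z \<in> U \<Longrightarrow> f z \<in> borel_measurable M"
    and hol: "\<And>t. t \<in> space M \<Longrightarrow> (\<lambda>z. f z t) holomorphic_on U"
    and bd: "\<And>z t. z \<in> U \<Longrightarrow> t \<in> space M \<Longrightarrow> cmod (f z t) \<le> g t" and g: "integrable M g"
  shows "(\<lambda>z. LINT t|M. f z t) holomorphic_on U"
proof -
  have int: "integrable M (f z)" if "z \<in> U" for z
    by (rule Bochner_Integration.integrable_bound[OF g meas[OF that]])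
       (auto intro!: AE_I2 order_trans[OF bd[OF that] abs_ge_self])
  have "\<exists>D. ((\<lambda>z. LINT t|M. f z t) has_field_derivative D) (at z0)" if z0: "z0 \<in> U" for z0
  proof -
    obtain e where e: "e > 0" "ball z0 e \<subseteq> U" using U z0 by (meson openE)
    define \<delta> where "\<delta> = e / 3"
    have \<delta>: "\<delta> > 0" using e by (simp add: \<delta>_def)
    have sub: "cball w \<delta> \<subseteq> U" if "w \<in> ball z0 \<delta>" for w
    proof
      fix u assume "u \<in> cball w \<delta>"
      then have "dist z0 u \<le> dist z0 w + dist w u" by (metis dist_triangle)
      also have "\<dots> < e" using that \<open>u \<in> cball w \<delta>\<close> e(1) by (simp add: \<delta>_def)
      finally show "u \<in> U" using e by auto
    qed
    have quot: "cmod (f z t - f z0 t) \<le> g t / \<delta> * cmod (z - z0)" if z: "z \<in> ball z0 \<delta>" and t: "t \<in> space M" for z t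
    proof (rule field_differentiable_bound[of "ball z0 \<delta>" "\<lambda>z. f z t" "deriv (\<lambda>z. f z t)"])
      fix w assume w: "w \<in> ball z0 \<delta>"
      then have "w \<in> U" using sub[OF w] \<delta> by auto
      then show "((\<lambda>z. f z t) has_field_derivative deriv (\<lambda>z. f z t) w) (at w within ball z0 \<delta>)"
        using holomorphic_derivI[OF hol[OF t] U] by (metis has_field_derivative_at_within)
      have "cmod ((deriv ^^ 1) (\<lambda>z. f z t) w) \<le> fact 1 * g t / \<delta>^1"
      proof (rule Cauchy_inequality)
        show "(\<lambda>z. f z t) holomorphic_on ball w \<delta>"
          using hol[OF t] sub[OF w] by (meson ball_subset_cball holomorphic_on_subset order_trans)
        show "continuous_on (cball w \<delta>) (\<lambda>z. f z t)"
          using hol[OF t] sub[OF w] by (meson holomorphic_on_imp_continuous_on holomorphic_on_subset)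
        show "cmod (f x t) \<le> g t" if "cmod (w - x) = \<delta>" for x
          using bd[OF _ t] sub[OF w] that by (auto simp: dist_norm subset_iff)
      qed (use \<delta> in auto)
      then show "cmod (deriv (\<lambda>z. f z t) w) \<le> g t / \<delta>" by simp
    qed (use z \<delta> in auto)
    define f' where "f' t = deriv (\<lambda>z. f z t) z0" for t
    have lim: "(\<lambda>n. (f (X n) t - f z0 t) / (X n - z0)) \<longlonglongrightarrow> f' t"
      if "t \<in> space M" "\<And>n. X n \<noteq> z0" "X \<longlonglongrightarrow> z0" for X t
    proof -
      have "((\<lambda>z. f z t) has_field_derivative f' t) (at z0)"
        unfolding f'_def using holomorphic_derivI[OF hol[OF that(1)] U z0] .
      then have "((\<lambda>z. (f z t - f z0 t) / (z - z0)) \<longlongrightarrow> f' t) (at z0)"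
        by (simp add: has_field_derivative_iff)
      then show ?thesis using that unfolding tendsto_at_iff_sequentially comp_def by auto
    qed
    have "((\<lambda>z. ((LINT t|M. f z t) - (LINT t|M. f z0 t)) / (z - z0)) \<longlongrightarrow> (LINT t|M. f' t)) (at z0)"
      unfolding tendsto_at_iff_sequentially comp_def
    proof (intro allI impI)
      fix X assume X: "\<forall>i. X i \<in> UNIV - {z0}" "X \<longlonglongrightarrow> z0"
      then obtain N where N: "\<And>n. n \<ge> N \<Longrightarrow> X n \<in> ball z0 \<delta>"
        using \<delta> by (metis (no_types, lifting) tendsto_def eventually_sequentially open_ball centre_in_ball)
      define Y where "Y n = X (n + N)" for n
      have Y: "Y n \<in> ball z0 \<delta>" "Y n \<noteq> z0" "Y n \<in> U" for n
        using N[of "n + N"] X sub[of "Y n"] \<delta> by (auto simp: Y_def)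
      have YL: "Y \<longlonglongrightarrow> z0" unfolding Y_def using X(2) by (rule LIMSEQ_ignore_initial_segment)
      have "(\<lambda>n. LINT t|M. (f (Y n) t - f z0 t) / (Y n - z0)) \<longlonglongrightarrow> (LINT t|M. f' t)"
      proof (rule integral_dominated_convergence[where w = "\<lambda>t. g t / \<delta>"])
        have qm: "(\<lambda>t. (f (Y n) t - f z0 t) / (Y n - z0)) \<in> borel_measurable M" for n
          using meas[OF Y(3)] meas[OF z0] by measurable
        then show "(\<lambda>t. (f (Y n) t - f z0 t) / (Y n - z0)) \<in> borel_measurable M" for n .
        show "f' \<in> borel_measurable M"
          by (rule borel_measurable_LIMSEQ_metric[OF qm lim]) (use Y YL in auto)
        show "integrable M (\<lambda>t. g t / \<delta>)" using g by simp
        show "AE t in M. (\<lambda>n. (f (Y n) t - f z0 t) / (Y n - z0)) \<longlonglongrightarrow> f' t"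
          by (rule AE_I2, rule lim) (use Y YL in auto)
        show "AE t in M. cmod ((f (Y n) t - f z0 t) / (Y n - z0)) \<le> g t / \<delta>" for n
        proof (rule AE_I2)
          fix t assume "t \<in> space M"
          then show "cmod ((f (Y n) t - f z0 t) / (Y n - z0)) \<le> g t / \<delta>"
            using quot[OF Y(1), of t n] Y(2)[of n] by (simp add: norm_divide divide_le_eq)
        qed
      qed
      moreover have "(LINT t|M. (f (Y n) t - f z0 t) / (Y n - z0))
          = ((LINT t|M. f (Y n) t) - (LINT t|M. f z0 t)) / (Y n - z0)" for n
        using int[OF Y(3)[of n]] int[OF z0] by simp
      ultimately have "(\<lambda>n. ((LINT t|M. f (Y n) t) - (LINT t|M. f z0 t)) / (Y n - z0)) \<longlonglongrightarrow> (LINT t|M. f' t)"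
        by (simp only:)
      then show "(\<lambda>n. ((LINT t|M. f (X n) t) - (LINT t|M. f z0 t)) / (X n - z0)) \<longlonglongrightarrow> (LINT t|M. f' t)"
        unfolding Y_def by (rule LIMSEQ_offset)
    qed
    then show ?thesis by (auto simp: has_field_derivative_iff)
  qed
  then show ?thesis using U by (simp add: holomorphic_on_open)
qed

section \<open>The Cauchy transform\<close>

definition cauchy_transform :: "(complex \<Rightarrow> complex) \<Rightarrow> complex \<Rightarrow> complex" where
  "cauchy_transform g a = (LINT t|lborel. g t / (t - a))"

lemma
  fixes g :: "complex \<Rightarrow> complex"
  assumes gm[measurable]: "g \<in> borel_measurable borel" and K: "\<And>t. cmod (g t) \<le> K"
    and supp: "\<And>t. t \<notin> ball 0 \<rho> \<Longrightarrow> g t = 0" and \<rho>: "0 \<le> \<rho>"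
  shows integrable_cauchy_kernel: "integrable lborel (\<lambda>t. g t / (t - a))"
    and nn_integral_cauchy_kernel: "(\<integral>\<^sup>+t. ennreal (cmod (g t / (t - a))) \<partial>lborel) \<le> ennreal (K * (4 * pi + pi * \<rho>\<^sup>2))"
    and integrable_bounded_supp: "integrable lborel g"
proof -
  have K0: "K \<ge> 0" using K[of 0] norm_ge_zero order_trans by blast
  have "(\<integral>\<^sup>+t. ennreal (cmod (g t / (t - a))) \<partial>lborel)
      \<le> (\<integral>\<^sup>+t. ennreal K * (ennreal (1 / cmod (t - a)) * indicator (ball 0 \<rho>) t) \<partial>lborel)"
  proof (rule nn_integral_mono)
    fix t
    show "ennreal (cmod (g t / (t - a))) \<le> ennreal K * (ennreal (1 / cmod (t - a)) * indicator (ball 0 \<rho>) t)"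
    proof (cases "t \<in> ball 0 \<rho>")
      case True
      have "cmod (g t / (t - a)) \<le> K * (1 / cmod (t - a))"
        using K[of t] by (simp add: norm_divide divide_right_mono)
      then show ?thesis using True K0 by (simp add: ennreal_mult[symmetric] ennreal_leI)
    qed (use supp in auto)
  qed
  also have "\<dots> = ennreal K * (\<integral>\<^sup>+t\<in>ball 0 \<rho>. ennreal (1 / cmod (t - a)) \<partial>lborel)"
    by (rule nn_integral_cmult) measurable
  also have "\<dots> \<le> ennreal K * ennreal (4 * pi + pi * \<rho>\<^sup>2)"
    by (intro mult_left_mono nn_integral_inverse_norm_near \<rho>) auto
  also have "\<dots> = ennreal (K * (4 * pi + pi * \<rho>\<^sup>2))" using K0 by (simp add: ennreal_mult)
  finally show *: "(\<integral>\<^sup>+t. ennreal (cmod (g t / (t - a))) \<partial>lborel) \<le> ennreal (K * (4 * pi + pi * \<rho>\<^sup>2))" .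
  then show "integrable lborel (\<lambda>t. g t / (t - a))"
    by (intro integrableI_bounded) (auto simp: order_le_less_trans)
  have "(\<integral>\<^sup>+t. ennreal (cmod (g t)) \<partial>lborel) \<le> (\<integral>\<^sup>+(t::complex). ennreal K * indicator (ball 0 \<rho>) t \<partial>lborel)"
  proof (rule nn_integral_mono)
    fix t
    show "ennreal (cmod (g t)) \<le> ennreal K * indicator (ball 0 \<rho>) t"
      using K[of t] supp[of t] by (cases "t \<in> ball 0 \<rho>") (auto intro: ennreal_leI)
  qed
  also have "\<dots> = ennreal K * ennreal (pi * \<rho>\<^sup>2)"
    using \<rho> by (simp add: nn_integral_cmult_indicator emeasure_ball_complex)
  also have "\<dots> < \<infinity>" by (simp add: ennreal_mult_less_top)
  finally show "integrable lborel g" by (intro integrableI_bounded) auto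
qed

lemma integral_dist_le_nn_integral:
  fixes f g :: "'a \<Rightarrow> complex"
  assumes "integrable M f" "integrable M g" "(\<integral>\<^sup>+t. ennreal (cmod (f t - g t)) \<partial>M) \<le> ennreal c" "0 \<le> c"
  shows "dist (integral\<^sup>L M f) (integral\<^sup>L M g) \<le> c"
proof -
  have "ennreal (cmod (LINT t|M. (f t - g t))) \<le> (\<integral>\<^sup>+t. ennreal (cmod (f t - g t)) \<partial>M)"
    using integral_norm_bound_ennreal[OF Bochner_Integration.integrable_diff[OF assms(1,2)]] .
  also note assms(3)
  finally have "cmod (LINT t|M. (f t - g t)) \<le> c" using assms(4) by simp
  then show ?thesis using assms(1,2) by (simp add: dist_norm)
qed

text \<open>Truncating the kernel near its singularity, in the form \<open>cnj w / max |w|\<^sup>2 \<epsilon>\<^sup>2\<close> instead of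
\<open>1 / w\<close>, changes the transform by \<open>O(\<epsilon>)\<close> uniformly, and the truncated transforms are continuous
by dominated convergence.\<close>

lemma continuous_on_cauchy_transform:
  fixes g :: "complex \<Rightarrow> complex"
  assumes gm[measurable]: "g \<in> borel_measurable borel" and K: "\<And>t. cmod (g t) \<le> K"
    and supp: "\<And>t. t \<notin> ball 0 \<rho> \<Longrightarrow> g t = 0" and \<rho>: "0 \<le> \<rho>"
  shows "continuous_on UNIV (cauchy_transform g)"
proof -
  have K0: "K \<ge> 0" using K[of 0] norm_ge_zero order_trans by blast
  define k where "k \<epsilon> w = cnj w / of_real (max ((cmod w)\<^sup>2) (\<epsilon>\<^sup>2))" for \<epsilon> :: real and w :: complex
  have kbd: "cmod (k \<epsilon> w) \<le> 1 / \<epsilon>" if "\<epsilon> > 0" for \<epsilon> w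
  proof -
    have p: "max ((cmod w)\<^sup>2) (\<epsilon>\<^sup>2) > 0" using that by (simp add: less_max_iff_disj)
    have "cmod w * \<epsilon> \<le> max ((cmod w)\<^sup>2) (\<epsilon>\<^sup>2)"
    proof (cases "cmod w \<le> \<epsilon>")
      case True
      then have "cmod w * \<epsilon> \<le> \<epsilon> * \<epsilon>" using that by (intro mult_right_mono) auto
      then show ?thesis by (simp add: power2_eq_square)
    next
      case False
      then have "cmod w * \<epsilon> \<le> cmod w * cmod w" by (intro mult_left_mono) auto
      then show ?thesis by (simp add: power2_eq_square)
    qed
    then show ?thesis using p that by (simp add: k_def norm_divide divide_simps)
  qed
  have keq: "k \<epsilon> w = 1 / w" if "\<epsilon> \<le> cmod w" "\<epsilon> > 0" for \<epsilon> w
  proof -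
    have "\<epsilon>\<^sup>2 \<le> (cmod w)\<^sup>2" using that by (intro power_mono) auto
    then have "k \<epsilon> w = cnj w / of_real ((cmod w)\<^sup>2)" by (simp add: k_def max_def)
    also have "\<dots> = 1 / w"
      unfolding complex_norm_square using that by (auto simp: divide_simps)
    finally show ?thesis .
  qed
  have kle: "cmod (k \<epsilon> w) \<le> 1 / cmod w" if "\<epsilon> > 0" for \<epsilon> w
  proof (cases "w = 0")
    case False
    have "cmod w / max ((cmod w)\<^sup>2) (\<epsilon>\<^sup>2) \<le> cmod w / (cmod w)\<^sup>2"
      using False that by (intro divide_left_mono) (auto simp: less_max_iff_disj)
    moreover have "cmod (k \<epsilon> w) = cmod w / max ((cmod w)\<^sup>2) (\<epsilon>\<^sup>2)"
      by (simp add: k_def norm_divide abs_of_nonneg le_max_iff_disj)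
    ultimately show ?thesis using False by (simp add: power2_eq_square)
  qed (simp add: k_def)
  have kc: "continuous_on UNIV (k \<epsilon>)" if "\<epsilon> > 0" for \<epsilon>
    unfolding k_def using that
    by (intro continuous_intros) (auto simp: max_def simp flip: of_real_power)
  have km: "k \<epsilon> \<in> borel_measurable borel" if "\<epsilon> > 0" for \<epsilon>
    using kc[OF that] by (rule borel_measurable_continuous_onI)
  have gi: "integrable lborel g" by (rule integrable_bounded_supp[OF gm K supp \<rho>])
  have ki: "integrable lborel (\<lambda>t. g t * k \<epsilon> (t - a))" if "\<epsilon> > 0" for \<epsilon> a
  proof (rule Bochner_Integration.integrable_bound)
    note km[OF that, measurable]
    show "integrable lborel (\<lambda>t. (1 / \<epsilon>) *\<^sub>R g t)" using gi by simp
    show "(\<lambda>t. g t * k \<epsilon> (t - a)) \<in> borel_measurable lborel" by measurable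
    have "cmod (g t) * cmod (k \<epsilon> (t - a)) \<le> cmod (g t) * (1 / \<epsilon>)" for t
      by (intro mult_left_mono kbd that) auto
    then show "AE t in lborel. cmod (g t * k \<epsilon> (t - a)) \<le> cmod ((1 / \<epsilon>) *\<^sub>R g t)"
      using that by (auto simp: norm_mult)
  qed
  define C where "C \<epsilon> a = (LINT t|lborel. g t * k \<epsilon> (t - a))" for \<epsilon> a
  have Cc: "continuous_on UNIV (C \<epsilon>)" if "\<epsilon> > 0" for \<epsilon>
    unfolding continuous_on_sequentially C_def comp_def
  proof (intro allI ballI impI, elim conjE)
    fix X :: "nat \<Rightarrow> complex" and a assume X: "X \<longlonglongrightarrow> a"
    show "(\<lambda>n. LINT t|lborel. g t * k \<epsilon> (t - X n)) \<longlonglongrightarrow> (LINT t|lborel. g t * k \<epsilon> (t - a))"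
    proof (rule integral_dominated_convergence[where w = "\<lambda>t. cmod (g t) / \<epsilon>"])
      show "(\<lambda>t. g t * k \<epsilon> (t - a)) \<in> borel_measurable lborel" using ki[OF that] by simp
      show "(\<lambda>t. g t * k \<epsilon> (t - X n)) \<in> borel_measurable lborel" for n using ki[OF that] by simp
      show "integrable lborel (\<lambda>t. cmod (g t) / \<epsilon>)" using gi by simp
      have "(\<lambda>n. k \<epsilon> (t - X n)) \<longlonglongrightarrow> k \<epsilon> (t - a)" for t
        by (rule continuous_on_tendsto_compose[OF kc[OF that]]) (auto intro!: tendsto_intros X)
      then show "AE t in lborel. (\<lambda>n. g t * k \<epsilon> (t - X n)) \<longlonglongrightarrow> g t * k \<epsilon> (t - a)"
        by (auto intro!: tendsto_intros)
      have "cmod (g t) * cmod (k \<epsilon> (t - X n)) \<le> cmod (g t) * (1 / \<epsilon>)" for t n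
        by (intro mult_left_mono kbd that) auto
      then show "AE t in lborel. cmod (g t * k \<epsilon> (t - X n)) \<le> cmod (g t) / \<epsilon>" for n
        using that by (auto simp: norm_mult)
    qed
  qed
  have close: "dist (C \<epsilon> a) (cauchy_transform g a) \<le> 8 * pi * K * \<epsilon>" if "\<epsilon> > 0" for \<epsilon> a
    unfolding C_def cauchy_transform_def
  proof (rule integral_dist_le_nn_integral[OF ki[OF that] integrable_cauchy_kernel[OF gm K supp \<rho>]])
    have "(\<integral>\<^sup>+t. ennreal (cmod (g t * k \<epsilon> (t - a) - g t / (t - a))) \<partial>lborel)
       \<le> (\<integral>\<^sup>+t. ennreal (2 * K) * (ennreal (1 / cmod (t - a)) * indicator (ball a \<epsilon>) t) \<partial>lborel)"
    proof (rule nn_integral_mono)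
      fix t
      show "ennreal (cmod (g t * k \<epsilon> (t - a) - g t / (t - a)))
        \<le> ennreal (2 * K) * (ennreal (1 / cmod (t - a)) * indicator (ball a \<epsilon>) t)"
      proof (cases "t \<in> ball a \<epsilon>")
        case True
        have "cmod (k \<epsilon> (t - a) - 1 / (t - a)) \<le> 1 / cmod (t - a) + 1 / cmod (t - a)"
        proof -
          have "cmod (k \<epsilon> (t - a) - 1 / (t - a)) \<le> cmod (k \<epsilon> (t - a)) + cmod (1 / (t - a))"
            by (rule norm_triangle_ineq4)
          then show ?thesis using kle[OF that, of "t - a"] by (simp add: norm_divide)
        qed
        then have "cmod (g t) * cmod (k \<epsilon> (t - a) - 1 / (t - a)) \<le> K * (2 * (1 / cmod (t - a)))"
          using K[of t] K0 by (intro mult_mono) auto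
        moreover have "g t * k \<epsilon> (t - a) - g t / (t - a) = g t * (k \<epsilon> (t - a) - 1 / (t - a))"
          by (simp add: algebra_simps)
        ultimately have "cmod (g t * k \<epsilon> (t - a) - g t / (t - a)) \<le> 2 * K * (1 / cmod (t - a))"
          by (simp add: norm_mult mult_ac)
        then show ?thesis using True K0 by (simp add: ennreal_mult[symmetric] ennreal_leI)
      next
        case False
        then have "k \<epsilon> (t - a) = 1 / (t - a)" using that
          by (intro keq) (auto simp: dist_norm norm_minus_commute)
        then show ?thesis by simp
      qed
    qed
    also have "\<dots> = ennreal (2 * K) * (\<integral>\<^sup>+t\<in>ball a \<epsilon>. ennreal (1 / cmod (t - a)) \<partial>lborel)"
      by (rule nn_integral_cmult) measurable
    also have "\<dots> \<le> ennreal (2 * K) * ennreal (4 * pi * \<epsilon>)"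
      by (intro mult_left_mono nn_integral_inverse_norm_ball that) auto
    also have "\<dots> = ennreal (8 * pi * K * \<epsilon>)" using K0 that by (simp add: ennreal_mult[symmetric] mult_ac)
    finally show "(\<integral>\<^sup>+t. ennreal (cmod (g t * k \<epsilon> (t - a) - g t / (t - a))) \<partial>lborel) \<le> ennreal (8 * pi * K * \<epsilon>)" .
  qed (use K0 that in auto)
  have "uniform_limit UNIV C (cauchy_transform g) (at_right 0)"
  proof (rule uniform_limitI)
    fix e :: real assume "e > 0"
    define d where "d = e / (8 * pi * K + 1)"
    have pos: "8 * pi * K + 1 > 0" using K0 by (simp add: add_nonneg_pos)
    have d: "d > 0" using \<open>e > 0\<close> pos by (simp add: d_def)
    have "dist (C \<epsilon> a) (cauchy_transform g a) < e" if "0 < \<epsilon>" "\<epsilon> < d" for \<epsilon> a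
    proof -
      have "8 * pi * K * \<epsilon> \<le> 8 * pi * K * d" using that K0 by (intro mult_left_mono) auto
      also have "\<dots> < (8 * pi * K + 1) * d" using d by (simp add: algebra_simps)
      also have "\<dots> = e" using pos by (simp add: d_def)
      finally show ?thesis using close[OF that(1), of a] by linarith
    qed
    then show "\<forall>\<^sub>F \<epsilon> in at_right 0. \<forall>a\<in>UNIV. dist (C \<epsilon> a) (cauchy_transform g a) < e"
      using d unfolding eventually_at_right_field by blast
  qed
  then show ?thesis
    by (rule uniform_limit_theorem[rotated])
       (auto intro!: Cc simp: eventually_at_right_field intro: exI[of _ 1])
qed

text \<open>Fubini's theorem exchanges the integral over the plane with the one along a segment. The
function \<open>J\<close> is the path integral of the kernel, defined as a Lebesgue integral so that it also has
a value for \<open>t\<close> on the segment.\<close>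

lemma cauchy_transform_segment:
  fixes g :: "complex \<Rightarrow> complex"
  assumes gm[measurable]: "g \<in> borel_measurable borel" and K: "\<And>t. cmod (g t) \<le> K"
    and supp: "\<And>t. t \<notin> ball 0 \<rho> \<Longrightarrow> g t = 0" and \<rho>: "0 \<le> \<rho>"
  defines "J \<equiv> (\<lambda>p q t. LINT x:{0..1}|lborel. (q - p) / (t - linepath p q x))"
  shows "integrable lborel (\<lambda>t. g t * J p q t)"
    and "contour_integral (linepath p q) (cauchy_transform g) = (LINT t|lborel. g t * J p q t)"
    and "t \<notin> closed_segment p q \<Longrightarrow> J p q t = contour_integral (linepath p q) (\<lambda>a. 1 / (t - a))"
proof -
  define F where "F = (\<lambda>(x::real, t::complex). indicator {0..1} x *\<^sub>R (g t * ((q - p) / (t - linepath p q x))))"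
  have lp[measurable]: "linepath p q \<in> borel_measurable borel"
    by (intro borel_measurable_continuous_onI continuous_on_linepath)
  have Fm[measurable]: "F \<in> borel_measurable (lborel \<Otimes>\<^sub>M lborel)"
    unfolding F_def by measurable
  have K0: "K \<ge> 0" using K[of 0] norm_ge_zero order_trans by blast
  define c where "c = K * (4 * pi + pi * \<rho>\<^sup>2) * cmod (q - p)"
  have c0: "c \<ge> 0" using K0 by (auto simp: c_def)
  have "(\<integral>\<^sup>+z. ennreal (norm (F z)) \<partial>(lborel \<Otimes>\<^sub>M lborel))
      = (\<integral>\<^sup>+x. (\<integral>\<^sup>+t. ennreal (norm (F (x, t))) \<partial>lborel) \<partial>lborel)"
    by (rule lborel.nn_integral_fst[symmetric]) measurable
  also have "\<dots> \<le> (\<integral>\<^sup>+x. ennreal c * indicator {0..1} x \<partial>(lborel :: real measure))"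
  proof (rule nn_integral_mono)
    fix x :: real
    have "(\<integral>\<^sup>+t. ennreal (norm (F (x, t))) \<partial>lborel)
       = (\<integral>\<^sup>+t. ennreal (cmod (q - p) * indicator {0..1} x) * ennreal (cmod (g t / (t - linepath p q x))) \<partial>lborel)"
      by (intro nn_integral_cong) (auto simp: F_def norm_mult norm_divide ennreal_mult[symmetric] mult_ac)
    also have "\<dots> = ennreal (cmod (q - p) * indicator {0..1} x) * (\<integral>\<^sup>+t. ennreal (cmod (g t / (t - linepath p q x))) \<partial>lborel)"
      by (rule nn_integral_cmult) measurable
    also have "\<dots> \<le> ennreal (cmod (q - p) * indicator {0..1} x) * ennreal (K * (4 * pi + pi * \<rho>\<^sup>2))"
      by (intro mult_left_mono nn_integral_cauchy_kernel[OF gm K supp \<rho>]) auto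
    also have "\<dots> = ennreal c * indicator {0..1} x"
      using K0 by (auto simp: c_def ennreal_mult[symmetric] mult_ac split: split_indicator)
    finally show "(\<integral>\<^sup>+t. ennreal (norm (F (x, t))) \<partial>lborel) \<le> ennreal c * indicator {0..1} x" .
  qed
  also have "\<dots> < \<infinity>" by (simp add: nn_integral_cmult_indicator)
  finally have Fi: "integrable (lborel \<Otimes>\<^sub>M lborel) F" by (intro integrableI_bounded Fm) auto
  then have Fi': "integrable (lborel \<Otimes>\<^sub>M lborel) (\<lambda>(x, t). F (x, t))" by simp
  have snd: "(LINT x|lborel. F (x, t)) = g t * J p q t" for t
    unfolding F_def J_def set_lebesgue_integral_def
    by (subst integral_mult_right_zero[symmetric]) (auto intro!: Bochner_Integration.integral_cong simp: mult_ac)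
  show "integrable lborel (\<lambda>t. g t * J p q t)"
    using lborel_pair.integrable_snd[OF Fi'] unfolding snd by simp
  have fst: "(LINT t|lborel. F (x, t)) = indicator {0..1} x *\<^sub>R (cauchy_transform g (linepath p q x) * (q - p))" for x
  proof -
    have "(LINT t|lborel. F (x, t)) = (LINT t|lborel. (indicator {0..1} x *\<^sub>R (q - p)) * (g t / (t - linepath p q x)))"
      by (intro Bochner_Integration.integral_cong) (auto simp: F_def scaleR_conv_of_real mult_ac)
    also have "\<dots> = (indicator {0..1} x *\<^sub>R (q - p)) * (LINT t|lborel. g t / (t - linepath p q x))"
      by (rule integral_mult_right_zero)
    finally show ?thesis by (simp add: cauchy_transform_def mult.commute)
  qed
  have cc: "continuous_on UNIV (cauchy_transform g)" by (rule continuous_on_cauchy_transform[OF gm K supp \<rho>])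
  have ci: "continuous_on {0..1} (\<lambda>x. cauchy_transform g (linepath p q x) * (q - p))"
    by (intro continuous_intros continuous_on_compose2[OF cc]) auto
  have "contour_integral (linepath p q) (cauchy_transform g)
      = integral {0..1} (\<lambda>x. cauchy_transform g (linepath p q x) * (q - p))"
    by (simp add: contour_integral_integral)
  also have "\<dots> = (LINT x:{0..1}|lborel. cauchy_transform g (linepath p q x) * (q - p))"
    by (rule set_borel_integral_eq_integral(2)[symmetric]) (rule borel_integrable_atLeastAtMost'[OF ci])
  also have "\<dots> = (LINT x|lborel. LINT t|lborel. F (x, t))"
    unfolding fst set_lebesgue_integral_def ..
  also have "\<dots> = (LINT t|lborel. LINT x|lborel. F (x, t))"
    by (rule lborel_pair.Fubini_integral[OF Fi', symmetric])
  finally show "contour_integral (linepath p q) (cauchy_transform g) = (LINT t|lborel. g t * J p q t)"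
    unfolding snd .
  assume t: "t \<notin> closed_segment p q"
  have ci: "continuous_on {0..1} (\<lambda>x. (q - p) / (t - linepath p q x))"
    using t by (intro continuous_intros) (auto simp: linepath_image_01[symmetric])
  have "J p q t = integral {0..1} (\<lambda>x. (q - p) / (t - linepath p q x))"
    unfolding J_def
    by (rule set_borel_integral_eq_integral(2)) (rule borel_integrable_atLeastAtMost'[OF ci])
  also have "\<dots> = contour_integral (linepath p q) (\<lambda>a. 1 / (t - a))"
    by (simp add: contour_integral_integral)
  finally show "J p q t = contour_integral (linepath p q) (\<lambda>a. 1 / (t - a))" .
qed

lemma contour_integral_rectpath_split:
  assumes "continuous_on (path_image (rectpath a1 a3)) f"
  shows "contour_integral (rectpath a1 a3) f =
      contour_integral (linepath a1 (Complex (Re a3) (Im a1))) f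
    + (contour_integral (linepath (Complex (Re a3) (Im a1)) a3) f
    + (contour_integral (linepath a3 (Complex (Re a1) (Im a3))) f
    + contour_integral (linepath (Complex (Re a1) (Im a3)) a1) f))"
proof -
  have pi: "path_image (rectpath a1 a3) = closed_segment a1 (Complex (Re a3) (Im a1))
    \<union> (closed_segment (Complex (Re a3) (Im a1)) a3
    \<union> (closed_segment a3 (Complex (Re a1) (Im a3)) \<union> closed_segment (Complex (Re a1) (Im a3)) a1))"
    unfolding rectpath_def Let_def by (simp add: path_image_join)
  have "f contour_integrable_on linepath a1 (Complex (Re a3) (Im a1))"
       "f contour_integrable_on linepath (Complex (Re a3) (Im a1)) a3"
       "f contour_integrable_on linepath a3 (Complex (Re a1) (Im a3))"
       "f contour_integrable_on linepath (Complex (Re a1) (Im a3)) a1"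
    by (intro contour_integrable_continuous_linepath continuous_on_subset[OF assms], force simp: pi)+
  then show ?thesis unfolding rectpath_def Let_def by simp
qed

text \<open>This is the weak form of the fact that the derivative of the Cauchy transform of \<open>g\<close> with
respect to \<open>cnj z\<close> is \<open>-\<pi> g\<close>: only the values of \<open>g\<close> inside the rectangle contribute, because the
integral of \<open>1 / (t - a)\<close> over its boundary is a winding number.\<close>

lemma contour_integral_rectpath_cauchy_transform:
  fixes g :: "complex \<Rightarrow> complex"
  assumes gm[measurable]: "g \<in> borel_measurable borel" and K: "\<And>t. cmod (g t) \<le> K"
    and supp: "\<And>t. t \<notin> ball 0 \<rho> \<Longrightarrow> g t = 0" and \<rho>: "0 \<le> \<rho>"
    and lu: "Re l \<le> Re u" "Im l \<le> Im u"
  shows "contour_integral (rectpath l u) (cauchy_transform g)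
       = - (2 * pi * \<i>) * (LINT t:box l u|lborel. g t)"
proof -
  note seg = cauchy_transform_segment[OF gm K supp \<rho>]
  let ?J = "\<lambda>p q t. LINT x:{0..1}|lborel. (q - p) / (t - linepath p q x)"
  have seg1: "integrable lborel (\<lambda>t. g t * ?J p q t)"
    and seg2: "contour_integral (linepath p q) (cauchy_transform g) = (LINT t|lborel. g t * ?J p q t)"
    and seg3: "t \<notin> closed_segment p q \<Longrightarrow> ?J p q t = contour_integral (linepath p q) (\<lambda>a. 1 / (t - a))" for p q t
    using seg(1)[where p = p and q = q] seg(2)[where p = p and q = q]
      seg(3)[where p = p and q = q and t = t] by simp_all
  let ?b = "Complex (Re u) (Im l)" and ?d = "Complex (Re l) (Im u)"
  have cc: "continuous_on UNIV (cauchy_transform g)" by (rule continuous_on_cauchy_transform[OF gm K supp \<rho>])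
  have "contour_integral (rectpath l u) (cauchy_transform g)
    = (LINT t|lborel. g t * ?J l ?b t) + ((LINT t|lborel. g t * ?J ?b u t)
     + ((LINT t|lborel. g t * ?J u ?d t) + (LINT t|lborel. g t * ?J ?d l t)))"
    unfolding contour_integral_rectpath_split[OF continuous_on_subset[OF cc subset_UNIV]] seg2 by (rule refl)
  also have "\<dots> = (LINT t|lborel. g t * (?J l ?b t + (?J ?b u t + (?J u ?d t + ?J ?d l t))))"
    by (simp add: seg1 distrib_left)
  also have "\<dots> = (LINT t|lborel. - (2 * pi * \<i>) * (indicator (box l u) t *\<^sub>R g t))"
  proof (rule integral_cong_AE)
    have "negligible (cbox l u - box l u)" by (rule negligible_frontier_interval)
    then have "AE t in lebesgue. t \<notin> cbox l u - box l u"
      unfolding negligible_iff_null_sets by (rule AE_not_in)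
    then have "AE t in lborel. t \<notin> cbox l u - box l u" by (simp add: AE_completion_iff)
    then show "AE t in lborel. g t * (?J l ?b t + (?J ?b u t + (?J u ?d t + ?J ?d l t)))
      = - (2 * pi * \<i>) * (indicator (box l u) t *\<^sub>R g t)"
    proof (rule AE_mp, intro AE_I2 impI)
      fix t assume "t \<notin> cbox l u - box l u"
      then have t: "t \<notin> path_image (rectpath l u)" by (simp add: path_image_rectpath_cbox_minus_box lu)
      have pi: "path_image (rectpath l u) = closed_segment l ?b
        \<union> (closed_segment ?b u \<union> (closed_segment u ?d \<union> closed_segment ?d l))"
        unfolding rectpath_def Let_def by (simp add: path_image_join)
      have "?J l ?b t + (?J ?b u t + (?J u ?d t + ?J ?d l t)) = contour_integral (rectpath l u) (\<lambda>a. 1 / (t - a))"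
        using t unfolding pi
        by (subst contour_integral_rectpath_split)
           (auto simp: seg3 pi intro!: continuous_intros)
      also have "\<dots> = contour_integral (rectpath l u) (\<lambda>a. - (1 / (a - t)))"
        by (rule contour_integral_cong) (auto simp: divide_simps)
      also have "\<dots> = - contour_integral (rectpath l u) (\<lambda>a. 1 / (a - t))"
        by (rule contour_integral_neg)
      also have "contour_integral (rectpath l u) (\<lambda>a. 1 / (a - t)) = 2 * pi * \<i> * winding_number (rectpath l u) t"
        using winding_number_valid_path[OF valid_path_rectpath t] by simp
      also have "winding_number (rectpath l u) t = indicator (box l u) t"
      proof (cases "t \<in> box l u")
        case False
        then have "t \<notin> cbox l u" using \<open>t \<notin> cbox l u - box l u\<close> by auto
        then show ?thesis using False lu by (simp add: winding_number_rectpath_outside)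
      qed (simp add: winding_number_rectpath)
      finally show "g t * (?J l ?b t + (?J ?b u t + (?J u ?d t + ?J ?d l t)))
        = - (2 * pi * \<i>) * (indicator (box l u) t *\<^sub>R g t)"
        by (auto split: split_indicator simp: mult_ac)
    qed
    have "integrable lborel (\<lambda>t. g t * (?J l ?b t + (?J ?b u t + (?J u ?d t + ?J ?d l t))))"
      by (simp add: seg1 distrib_left)
    then show "(\<lambda>t. g t * (?J l ?b t + (?J ?b u t + (?J u ?d t + ?J ?d l t)))) \<in> borel_measurable lborel" by simp
  qed measurable
  also have "\<dots> = - (2 * pi * \<i>) * (LINT t|lborel. indicator (box l u) t *\<^sub>R g t)"
    by (rule integral_mult_right_zero)
  finally show ?thesis by (simp only: set_lebesgue_integral_def)
qed

section \<open>The potential of a bounded Beltrami coefficient\<close>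

text \<open>The Cauchy kernel \<open>1 / (t - a)\<close> is not integrable at infinity. Outside the unit disc it is
replaced by \<open>1 / (t - a) - 1 / t - a / t\<^sup>2\<close>, which decays like \<open>|t|\<^sup>-\<^sup>3\<close>. The correction is affine
in \<open>a\<close>, so it is invisible to the derivative with respect to \<open>cnj a\<close>.\<close>

definition pot_kernel :: "complex \<Rightarrow> complex \<Rightarrow> complex" where
  "pot_kernel a t = (if cmod t < 1 then 1 / (t - a) else a\<^sup>2 / (t\<^sup>2 * (t - a)))"

definition potential :: "(complex \<Rightarrow> complex) \<Rightarrow> complex \<Rightarrow> complex" where
  "potential m a = (LINT t|lborel. m t * pot_kernel a t)"

lemma pot_kernel_measurable [measurable]: "pot_kernel a \<in> borel_measurable borel"
  unfolding pot_kernel_def by measurable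

lemma nn_integral_pot_kernel:
  "(\<integral>\<^sup>+t. ennreal (cmod (pot_kernel a t)) \<partial>lborel) \<le> ennreal (20 * pi * (1 + (cmod a)\<^sup>2))"
proof -
  have "(\<integral>\<^sup>+t. ennreal (cmod (pot_kernel a t)) \<partial>lborel)
    \<le> (\<integral>\<^sup>+t. (ennreal (1 / cmod (t - a)) * indicator (ball 0 1) t
       + ennreal ((cmod a)\<^sup>2) * (ennreal (1 / (cmod t ^ 2 * cmod (t - a))) * indicator (- ball 0 1) t)) \<partial>lborel)"
    by (intro nn_integral_mono)
       (auto simp: pot_kernel_def norm_divide norm_mult norm_power ennreal_mult[symmetric] split: split_indicator)
  also have "\<dots> = (\<integral>\<^sup>+t\<in>ball 0 1. ennreal (1 / cmod (t - a)) \<partial>lborel)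
      + ennreal ((cmod a)\<^sup>2) * (\<integral>\<^sup>+t\<in>- ball 0 1. ennreal (1 / (cmod t ^ 2 * cmod (t - a))) \<partial>lborel)"
  proof -
    have [measurable]: "(\<lambda>t. ennreal (1 / (cmod t ^ 2 * cmod (t - a))) * indicator (- ball 0 1) t) \<in> borel_measurable borel"
      by measurable
    have [measurable]: "(\<lambda>t. ennreal (1 / cmod (t - a)) * indicator (ball 0 1) t) \<in> borel_measurable borel"
      by measurable
    show ?thesis by (simp add: nn_integral_add nn_integral_cmult)
  qed
  also have "\<dots> \<le> ennreal (4 * pi + pi * 1\<^sup>2) + ennreal ((cmod a)\<^sup>2) * ennreal (20 * pi)"
    by (intro add_mono mult_left_mono nn_integral_inverse_norm_near nn_integral_inverse_norm_far) auto
  also have "\<dots> = ennreal (5 * pi + (cmod a)\<^sup>2 * (20 * pi))" by (simp add: ennreal_mult[symmetric] ennreal_plus[symmetric] del: ennreal_plus)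
  also have "\<dots> \<le> ennreal (20 * pi * (1 + (cmod a)\<^sup>2))"
    by (rule ennreal_leI) (simp add: algebra_simps)
  finally show ?thesis .
qed

lemma
  fixes m :: "complex \<Rightarrow> complex"
  assumes mm[measurable]: "m \<in> borel_measurable borel" and K: "\<And>t. cmod (m t) \<le> K"
  shows integrable_potential: "integrable lborel (\<lambda>t. m t * pot_kernel a t)"
    and potential_bound: "cmod (potential m a) \<le> 20 * pi * K * (1 + (cmod a)\<^sup>2)"
proof -
  have K0: "K \<ge> 0" using K[of 0] norm_ge_zero order_trans by blast
  have "(\<integral>\<^sup>+t. ennreal (cmod (m t * pot_kernel a t)) \<partial>lborel)
     \<le> (\<integral>\<^sup>+t. ennreal K * ennreal (cmod (pot_kernel a t)) \<partial>lborel)"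
    using K K0 by (intro nn_integral_mono) (auto simp: norm_mult ennreal_mult[symmetric] intro!: ennreal_leI mult_right_mono)
  also have "\<dots> = ennreal K * (\<integral>\<^sup>+t. ennreal (cmod (pot_kernel a t)) \<partial>lborel)"
    by (rule nn_integral_cmult) measurable
  also have "\<dots> \<le> ennreal K * ennreal (20 * pi * (1 + (cmod a)\<^sup>2))"
    by (intro mult_left_mono nn_integral_pot_kernel) auto
  also have "\<dots> = ennreal (20 * pi * K * (1 + (cmod a)\<^sup>2))"
    using K0 by (simp add: ennreal_mult[symmetric] mult_ac)
  finally have *: "(\<integral>\<^sup>+t. ennreal (cmod (m t * pot_kernel a t)) \<partial>lborel) \<le> ennreal (20 * pi * K * (1 + (cmod a)\<^sup>2))" .
  then show i: "integrable lborel (\<lambda>t. m t * pot_kernel a t)"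
    by (intro integrableI_bounded) (auto simp: order_le_less_trans)
  have "ennreal (cmod (potential m a)) \<le> (\<integral>\<^sup>+t. ennreal (cmod (m t * pot_kernel a t)) \<partial>lborel)"
    unfolding potential_def by (rule integral_norm_bound_ennreal[OF i])
  also note *
  finally show "cmod (potential m a) \<le> 20 * pi * K * (1 + (cmod a)\<^sup>2)"
    using K0 by (simp add: ennreal_le_iff mult_nonneg_nonneg add_nonneg_nonneg)
qed

lemma potential_sum:
  assumes "finite I" "\<And>i. i \<in> I \<Longrightarrow> f i \<in> borel_measurable borel" "\<And>i t. i \<in> I \<Longrightarrow> cmod (f i t) \<le> K"
  shows "potential (\<lambda>t. \<Sum>i\<in>I. c i * f i t) a = (\<Sum>i\<in>I. c i * potential (f i) a)"
proof -
  have "potential (\<lambda>t. \<Sum>i\<in>I. c i * f i t) a = (LINT t|lborel. (\<Sum>i\<in>I. c i * (f i t * pot_kernel a t)))"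
    unfolding potential_def
    by (intro Bochner_Integration.integral_cong) (auto simp: sum_distrib_right mult.assoc)
  also have "\<dots> = (\<Sum>i\<in>I. LINT t|lborel. c i * (f i t * pot_kernel a t))"
    by (rule Bochner_Integration.integral_sum) (intro integrable_mult_right integrable_potential[where K = K] assms)
  finally show ?thesis by (simp add: potential_def)
qed

text \<open>On \<open>B\<close> the kernels differ by a function of \<open>a\<close> that is holomorphic for every \<open>t\<close>: an affine
function if \<open>t\<close> lies in \<open>B\<close>, and the modified kernel itself, with its pole outside \<open>B\<close>, otherwise. All local
properties of the potential are therefore those of Cauchy transforms of functions with compact
support.\<close>

lemma potential_local:
  fixes m :: "complex \<Rightarrow> complex"
  assumes mm[measurable]: "m \<in> borel_measurable borel" and K: "\<And>t. cmod (m t) \<le> K"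
    and B: "open B" and bB: "bounded B"
  obtains h where "h holomorphic_on B"
    "\<And>a. a \<in> B \<Longrightarrow> potential m a = cauchy_transform (\<lambda>t. m t * indicator B t) a + h a"
proof -
  have K0: "K \<ge> 0" using K[of 0] norm_ge_zero order_trans by blast
  have [measurable]: "B \<in> sets borel" using B by simp
  obtain \<rho>0 where "\<And>x. x \<in> B \<Longrightarrow> norm x < \<rho>0" using bB by (meson bounded_pos_less)
  define \<rho> where "\<rho> = max \<rho>0 1"
  have \<rho>: "\<rho> \<ge> 1" "\<And>x. x \<in> B \<Longrightarrow> norm x < \<rho>"
    using \<open>\<And>x. x \<in> B \<Longrightarrow> norm x < \<rho>0\<close> by (auto simp: \<rho>_def less_max_iff_disj)
  define k where "k a t = (if t \<in> B then (if cmod t < 1 then 0 else - (1 / t) - a / t\<^sup>2) else pot_kernel a t)" for a t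
  have km[measurable]: "k a \<in> borel_measurable borel" for a unfolding k_def by measurable
  define h where "h a = (LINT t|lborel. m t * k a t)" for a
  have dec: "pot_kernel a t = indicator B t / (t - a) + k a t" if "t \<noteq> a" for a t
  proof (cases "t \<in> B \<and> \<not> cmod t < 1")
    case True
    then have "t \<noteq> 0" by auto
    moreover have "t - a \<noteq> 0" using that by simp
    ultimately have "a\<^sup>2 / (t\<^sup>2 * (t - a)) = 1 / (t - a) + (- (1 / t) - a / t\<^sup>2)"
      by (simp add: divide_simps) (simp add: algebra_simps power2_eq_square)
    then show ?thesis using True by (simp add: pot_kernel_def k_def)
  qed (auto simp: k_def pot_kernel_def)
  have ci: "integrable lborel (\<lambda>t. m t * indicator B t / (t - a))" for a
    by (rule integrable_cauchy_kernel[where \<rho> = \<rho> and K = K])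
       (use K K0 \<rho> in \<open>auto split: split_indicator simp: indicator_def\<close>)
  have "\<exists>e>0. h holomorphic_on ball a0 e" if a0: "a0 \<in> B" for a0
  proof -
    obtain e where e: "e > 0" "ball a0 e \<subseteq> B" using B a0 by (meson openE)
    define \<delta> where "\<delta> = e / 2"
    have \<delta>: "\<delta> > 0" using e by (simp add: \<delta>_def)
    \<comment> \<open>an integrable majorant, valid for all \<open>a\<close> in the smaller ball: constant for \<open>|t| < 2 \<rho>\<close> and a multiple of \<open>|t|\<^sup>-\<^sup>3\<close> beyond\<close>
    define w where "w t = K * ((1 + 2 * \<rho>\<^sup>2) / min \<delta> 1 * indicator (ball 0 (2 * \<rho>)) t
        + 2 * \<rho>\<^sup>2 * (indicator (- ball 0 1) t / cmod t ^ 3))" for t :: complex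
    have kw: "cmod (k a t) \<le> (1 + 2 * \<rho>\<^sup>2) / min \<delta> 1 * indicator (ball 0 (2 * \<rho>)) t
        + 2 * \<rho>\<^sup>2 * (indicator (- ball 0 1) t / cmod t ^ 3)" if a: "a \<in> ball a0 \<delta>" for a t
    proof -
      have aB: "a \<in> B" using a e \<delta> by (auto simp: \<delta>_def subset_iff)
      then have a\<rho>: "cmod a < \<rho>" using \<rho> by blast
      have \<rho>2: "\<rho> \<le> \<rho>\<^sup>2" "1 \<le> \<rho>\<^sup>2" using \<rho>(1) by (auto simp: power2_eq_square mult_le_cancel_left1 intro: order_trans[OF \<rho>(1)])
      have tail: "0 \<le> 2 * \<rho>\<^sup>2 * (indicator (- ball 0 1) t / cmod t ^ 3)" by simp
      have m1: "1 + 2 * \<rho>\<^sup>2 \<le> (1 + 2 * \<rho>\<^sup>2) / min \<delta> 1"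
      proof -
        have "min \<delta> 1 * (1 + 2 * \<rho>\<^sup>2) \<le> 1 * (1 + 2 * \<rho>\<^sup>2)" by (intro mult_right_mono) auto
        then show ?thesis using \<delta> by (simp add: le_divide_eq mult.commute)
      qed
      show ?thesis
      proof (cases "t \<in> B")
        case True
        have "cmod (k a t) \<le> 1 + 2 * \<rho>\<^sup>2"
        proof (cases "cmod t < 1")
          case False
          then have t1: "1 \<le> cmod t" "1 \<le> (cmod t)\<^sup>2" by (auto intro: one_le_power)
          have "cmod (- (1 / t) - a / t\<^sup>2) \<le> cmod (1 / t) + cmod (a / t\<^sup>2)"
            using norm_triangle_ineq4[of "- (1 / t)" "a / t\<^sup>2"] by simp
          also have "\<dots> \<le> 1 + \<rho>"
          proof (rule add_mono)
            show "cmod (1 / t) \<le> 1" using t1 frac_le[of 1 1 1 "cmod t"] by (simp add: norm_divide)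
            show "cmod (a / t\<^sup>2) \<le> \<rho>"
              using frac_le[of \<rho> "cmod a" 1 "(cmod t)\<^sup>2"] t1 a\<rho> \<rho>(1) by (simp add: norm_divide norm_power)
          qed
          finally show ?thesis using False True \<rho>2 by (simp add: k_def)
        qed (use True in \<open>simp add: k_def\<close>)
        moreover have "indicator (ball 0 (2 * \<rho>)) t = (1::real)" using \<rho>(2)[OF True] \<rho>(1) by simp
        ultimately show ?thesis using m1 tail by (simp only: mult_1_right)
      next
        case False
        then have "t \<notin> ball a0 e" using e by blast
        then have "e \<le> cmod (t - a0)" by (simp add: dist_norm norm_minus_commute)
        moreover have "cmod (a - a0) < \<delta>" using a by (simp add: dist_norm norm_minus_commute)
        moreover have "cmod (t - a0) \<le> cmod (t - a) + cmod (a - a0)"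
          using norm_triangle_ineq[of "t - a" "a - a0"] by simp
        ultimately have ta: "\<delta> \<le> cmod (t - a)" by (simp add: \<delta>_def)
        show ?thesis
        proof (cases "t \<in> ball 0 (2 * \<rho>)")
          case t: True
          have i: "1 / cmod (t - a) \<le> 1 / min \<delta> 1"
            using ta \<delta> by (intro frac_le) auto
          have "cmod (k a t) \<le> (1 + 2 * \<rho>\<^sup>2) * (1 / cmod (t - a))"
          proof (cases "cmod t < 1")
            case True
            have "1 * (1 / cmod (t - a)) \<le> (1 + 2 * \<rho>\<^sup>2) * (1 / cmod (t - a))"
              by (intro mult_right_mono) auto
            then show ?thesis using False True by (simp add: k_def pot_kernel_def norm_divide)
          next
            case t1: False
            then have "1 \<le> (cmod t)\<^sup>2" by (auto intro: one_le_power)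
            moreover have "(cmod a)\<^sup>2 \<le> \<rho>\<^sup>2" using a\<rho> by (intro power_mono) auto
            ultimately have "(cmod a)\<^sup>2 / (cmod t)\<^sup>2 \<le> \<rho>\<^sup>2 / 1" by (intro frac_le) auto
            then have "(cmod a)\<^sup>2 / (cmod t)\<^sup>2 \<le> 1 + 2 * \<rho>\<^sup>2" using \<rho>2 by simp
            then have "(cmod a)\<^sup>2 / (cmod t)\<^sup>2 * (1 / cmod (t - a)) \<le> (1 + 2 * \<rho>\<^sup>2) * (1 / cmod (t - a))"
              by (intro mult_right_mono) auto
            then show ?thesis using False t1 by (simp add: k_def pot_kernel_def norm_divide norm_mult norm_power)
          qed
          also have "\<dots> \<le> (1 + 2 * \<rho>\<^sup>2) * (1 / min \<delta> 1)" using i by (intro mult_left_mono) auto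
          also have "\<dots> = (1 + 2 * \<rho>\<^sup>2) / min \<delta> 1 * indicator (ball 0 (2 * \<rho>)) t" using t by simp
          finally show ?thesis using tail by linarith
        next
          case t: False
          then have t2: "2 * \<rho> \<le> cmod t" by simp
          then have tp: "1 \<le> cmod t" "0 < cmod t" using \<rho>(1) by auto
          have "cmod t \<le> cmod (t - a) + cmod a" using norm_triangle_ineq[of "t - a" a] by simp
          then have half: "cmod t / 2 \<le> cmod (t - a)" using t2 a\<rho> by simp
          have "(cmod a)\<^sup>2 \<le> \<rho>\<^sup>2" using a\<rho> by (intro power_mono) auto
          then have "(cmod a)\<^sup>2 / ((cmod t)\<^sup>2 * cmod (t - a)) \<le> \<rho>\<^sup>2 / ((cmod t)\<^sup>2 * (cmod t / 2))"
            using half tp by (intro frac_le mult_left_mono) auto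
          also have "\<dots> = 2 * \<rho>\<^sup>2 * (1 / cmod t ^ 3)" by (simp add: power2_eq_square power3_eq_cube)
          finally show ?thesis using False t tp
            by (simp add: k_def pot_kernel_def norm_divide norm_mult norm_power)
        qed
      qed
    qed
    have i3: "integrable lborel (\<lambda>t::complex. indicator (- ball 0 1) t / cmod t ^ 3)"
    proof (rule integrableI_bounded)
      have "(\<integral>\<^sup>+(t::complex). ennreal (norm (indicator (- ball 0 1) t / cmod t ^ 3)) \<partial>lborel)
        = (\<integral>\<^sup>+t\<in>- ball 0 1. ennreal (1 / cmod (t - 0)^3) \<partial>lborel)"
        by (intro nn_integral_cong) (auto split: split_indicator)
      also have "\<dots> < \<infinity>" using nn_integral_inverse_norm_cube[of 0] by (simp add: order_le_less_trans)
      finally show "(\<integral>\<^sup>+(t::complex). ennreal (norm (indicator (- ball 0 1) t / cmod t ^ 3)) \<partial>lborel) < \<infinity>" .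
    qed measurable
    have wi: "integrable lborel w"
      unfolding w_def
      by (intro integrable_mult_right Bochner_Integration.integrable_add i3 integrable_real_indicator)
         (use \<rho>(1) in \<open>auto simp: emeasure_ball_complex\<close>)
    have "(\<lambda>a. LINT t|lborel. m t * k a t) holomorphic_on ball a0 \<delta>"
    proof (rule holomorphic_on_lebesgue_integral[OF open_ball _ _ _ wi])
      show "(\<lambda>t. m t * k a t) \<in> borel_measurable lborel" for a by measurable
      show "(\<lambda>a. m t * k a t) holomorphic_on ball a0 \<delta>" for t
      proof (cases "t \<in> B")
        case True
        then show ?thesis unfolding k_def by (cases "cmod t < 1") (auto intro!: holomorphic_intros)
      next
        case False
        then have "t - a \<noteq> 0" if "a \<in> ball a0 \<delta>" for a using that e \<delta> by (auto simp: \<delta>_def subset_iff)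
        moreover have "t \<noteq> 0" if "\<not> cmod t < 1" using that by auto
        ultimately show ?thesis
          using False unfolding k_def pot_kernel_def
          by (cases "cmod t < 1") (auto intro!: holomorphic_intros)
      qed
      show "cmod (m t * k a t) \<le> w t" if "a \<in> ball a0 \<delta>" for a t
        unfolding w_def norm_mult by (intro mult_mono K K0 kw[OF that]) auto
    qed
    then show ?thesis using \<delta> unfolding h_def by blast
  qed
  then have "h holomorphic_on B"
    unfolding holomorphic_on_open[OF B] by (meson centre_in_ball holomorphic_on_open open_ball)
  moreover have "potential m a = cauchy_transform (\<lambda>t. m t * indicator B t) a + h a" for a
  proof -
    have ae: "AE t in lborel. t \<noteq> a" by (rule AE_lborel_singleton)
    have eq: "AE t in lborel. m t * pot_kernel a t - m t * indicator B t / (t - a) = m t * k a t"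
      using ae by (rule AE_mp) (auto simp: dec algebra_simps)
    have "(LINT t|lborel. m t * pot_kernel a t - m t * indicator B t / (t - a)) = h a"
      unfolding h_def by (rule integral_cong_AE) (use eq in auto)
    moreover have "(LINT t|lborel. m t * pot_kernel a t - m t * indicator B t / (t - a))
      = potential m a - cauchy_transform (\<lambda>t. m t * indicator B t) a"
      unfolding potential_def cauchy_transform_def
      by (rule Bochner_Integration.integral_diff[OF integrable_potential[OF mm K] ci])
    ultimately show ?thesis by (simp add: diff_eq_eq add.commute)
  qed
  ultimately show ?thesis using that by blast
qed

lemma continuous_on_potential:
  fixes m :: "complex \<Rightarrow> complex"
  assumes mm[measurable]: "m \<in> borel_measurable borel" and K: "\<And>t. cmod (m t) \<le> K"
  shows "continuous_on UNIV (potential m)"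
proof -
  have K0: "K \<ge> 0" using K[of 0] norm_ge_zero order_trans by blast
  have "isCont (potential m) a" for a
  proof -
    define \<rho> where "\<rho> = cmod a + 1"
    have \<rho>: "0 \<le> \<rho>" "a \<in> ball 0 \<rho>" by (auto simp: \<rho>_def)
    obtain h where h: "h holomorphic_on ball 0 \<rho>"
      "\<And>a. a \<in> ball 0 \<rho> \<Longrightarrow> potential m a = cauchy_transform (\<lambda>t. m t * indicator (ball 0 \<rho>) t) a + h a"
      by (rule potential_local[OF mm K open_ball bounded_ball]) blast
    have "continuous_on UNIV (cauchy_transform (\<lambda>t. m t * indicator (ball 0 \<rho>) t))"
      by (rule continuous_on_cauchy_transform[where \<rho> = \<rho> and K = K])
         (use K K0 \<rho> in \<open>auto simp: indicator_def\<close>)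
    then have "continuous_on (ball 0 \<rho>) (\<lambda>a. cauchy_transform (\<lambda>t. m t * indicator (ball 0 \<rho>) t) a + h a)"
      using holomorphic_on_imp_continuous_on[OF h(1)]
      by (intro continuous_on_add) (auto intro: continuous_on_subset)
    then have "continuous_on (ball 0 \<rho>) (potential m)"
      by (subst continuous_on_cong[OF refl h(2)])
    then show ?thesis using \<rho>(2) by (simp add: continuous_on_eq_continuous_at)
  qed
  then show ?thesis by (simp add: continuous_at_imp_continuous_on)
qed

lemma holomorphic_on_potential:
  fixes m :: "complex \<Rightarrow> complex"
  assumes mm[measurable]: "m \<in> borel_measurable borel" and K: "\<And>t. cmod (m t) \<le> K"
    and U: "open U" and zero: "AE t in lborel. t \<in> U \<longrightarrow> m t = 0"
  shows "potential m holomorphic_on U"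
proof -
  have "\<exists>e>0. potential m holomorphic_on ball a e" if a: "a \<in> U" for a
  proof -
    obtain e where e: "e > 0" "ball a e \<subseteq> U" using U a by (meson openE)
    obtain h where h: "h holomorphic_on ball a e"
      "\<And>z. z \<in> ball a e \<Longrightarrow> potential m z = cauchy_transform (\<lambda>t. m t * indicator (ball a e) t) z + h z"
      by (rule potential_local[OF mm K open_ball bounded_ball]) blast
    have "cauchy_transform (\<lambda>t. m t * indicator (ball a e) t) z = 0" for z
      unfolding cauchy_transform_def
      by (rule integral_eq_zero_AE, rule AE_mp[OF zero], rule AE_I2)
         (use e in \<open>auto simp: indicator_def\<close>)
    then have "potential m holomorphic_on ball a e"
      using holomorphic_transform[OF h(1)] h(2) by simp
    then show ?thesis using e by blast
  qed
  then show ?thesis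
    unfolding holomorphic_on_open[OF U] by (meson centre_in_ball holomorphic_on_open open_ball)
qed

lemma integral_boxes_zero_imp_AE_zero:
  fixes g :: "complex \<Rightarrow> complex"
  assumes g: "integrable lborel g"
    and zero: "\<And>l u. (LINT t:box l u|lborel. g t) = 0"
  shows "AE t in lborel. g t = 0"
proof -
  have si: "set_integrable lborel A g" if "A \<in> sets borel" for A
    unfolding set_integrable_def by (rule integrable_mult_indicator) (use g that in auto)
  have "(LINT t:A|lborel. g t) = 0" if "A \<in> sets borel" for A
  proof -
    define G where "G = range (\<lambda>(a, b). box a b :: complex set)"
    have "Int_stable G"
      unfolding Int_stable_def G_def by (auto simp: box_Int_box)
    moreover have "G \<subseteq> Pow UNIV" by simp
    moreover have "A \<in> sigma_sets UNIV G"
      using that by (simp add: borel_eq_box G_def sets_measure_of)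
    ultimately show ?thesis
    proof (induction rule: sigma_sets_induct_disjoint)
      fix A assume "A \<in> G" then show "(LINT t:A|lborel. g t) = 0" using zero by (auto simp: G_def)
    next
      show "(LINT t:{}|lborel. g t) = 0" by (simp add: set_lebesgue_integral_def)
    next
      fix A assume A: "A \<in> sigma_sets UNIV G" "(LINT t:A|lborel. g t) = 0"
      have Ab: "A \<in> sets borel" using A(1) by (simp add: borel_eq_box G_def sets_measure_of)
      have "(\<lambda>n. LINT t:box (- (real n *\<^sub>R One)) (real n *\<^sub>R One)|lborel. g t)
         \<longlonglongrightarrow> (LINT t:(\<Union>n. box (- (real n *\<^sub>R One)) (real n *\<^sub>R One))|lborel. g t)"
      proof (rule set_integral_cont_up)
        show "incseq (\<lambda>n. box (- (real n *\<^sub>R One)) (real n *\<^sub>R One) :: complex set)"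
          by (auto simp: incseq_def box_def)
      qed (use si in auto)
      then have "(LINT t:UNIV|lborel. g t) = 0"
        unfolding zero UN_box_eq_UNIV by (simp add: LIMSEQ_const_iff)
      moreover have "(LINT t:UNIV|lborel. g t) = (LINT t:A|lborel. g t) + (LINT t:UNIV - A|lborel. g t)"
        using set_integral_Un[of A "UNIV - A" lborel g] si Ab by (simp add: Un_absorb)
      ultimately show "(LINT t:UNIV - A|lborel. g t) = 0" using A(2) by simp
    next
      fix A :: "nat \<Rightarrow> complex set"
      assume A: "disjoint_family A" "range A \<subseteq> sigma_sets UNIV G" "\<And>i. (LINT t:A i|lborel. g t) = 0"
      have Ab: "A i \<in> sets borel" for i using A(2) by (auto simp: borel_eq_box G_def sets_measure_of)
      have UA: "(\<Union>i. A i) \<in> sets borel" using Ab by auto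
      have "(LINT t:(\<Union>i. A i)|lborel. g t) = (\<Sum>i. LINT t:A i|lborel. g t)"
        by (rule lebesgue_integral_countable_add)
           (use A(1) Ab si[OF UA] in \<open>auto simp: disjoint_family_on_def\<close>)
      then show "(LINT t:(\<Union>i. A i)|lborel. g t) = 0" using A(3) by simp
    qed
  qed
  then show ?thesis
    using sigma_finite_measure.density_zero[OF sigma_finite_lborel g] by simp
qed

text \<open>Where the potential vanishes, the Cauchy transform of \<open>m\<close> cut off to a square is holomorphic,
up to sign the correction term. Cauchy's theorem then makes the integral of \<open>m\<close> over every
rectangle zero.\<close>

lemma potential_eq_0_imp_AE_0:
  fixes m :: "complex \<Rightarrow> complex"
  assumes mm[measurable]: "m \<in> borel_measurable borel" and K: "\<And>t. cmod (m t) \<le> K"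
    and zero: "\<And>a. potential m a = 0"
  shows "AE t in lborel. m t = 0"
proof -
  have K0: "K \<ge> 0" using K[of 0] norm_ge_zero order_trans by blast
  define Q where "Q n = box (- of_nat n *\<^sub>R One) (of_nat n *\<^sub>R One :: complex)" for n
  have QC: "z \<in> Q n \<longleftrightarrow> \<bar>Re z\<bar> < n \<and> \<bar>Im z\<bar> < n" for n z
    by (auto simp: Q_def in_box_complex_iff Basis_complex_def abs_less_iff)
  have Qn: "cmod z < 2 * real n" if "z \<in> Q n" for z n
    using that cmod_le[of z] by (auto simp: QC)
  have Qo: "open (Q n)" "convex (Q n)" "bounded (Q n)" for n
    by (auto simp: Q_def bounded_box)
  have "AE t in lborel. m t * indicator (Q n) t = 0" for n
  proof (rule integral_boxes_zero_imp_AE_zero)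
    let ?B = "Q (Suc n)"
    let ?g = "\<lambda>t. m t * indicator ?B t"
    have [measurable]: "Q k \<in> sets borel" for k using Qo by simp
    have g: "?g \<in> borel_measurable borel" "\<And>t. cmod (?g t) \<le> K"
      "\<And>t. t \<notin> ball 0 (2 * real (Suc n)) \<Longrightarrow> ?g t = 0"
      using K K0 Qn[of _ "Suc n"] by (auto simp: indicator_def)
    show "integrable lborel (\<lambda>t. m t * indicator (Q n) t)"
      by (rule integrable_bounded_supp[of _ K "2 * real n"])
         (use K K0 Qn[of _ n] in \<open>auto simp: indicator_def\<close>)
    have cbx: "(LINT t:box l u|lborel. ?g t) = 0" if lu: "Re l \<le> Re u" "Im l \<le> Im u" "cbox l u \<subseteq> ?B" for l u
    proof -
      obtain h where h: "h holomorphic_on ?B"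
        "\<And>a. a \<in> ?B \<Longrightarrow> potential m a = cauchy_transform ?g a + h a"
        by (rule potential_local[OF mm K Qo(1) Qo(3)]) blast
      have pi: "path_image (rectpath l u) \<subseteq> ?B"
        using path_image_rectpath_subset_cbox[OF lu(1,2)] lu(3) by blast
      have "contour_integral (rectpath l u) (cauchy_transform ?g) = contour_integral (rectpath l u) (\<lambda>a. - h a)"
      proof (rule contour_integral_cong[OF refl])
        fix a assume "a \<in> path_image (rectpath l u)"
        then have "a \<in> ?B" using pi by blast
        from h(2)[OF this] show "cauchy_transform ?g a = - h a" using zero by (simp add: add_eq_0_iff2)
      qed
      also have "\<dots> = 0"
        by (rule contour_integral_unique, rule Cauchy_theorem_convex_simple[OF _ Qo(2)[of "Suc n"]])
           (use h pi in \<open>auto intro!: holomorphic_intros\<close>)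
      finally have "- (2 * pi * \<i>) * (LINT t:box l u|lborel. ?g t) = 0"
        using contour_integral_rectpath_cauchy_transform[OF g _ lu(1,2)] by simp
      then show ?thesis by simp
    qed
    show "(LINT t:box l u|lborel. m t * indicator (Q n) t) = 0" for l u
    proof -
      define l' u' where "l' = Complex (max (Re l) (- n)) (max (Im l) (- n))"
        and "u' = Complex (min (Re u) n) (min (Im u) n)"
      have ind: "indicator (box l u) t *\<^sub>R (m t * indicator (Q n) t) = indicator (box l' u') t *\<^sub>R ?g t" for t
      proof -
        have "t \<in> box l' u' \<longleftrightarrow> t \<in> box l u \<and> t \<in> Q n"
          by (auto simp: QC in_box_complex_iff l'_def u'_def abs_less_iff)
        moreover have "t \<in> Q n \<Longrightarrow> t \<in> ?B" by (auto simp: QC)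
        ultimately show ?thesis by (auto simp: indicator_def)
      qed
      have "(LINT t:box l' u'|lborel. ?g t) = 0"
      proof (cases "Re l' \<le> Re u' \<and> Im l' \<le> Im u'")
        case True
        then show ?thesis
          by (intro cbx) (auto simp: QC in_cbox_complex_iff l'_def u'_def abs_less_iff)
      next
        case False
        then have "box l' u' = {}" by (auto simp: in_box_complex_iff)
        then show ?thesis by (simp add: set_lebesgue_integral_def)
      qed
      then show ?thesis unfolding set_lebesgue_integral_def ind .
    qed
  qed
  then have "AE t in lborel. \<forall>n. m t * indicator (Q n) t = 0" unfolding AE_all_countable by blast
  then show ?thesis
  proof (rule AE_mp, intro AE_I2 impI)
    fix t assume *: "\<forall>n. m t * indicator (Q n) t = 0"
    obtain n where "cmod t < real n" using reals_Archimedean2 by blast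
    then have "t \<in> Q n" using abs_Re_le_cmod[of t] abs_Im_le_cmod[of t] by (auto simp: QC)
    then show "m t = 0" using *[rule_format, of n] by simp
  qed
qed

section \<open>The topology of the sphere\<close>

lemma dist_csphere: "dist x y = dist (stereo x) (stereo y)"
  by (rule dist_csphere_def)

lemma tendsto_csphere_iff:
  "(f \<longlongrightarrow> l) F \<longleftrightarrow> ((\<lambda>x. stereo (f x)) \<longlongrightarrow> stereo l) F"
  by (simp add: tendsto_iff dist_csphere)

lemma continuous_on_stereo [continuous_intros]: "continuous_on A stereo"
  by (auto simp: continuous_on_iff dist_csphere)

lemma norm_sq_pos: "0 < 1 + (cmod z)\<^sup>2" "0 < (cmod z)\<^sup>2 + 1"
  by (simp_all add: add_pos_nonneg add_nonneg_pos)

lemma one_plus_norm_sq_neq_0: "1 + (complex_of_real (cmod z))\<^sup>2 \<noteq> 0"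
proof -
  have "1 + (complex_of_real (cmod z))\<^sup>2 = of_real (1 + (cmod z)\<^sup>2)" by simp
  then show ?thesis using norm_sq_pos(1)[of z] by (metis less_irrefl of_real_eq_0_iff)
qed

text \<open>Inverse stereographic projection. It shows that \<open>fin_part\<close> is continuous off \<open>Infty\<close>.\<close>

lemma fin_part_stereo:
  assumes "x \<noteq> Infty"
  shows "snd (stereo x) \<noteq> 1" "fin_part x = fst (stereo x) / of_real (1 - snd (stereo x))"
proof -
  obtain z where x: "x = Fin z" using assms by (cases x) auto
  have N: "(cmod z)\<^sup>2 + 1 \<noteq> 0" using norm_sq_pos(2)[of z] by linarith
  have one: "1 - snd (stereo x) = 2 / (1 + (cmod z)\<^sup>2)"
    using N by (simp add: x divide_simps)
  then show "snd (stereo x) \<noteq> 1" using norm_sq_pos[of z] by auto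
  note N' = one_plus_norm_sq_neq_0[of z]
  show "fin_part x = fst (stereo x) / of_real (1 - snd (stereo x))"
    unfolding one using N' by (simp add: x)
qed

lemma continuous_on_fin_part: "continuous_on (- {Infty}) fin_part"
proof -
  have "continuous_on (- {Infty}) (\<lambda>x. fst (stereo x) / of_real (1 - snd (stereo x)))"
    by (intro continuous_intros) (use fin_part_stereo(1) in auto)
  then show ?thesis
    by (subst continuous_on_cong[OF refl fin_part_stereo(2)]) auto
qed

lemma open_Fin_image: "open V \<Longrightarrow> open (Fin ` V)"
proof -
  assume "open V"
  have "open (- {Infty :: csphere})" by (rule open_Compl[OF closed_singleton])
  then have "open (- {Infty} \<inter> fin_part -` V)"
    using continuous_open_preimage[OF continuous_on_fin_part _ \<open>open V\<close>] by blast
  also have "- {Infty} \<inter> fin_part -` V = Fin ` V"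
    by (auto simp: image_iff) (metis csphere.exhaust fin_part.simps(1))
  finally show ?thesis .
qed

lemma Fin_measurable [measurable]: "Fin \<in> borel_measurable borel"
  by (rule borel_measurable_continuous_onI[OF continuous_on_Fin])

lemma fin_part_measurable [measurable]: "fin_part \<in> borel_measurable borel"
proof -
  have "(\<lambda>x. if x \<in> - {Infty} then fin_part x else 0) \<in> borel_measurable borel"
    by (rule borel_measurable_continuous_on_if) (auto intro: continuous_on_fin_part)
  also have "(\<lambda>x. if x \<in> - {Infty} then fin_part x else 0) = fin_part"
    by (auto simp: fun_eq_iff)
  finally show ?thesis .
qed

text \<open>The point with homogeneous coordinates \<open>[x : y]\<close>. In these coordinates stereographic
projection has no exceptional point, so continuity of rational maps needs no case distinction.\<close>

definition sph :: "complex \<Rightarrow> complex \<Rightarrow> csphere" where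
  "sph x y = (if y = 0 then Infty else Fin (x / y))"

lemma stereo_sph:
  assumes "x \<noteq> 0 \<or> y \<noteq> 0"
  shows "stereo (sph x y) = (2 * x * cnj y / of_real ((cmod x)\<^sup>2 + (cmod y)\<^sup>2),
      ((cmod x)\<^sup>2 - (cmod y)\<^sup>2) / ((cmod x)\<^sup>2 + (cmod y)\<^sup>2))"
proof (cases "y = 0")
  case False
  have p: "(cmod x)\<^sup>2 + (cmod y)\<^sup>2 > 0" using False by (simp add: add_nonneg_pos)
  have y2: "(cmod y)\<^sup>2 > 0" using False by simp
  have N: "1 + (cmod (x / y))\<^sup>2 = ((cmod x)\<^sup>2 + (cmod y)\<^sup>2) / (cmod y)\<^sup>2"
    using False by (simp add: norm_divide power_divide divide_simps)
  have a: "2 * (x / y) / of_real (1 + (cmod (x / y))\<^sup>2) = 2 * x * cnj y / of_real ((cmod x)\<^sup>2 + (cmod y)\<^sup>2)"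
  proof -
    have "2 * (x / y) / of_real (1 + (cmod (x / y))\<^sup>2)
      = 2 * (x / y) * of_real ((cmod y)\<^sup>2) / of_real ((cmod x)\<^sup>2 + (cmod y)\<^sup>2)"
      unfolding N by simp
    also have "of_real ((cmod y)\<^sup>2) = y * cnj y" by (rule complex_norm_square)
    finally show ?thesis using False by simp
  qed
  have b: "((cmod (x / y))\<^sup>2 - 1) / ((cmod (x / y))\<^sup>2 + 1) = ((cmod x)\<^sup>2 - (cmod y)\<^sup>2) / ((cmod x)\<^sup>2 + (cmod y)\<^sup>2)"
  proof -
    have "(cmod (x / y))\<^sup>2 - 1 = ((cmod x)\<^sup>2 - (cmod y)\<^sup>2) / (cmod y)\<^sup>2"
      using False by (simp add: norm_divide power_divide divide_simps)
    then show ?thesis using N y2 by (simp add: add.commute)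
  qed
  show ?thesis using False a b by (simp add: sph_def)
qed (use assms in \<open>simp add: sph_def\<close>)

lemma tendsto_sph:
  assumes "(f \<longlongrightarrow> a) F" "(g \<longlongrightarrow> b) F" "a \<noteq> 0 \<or> b \<noteq> 0"
    and ne: "\<And>x. f x \<noteq> 0 \<or> g x \<noteq> 0"
  shows "((\<lambda>x. sph (f x) (g x)) \<longlongrightarrow> sph a b) F"
proof -
  have p: "(cmod a)\<^sup>2 + (cmod b)\<^sup>2 \<noteq> 0" using assms(3) by (simp add: sum_power2_eq_zero_iff)
  show ?thesis
    unfolding tendsto_csphere_iff stereo_sph[OF assms(3)] stereo_sph[OF ne]
    by (intro tendsto_intros assms) (use p in \<open>auto simp flip: of_real_power of_real_add\<close>)
qed

text \<open>The coordinate \<open>1 / z\<close> near \<open>Infty\<close>, expressed through stereographic projection so that its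
continuity at \<open>Infty\<close> is visible.\<close>

definition winv :: "csphere \<Rightarrow> complex" where
  "winv x = cnj (fst (stereo x)) / of_real (1 + snd (stereo x))"

lemma winv_Infty: "winv Infty = 0"
  by (simp add: winv_def)

lemma winv_Fin: "z \<noteq> 0 \<Longrightarrow> winv (Fin z) = 1 / z"
proof -
  assume z: "z \<noteq> 0"
  have N: "(cmod z)\<^sup>2 + 1 \<noteq> 0" using norm_sq_pos(2)[of z] by linarith
  have one: "1 + snd (stereo (Fin z)) = 2 * (cmod z)\<^sup>2 / (1 + (cmod z)\<^sup>2)"
    using N by (simp add: divide_simps)
  note N' = one_plus_norm_sq_neq_0[of z]
  have "winv (Fin z) = cnj z / of_real ((cmod z)\<^sup>2)"
    unfolding winv_def one using N' by simp
  also have "\<dots> = 1 / z" unfolding complex_norm_square using z by simp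
  finally show ?thesis .
qed

lemma sph_winv: "x \<noteq> Fin 0 \<Longrightarrow> x = sph 1 (winv x)"
  by (cases x) (auto simp: winv_Infty winv_Fin sph_def)

lemma tendsto_winv_Infty: "(winv \<longlongrightarrow> 0) (at Infty)"
proof -
  have s: "(stereo \<longlongrightarrow> stereo Infty) (at Infty)"
    using tendsto_ident_at[of Infty UNIV] unfolding tendsto_csphere_iff .
  have "((\<lambda>x. cnj (fst (stereo x)) / of_real (1 + snd (stereo x))) \<longlongrightarrow>
      cnj (fst (stereo Infty)) / of_real (1 + snd (stereo Infty))) (at Infty)"
    by (intro tendsto_intros s) auto
  then show ?thesis by (simp add: winv_def[abs_def])
qed

text \<open>The speed of a curve in the chordal metric is at most a multiple of \<open>|h'| / (1 + |h|\<^sup>2)\<close>.\<close>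

lemma stereo_vector_derivative:
  fixes h :: "real \<Rightarrow> complex"
  assumes h: "(h has_vector_derivative h') (at s)"
  obtains D where "((\<lambda>s. stereo (Fin (h s))) has_vector_derivative D) (at s)"
    "norm D \<le> 10 * cmod h' / (1 + (cmod (h s))\<^sup>2)"
proof -
  define N where "N s = 1 + (Re (h s))\<^sup>2 + (Im (h s))\<^sup>2" for s
  have Neq: "N s = 1 + (cmod (h s))\<^sup>2" for s by (simp add: N_def cmod_power2)
  have Np: "N s > 0" for s unfolding Neq by (rule norm_sq_pos)
  have Re: "((\<lambda>s. Re (h s)) has_real_derivative Re h') (at s)"
    and Im: "((\<lambda>s. Im (h s)) has_real_derivative Im h') (at s)"
    using bounded_linear.has_vector_derivative[OF bounded_linear_Re h]
      bounded_linear.has_vector_derivative[OF bounded_linear_Im h]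
    by (simp_all add: has_real_derivative_iff_has_vector_derivative)
  define N' where "N' = 2 * Re (h s) * Re h' + 2 * Im (h s) * Im h'"
  have dN: "(N has_real_derivative N') (at s)"
    unfolding N_def
    using DERIV_add[OF DERIV_add[OF DERIV_const DERIV_power[OF Re]] DERIV_power[OF Im], of 1 2 2]
    by (simp add: N'_def mult_ac)
  have N'le: "\<bar>N'\<bar> \<le> 2 * cmod (h s) * cmod h'"
  proof -
    have "N' = 2 * Re (h s * cnj h')" by (simp add: N'_def)
    moreover have "\<bar>Re (h s * cnj h')\<bar> \<le> cmod (h s) * cmod h'"
      using abs_Re_le_cmod[of "h s * cnj h'"] by (simp add: norm_mult)
    ultimately show ?thesis by (simp add: abs_mult)
  qed
  have di: "((\<lambda>s. 2 / N s) has_real_derivative - (2 * N' / (N s)\<^sup>2)) (at s)"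
    using DERIV_divide[OF DERIV_const dN, of 2] Np[of s] by (simp add: power2_eq_square)
  define D1 where "D1 = (2 / N s) *\<^sub>R h' + (- (2 * N' / (N s)\<^sup>2)) *\<^sub>R h s"
  have d1: "((\<lambda>s. (2 / N s) *\<^sub>R h s) has_vector_derivative D1) (at s)"
    unfolding D1_def by (rule has_vector_derivative_scaleR[OF di h])
  define D2 where "D2 = 2 * N' / (N s)\<^sup>2"
  have d2: "((\<lambda>s. 1 - 2 / N s) has_vector_derivative D2) (at s)"
    unfolding D2_def has_real_derivative_iff_has_vector_derivative[symmetric]
    using DERIV_diff[OF DERIV_const di, of 1] by simp
  have "stereo (Fin (h s)) = ((2 / N s) *\<^sub>R h s, 1 - 2 / N s)" for s
  proof -
    have "((cmod (h s))\<^sup>2 - 1) / ((cmod (h s))\<^sup>2 + 1) = 1 - 2 / N s"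
      using Np[of s] unfolding Neq by (simp add: divide_simps)
    then show ?thesis by (simp add: Neq scaleR_conv_of_real)
  qed
  then have "((\<lambda>s. stereo (Fin (h s))) has_vector_derivative (D1, D2)) (at s)"
    using has_vector_derivative_Pair[OF d1 d2] by simp
  moreover have "norm (D1, D2) \<le> 10 * cmod h' / N s"
  proof -
    have h2: "(cmod (h s))\<^sup>2 \<le> N s" "cmod (h s) \<le> N s"
    proof -
      show "(cmod (h s))\<^sup>2 \<le> N s" by (simp add: Neq)
      have "0 \<le> (cmod (h s) - 1)\<^sup>2" by simp
      then have "2 * cmod (h s) \<le> N s" unfolding Neq by (simp add: power2_eq_square algebra_simps)
      then show "cmod (h s) \<le> N s" using norm_ge_zero[of "h s"] by linarith
    qed
    have "norm D1 \<le> 2 / N s * cmod h' + 2 * \<bar>N'\<bar> / (N s)\<^sup>2 * cmod (h s)"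
      unfolding D1_def by (rule order_trans[OF norm_triangle_ineq]) (use Np[of s] in \<open>simp add: abs_mult\<close>)
    also have "2 * \<bar>N'\<bar> / (N s)\<^sup>2 * cmod (h s) \<le> 4 * cmod h' / N s"
    proof -
      have "2 * \<bar>N'\<bar> * cmod (h s) \<le> 2 * (2 * cmod (h s) * cmod h') * cmod (h s)"
        using N'le by (intro mult_right_mono mult_left_mono) auto
      also have "\<dots> = 4 * cmod h' * (cmod (h s))\<^sup>2" by (simp add: power2_eq_square)
      also have "\<dots> \<le> 4 * cmod h' * N s" using h2 by (intro mult_left_mono) auto
      finally have "2 * \<bar>N'\<bar> * cmod (h s) / (N s)\<^sup>2 \<le> 4 * cmod h' * N s / (N s)\<^sup>2"
        by (rule divide_right_mono) simp
      then show ?thesis using Np[of s] by (simp add: power2_eq_square)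
    qed
    finally have 1: "norm D1 \<le> 6 * cmod h' / N s" by (simp add: add_divide_distrib[symmetric])
    have "2 * \<bar>N'\<bar> \<le> 2 * (2 * cmod (h s) * cmod h')" using N'le by (intro mult_left_mono) auto
    also have "\<dots> \<le> 4 * cmod h' * N s" using h2(2) mult_left_mono[OF h2(2), of "4 * cmod h'"] by (simp add: mult_ac)
    finally have "2 * \<bar>N'\<bar> / (N s)\<^sup>2 \<le> 4 * cmod h' * N s / (N s)\<^sup>2" by (rule divide_right_mono) simp
    then have 2: "norm D2 \<le> 4 * cmod h' / N s"
      using Np[of s] by (simp add: D2_def abs_mult power2_eq_square)
    have "norm (D1, D2) \<le> norm D1 + norm D2" by (rule norm_Pair_le)
    then show ?thesis using 1 2 by (simp add: add_divide_distrib[symmetric])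
  qed
  ultimately show ?thesis using that unfolding Neq by blast
qed

section \<open>Fatou and Julia sets\<close>

lemma open_fatou_set: "open (fatou_set R)"
  unfolding fatou_set_def by auto

lemma closed_julia_set: "closed (julia_set R)"
  unfolding julia_set_def using open_fatou_set by (simp add: closed_def)

lemma julia_plane_eq: "julia_plane R = Fin -` julia_set R"
  by (auto simp: julia_plane_def)

lemma closed_julia_plane: "closed (julia_plane R)"
  unfolding julia_plane_eq using closed_vimage[OF closed_julia_set continuous_on_Fin] .

text \<open>If \<open>g\<close> is a local inverse of \<open>R\<close> near \<open>w\<close>, then \<open>R\<^sup>n = R\<^sup>n\<^sup>+\<^sup>1 \<circ> g\<close> near \<open>R w\<close>, so
normality near \<open>w\<close> is inherited by \<open>R w\<close>.\<close>

lemma fatou_set_forward: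
  assumes U: "open U" and w: "w \<in> U" "Fin w \<in> fatou_set R"
    and r: "r holomorphic_on U" "deriv r w \<noteq> 0" "\<And>z. z \<in> U \<Longrightarrow> R (Fin z) = Fin (r z)"
  shows "R (Fin w) \<in> fatou_set R"
proof -
  obtain V where V: "open V" "Fin w \<in> V" "normal_family_on V (range (\<lambda>n. R ^^ n))"
    using w(2) unfolding fatou_set_def by auto
  have oV: "open (Fin -` V)" using open_vimage[OF V(1) continuous_on_Fin] .
  have o: "open (U \<inter> Fin -` V)" using U oV by auto
  have h': "r holomorphic_on (U \<inter> Fin -` V)" using r(1) by (rule holomorphic_on_subset) auto
  obtain \<delta> where \<delta>: "\<delta> > 0" "ball w \<delta> \<subseteq> U \<inter> Fin -` V" "open (r ` ball w \<delta>)" "inj_on r (ball w \<delta>)"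
    using has_complex_derivative_locally_invertible[OF h' _ o r(2)] w(1) V(2) by auto
  obtain g where g: "g holomorphic_on (r ` ball w \<delta>)" "\<And>z. z \<in> ball w \<delta> \<Longrightarrow> g (r z) = z"
    using holomorphic_has_inverse[OF holomorphic_on_subset[OF h' \<delta>(2)] open_ball \<delta>(4)] by metis
  let ?V' = "Fin ` (r ` ball w \<delta>)"
  have "open ?V'" using open_Fin_image[OF \<delta>(3)] .
  moreover have "normal_family_on ?V' (range (\<lambda>n. R ^^ n))"
    unfolding normal_family_on_def
  proof (intro allI impI)
    fix s :: "nat \<Rightarrow> csphere \<Rightarrow> csphere" assume "range s \<subseteq> range (\<lambda>n. R ^^ n)"
    then have "\<forall>j. \<exists>n. s j = R ^^ n" by auto
    then obtain n where n: "\<And>j. s j = R ^^ n j" by metis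
    define s' where "s' j = R ^^ Suc (n j)" for j
    have "range s' \<subseteq> range (\<lambda>n. R ^^ n)" unfolding s'_def by blast
    then obtain k G where k: "strict_mono k"
      and G: "\<And>K. compact K \<Longrightarrow> K \<subseteq> V \<Longrightarrow> uniform_limit K (\<lambda>j. s' (k j)) G sequentially"
      using V(3) unfolding normal_family_on_def by meson
    define gg where "gg x = Fin (g (fin_part x))" for x
    have "uniform_limit K (\<lambda>j. s (k j)) (G \<circ> gg) sequentially" if K: "compact K" "K \<subseteq> ?V'" for K
    proof -
      have "continuous_on K fin_part"
        using K(2) by (intro continuous_on_subset[OF continuous_on_fin_part]) auto
      moreover have "fin_part ` K \<subseteq> r ` ball w \<delta>" using K(2) by auto
      ultimately have "continuous_on K gg"
        unfolding gg_def
        by (intro continuous_on_compose2[OF continuous_on_Fin]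
              continuous_on_compose2[OF holomorphic_on_imp_continuous_on[OF g(1)]]) auto
      then have "compact (gg ` K)" using K(1) by (rule compact_continuous_image)
      moreover have gK: "gg x \<in> V \<and> R (gg x) = x" if "x \<in> K" for x
      proof -
        obtain z where z: "z \<in> ball w \<delta>" "x = Fin (r z)" using K(2) \<open>x \<in> K\<close> by blast
        then have "gg x = Fin z" by (simp add: gg_def g(2))
        then show ?thesis using z \<delta>(2) r(3)[of z] by auto
      qed
      ultimately have "uniform_limit (gg ` K) (\<lambda>j. s' (k j)) G sequentially" by (intro G) auto
      then have "uniform_limit K (\<lambda>j x. s' (k j) (gg x)) (\<lambda>x. G (gg x)) sequentially"
        by (simp add: uniform_limit_iff)
      moreover have "s' (k j) (gg x) = s (k j) x" if "x \<in> K" for x j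
        using gK[OF that] by (simp add: s'_def n funpow_swap1)
      ultimately show ?thesis
        by (simp add: uniform_limit_iff comp_def)
    qed
    then show "\<exists>k G. strict_mono k \<and> (\<forall>K. compact K \<and> K \<subseteq> ?V' \<longrightarrow> uniform_limit K (\<lambda>j. s (k j)) G sequentially)"
      using k by blast
  qed
  moreover have "R (Fin w) \<in> ?V'" using r(3)[OF w(1)] \<delta>(1) by auto
  ultimately show ?thesis unfolding fatou_set_def by blast
qed

lemma range_stereo: "range stereo = {(z, t). (cmod z)\<^sup>2 + t\<^sup>2 = 1}"
proof (intro equalityI subsetI)
  fix p assume "p \<in> range stereo"
  then obtain x where x: "p = stereo x" by blast
  show "p \<in> {(z, t). (cmod z)\<^sup>2 + t\<^sup>2 = 1}"
  proof (cases x)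
    case (Fin z)
    have p: "(cmod z)\<^sup>2 + 1 > 0" by (rule norm_sq_pos)
    have "cmod (2 * z / of_real (1 + (cmod z)\<^sup>2)) = 2 * cmod z / (1 + (cmod z)\<^sup>2)"
      using p by (simp only: norm_divide norm_mult norm_of_real norm_numeral)
    moreover have "(2 * c / (1 + c\<^sup>2))\<^sup>2 + ((c\<^sup>2 - 1) / (c\<^sup>2 + 1))\<^sup>2 = 1" if "c\<^sup>2 + 1 > 0" for c :: real
    proof -
      have "(2 * c / (1 + c\<^sup>2))\<^sup>2 + ((c\<^sup>2 - 1) / (c\<^sup>2 + 1))\<^sup>2 = ((2 * c)\<^sup>2 + (c\<^sup>2 - 1)\<^sup>2) / (c\<^sup>2 + 1)\<^sup>2"
        by (simp add: power_divide add_divide_distrib add.commute)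
      also have "(2 * c)\<^sup>2 + (c\<^sup>2 - 1)\<^sup>2 = (c\<^sup>2 + 1)\<^sup>2" by (simp add: power2_eq_square algebra_simps)
      finally show ?thesis using that by simp
    qed
    ultimately show ?thesis using p by (simp add: x Fin)
  qed (simp add: x)
next
  fix p :: "complex \<times> real" assume p: "p \<in> {(z, t). (cmod z)\<^sup>2 + t\<^sup>2 = 1}"
  obtain z t where zt: "p = (z, t)" by (cases p)
  then have e: "(cmod z)\<^sup>2 + t\<^sup>2 = 1" using p by simp
  show "p \<in> range stereo"
  proof (cases "t = 1")
    case True
    then have "z = 0" using e by simp
    then show ?thesis using True zt by (metis rangeI stereo.simps(2))
  next
    case False
    have "t\<^sup>2 \<le> 1" using e zero_le_power2[of "cmod z"] by linarith
    then have t1: "t < 1" using False by (metis abs_le_square_iff abs_1 abs_le_iff less_le power_one)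
    define w where "w = z / of_real (1 - t)"
    have w2: "(cmod w)\<^sup>2 = (1 + t) / (1 - t)"
    proof -
      have "(cmod w)\<^sup>2 = (cmod z)\<^sup>2 / (1 - t)\<^sup>2"
        using t1 by (simp add: w_def norm_divide power_divide del: of_real_diff)
      also have "(cmod z)\<^sup>2 = (1 + t) * (1 - t)" using e by (simp add: algebra_simps power2_eq_square)
      finally show ?thesis using t1 by (simp add: power2_eq_square)
    qed
    have N: "1 + (cmod w)\<^sup>2 = 2 / (1 - t)" using t1 unfolding w2 by (simp add: field_simps)
    have "2 * w / of_real (1 + (cmod w)\<^sup>2) = z"
    proof -
      have "2 * w / of_real (1 + (cmod w)\<^sup>2) = 2 * w / of_real (2 / (1 - t))" unfolding N ..
      also have "\<dots> = w * of_real (1 - t)" by (simp del: of_real_diff)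
      also have "\<dots> = z" using t1 by (simp add: w_def del: of_real_diff)
      finally show ?thesis .
    qed
    moreover have "((cmod w)\<^sup>2 - 1) / ((cmod w)\<^sup>2 + 1) = t"
      using N t1 unfolding add.commute[of "(cmod w)\<^sup>2" 1] unfolding N w2 by (simp add: field_simps)
    ultimately have "stereo (Fin w) = p" by (simp add: zt)
    then show ?thesis by (metis rangeI)
  qed
qed

text \<open>This is the theorem of Arzela and Ascoli for the maps \<open>stereo \<circ> R\<^sup>n\<close>; the limit function takes
values in the sphere because the image of \<open>stereo\<close> is closed.\<close>

lemma equi_Lipschitz_imp_fatou:
  assumes e: "e > 0"
    and L: "\<And>n x y. x \<in> ball z e \<Longrightarrow> y \<in> ball z e \<Longrightarrow>
        dist ((R ^^ n) (Fin x)) ((R ^^ n) (Fin y)) \<le> L * dist x y"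
  shows "Fin z \<in> fatou_set R"
proof -
  define S where "S = cball z (e / 2)"
  have S: "compact S" "S \<subseteq> ball z e" "ball z (e / 2) \<subseteq> S"
    using e by (auto simp: S_def)
  have cl: "closed (range stereo)"
  proof -
    have "range stereo = (\<lambda>p. (cmod (fst p))\<^sup>2 + (snd p)\<^sup>2) -` {1}"
      unfolding range_stereo by auto
    moreover have "closed ((\<lambda>p :: complex \<times> real. (cmod (fst p))\<^sup>2 + (snd p)\<^sup>2) -` {1})"
      by (rule closed_vimage) (auto intro!: continuous_intros)
    ultimately show ?thesis by simp
  qed
  have "normal_family_on (Fin ` ball z (e / 2)) (range (\<lambda>n. R ^^ n))"
    unfolding normal_family_on_def
  proof (intro allI impI)
    fix s :: "nat \<Rightarrow> csphere \<Rightarrow> csphere" assume "range s \<subseteq> range (\<lambda>n. R ^^ n)"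
    then have "\<forall>j. \<exists>n. s j = R ^^ n" by auto
    then obtain n where n: "\<And>j. s j = R ^^ n j" by metis
    define F where "F j x = stereo (s j (Fin x))" for j x
    have bd: "norm (F j x) \<le> 2" for j x
    proof -
      have "F j x \<in> range stereo" by (simp add: F_def)
      then have "(norm (F j x))\<^sup>2 = 1" unfolding range_stereo by (auto simp: norm_prod_def)
      then show ?thesis by (metis norm_ge_zero one_le_numeral power2_eq_1_iff order_trans neg_0_le_iff_le not_one_le_zero)
    qed
    have eq: "\<exists>d. 0 < d \<and> (\<forall>j y. y \<in> S \<and> norm (x - y) < d \<longrightarrow> norm (F j x - F j y) < \<epsilon>)"
      if x: "x \<in> S" and \<epsilon>: "0 < \<epsilon>" for x \<epsilon>
    proof (intro exI conjI allI impI)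
      show "0 < \<epsilon> / (\<bar>L\<bar> + 1)" using \<epsilon> by (simp add: add_nonneg_pos)
      fix j y assume y: "y \<in> S \<and> norm (x - y) < \<epsilon> / (\<bar>L\<bar> + 1)"
      have "norm (F j x - F j y) = dist (s j (Fin x)) (s j (Fin y))"
        by (simp add: F_def dist_csphere dist_norm)
      also have "\<dots> \<le> L * dist x y" unfolding n using x y S(2) by (intro L) auto
      also have "\<dots> \<le> (\<bar>L\<bar> + 1) * dist x y" by (intro mult_right_mono) auto
      also have "\<dots> < \<epsilon>"
        using y by (simp add: dist_norm pos_less_divide_eq add_nonneg_pos mult.commute)
      finally show "norm (F j x - F j y) < \<epsilon>" .
    qed
    have "\<exists>g k. strict_mono (k :: nat \<Rightarrow> nat) \<and> (\<forall>\<epsilon>>0. \<exists>N. \<forall>n x. n \<ge> N \<and> x \<in> S \<longrightarrow> norm (F (k n) x - g x) < \<epsilon>)"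
    proof (rule Arzela_Ascoli[of S F 2, OF S(1)])
      show "norm (F n x) \<le> 2" for n x by (rule bd)
      show "\<exists>d. 0 < d \<and> (\<forall>j y. y \<in> S \<and> norm (x - y) < d \<longrightarrow> norm (F j x - F j y) < \<epsilon>)"
        if "x \<in> S" "0 < \<epsilon>" for x \<epsilon> using eq that .
    qed blast
    then obtain g k where k: "strict_mono (k :: nat \<Rightarrow> nat)"
      and g: "\<And>\<epsilon>. 0 < \<epsilon> \<Longrightarrow> \<exists>N. \<forall>n x. n \<ge> N \<and> x \<in> S \<longrightarrow> norm (F (k n) x - g x) < \<epsilon>"
      by blast
    have gr: "g x \<in> range stereo" if "x \<in> S" for x
    proof -
      have "(\<lambda>n. F (k n) x) \<longlonglongrightarrow> g x"
        unfolding tendsto_iff dist_norm eventually_sequentially using g that by blast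
      moreover have "\<forall>n. F (k n) x \<in> range stereo" by (simp add: F_def)
      ultimately show ?thesis 
        using cl[unfolded closed_sequential_limits, rule_format, of "\<lambda>n. F (k n) x" "g x"] by blast
    qed
    define G where "G x = inv stereo (g (fin_part x))" for x
    have sG: "stereo (G (Fin x)) = g x" if "x \<in> S" for x
      using gr[OF that] by (simp add: G_def f_inv_into_f)
    have "uniform_limit K (\<lambda>j. s (k j)) G sequentially" if K: "K \<subseteq> Fin ` ball z (e / 2)" for K
      unfolding uniform_limit_iff eventually_sequentially
    proof (intro allI impI)
      fix \<epsilon> :: real assume "0 < \<epsilon>"
      then obtain N where N: "\<And>n x. n \<ge> N \<Longrightarrow> x \<in> S \<Longrightarrow> norm (F (k n) x - g x) < \<epsilon>" using g by blast
      have "dist (s (k n) x) (G x) < \<epsilon>" if nx: "n \<ge> N" "x \<in> K" for n x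
      proof -
        obtain y where y: "x = Fin y" "y \<in> S" using nx K S(3) by blast
        show ?thesis using N[OF nx(1) y(2)] sG[OF y(2)] by (simp add: y F_def dist_csphere dist_norm)
      qed
      then show "\<exists>N. \<forall>n\<ge>N. \<forall>x\<in>K. dist (s (k n) x) (G x) < \<epsilon>" by blast
    qed
    then show "\<exists>k G. strict_mono k \<and> (\<forall>K. compact K \<and> K \<subseteq> Fin ` ball z (e / 2) \<longrightarrow>
        uniform_limit K (\<lambda>j. s (k j)) G sequentially)"
      using k by blast
  qed
  moreover have "open (Fin ` ball z (e / 2))" by (rule open_Fin_image) simp
  moreover have "Fin z \<in> Fin ` ball z (e / 2)" using e by auto
  ultimately show ?thesis unfolding fatou_set_def by blast
qed

section \<open>Rational maps\<close>

locale rational =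
  fixes p q :: "complex poly" and d :: nat
  assumes coprime: "coprime p q" and deg: "d = max (degree p) (degree q)" and d2: "d \<ge> 2"
begin

abbreviation R :: "csphere \<Rightarrow> csphere" where "R \<equiv> rat_map p q"

definition r :: "complex \<Rightarrow> complex" where "r z = poly p z / poly q z"

definition wronskian :: "complex poly" where "wronskian = pderiv p * q - p * pderiv q"

definition r' :: "complex \<Rightarrow> complex" where "r' z = poly wronskian z / (poly q z)\<^sup>2"

text \<open>The finite points at which \<open>R\<close> is locally biholomorphic with a finite value.\<close>

definition X :: "complex set" where "X = {z. poly q z \<noteq> 0 \<and> poly wronskian z \<noteq> 0}"

definition fibre :: "complex \<Rightarrow> complex set" where "fibre s = {w \<in> X. r w = s}"

lemma no_common_zero: "poly p z \<noteq> 0 \<or> poly q z \<noteq> 0"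
  using coprime coprime_poly_0 by blast

lemma q_nz: "q \<noteq> 0"
proof
  assume "q = 0"
  then have "is_unit p" using coprime by simp
  then have "degree p = 0" using is_unit_iff_degree[of p] by (cases "p = 0") auto
  then show False using \<open>q = 0\<close> deg d2 by simp
qed

lemma p_nz: "p \<noteq> 0"
proof
  assume "p = 0"
  then have "is_unit q" using coprime by simp
  then have "degree q = 0" by (simp add: is_unit_iff_degree q_nz)
  then show False using \<open>p = 0\<close> deg d2 by simp
qed

lemma finite_q_roots: "finite {z. poly q z = 0}"
  using poly_roots_finite[OF q_nz] .

lemma r_deriv: "poly q z \<noteq> 0 \<Longrightarrow> (r has_field_derivative r' z) (at z)"
  unfolding r_def[abs_def] r'_def wronskian_def
  by (auto intro!: derivative_eq_intros poly_DERIV simp: power2_eq_square)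

lemma level_poly_nz: "p - smult s q \<noteq> 0"
proof
  assume "p - smult s q = 0"
  then have e: "p = smult s q" by simp
  then have "q dvd p" by (simp add: dvd_smult)
  then have "is_unit q" using coprime by (meson coprime_common_divisor dvd_refl)
  then have "degree q = 0" by (simp add: is_unit_iff_degree q_nz)
  then have "degree p = 0" using e by simp
  then show False using \<open>degree q = 0\<close> deg d2 by simp
qed

text \<open>Otherwise \<open>r\<close> would be constant on the connected set where it is finite, and one of the
polynomials \<open>p - s q\<close> would vanish identically.\<close>

lemma wronskian_nz: "wronskian \<noteq> 0"
proof
  assume 0: "wronskian = 0"
  let ?S = "- {z. poly q z = 0}"
  have S: "connected ?S" "open ?S"
    using connected_open_delete_finite[of UNIV "{z. poly q z = 0}"] finite_q_roots
    by (auto simp: Compl_eq_Diff_UNIV[symmetric] finite_imp_closed open_Compl)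
  have d: "(r has_field_derivative 0) (at z)" if "z \<in> ?S" for z
    using r_deriv[of z] that by (simp add: r'_def 0)
  then have "continuous_on ?S r"
    by (meson DERIV_continuous continuous_at_imp_continuous_on)
  then obtain c where c: "\<And>z. z \<in> ?S \<Longrightarrow> r z = c"
    using DERIV_zero_connected_constant[OF S finite.emptyI, of r] d by auto
  have "?S \<subseteq> {z. poly (p - smult c q) z = 0}"
    using c by (auto simp: r_def divide_simps)
  moreover have "finite {z. poly (p - smult c q) z = 0}" by (rule poly_roots_finite[OF level_poly_nz])
  ultimately have "finite ?S" by (rule finite_subset)
  then have "finite (?S \<union> {z. poly q z = 0})" using finite_q_roots by simp
  then show False using infinite_UNIV_char_0[where 'a = complex] by (simp add: Compl_partition2 Un_commute)
qed

lemma finite_wronskian_roots: "finite {z. poly wronskian z = 0}"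
  using poly_roots_finite[OF wronskian_nz] .

lemma X_eq: "- X = {z. poly q z = 0} \<union> {z. poly wronskian z = 0}"
  by (auto simp: X_def)

lemma finite_Compl_X: "finite (- X)"
  unfolding X_eq using finite_q_roots finite_wronskian_roots by simp

lemma open_X: "open X"
  using finite_imp_closed[OF finite_Compl_X] by (simp add: closed_def)

lemma Compl_X_null: "- X \<in> null_sets lborel"
  using finite_imp_null_set_lborel[OF finite_Compl_X] .

lemma AE_X: "AE z in lborel. z \<in> X"
  using AE_not_in[OF Compl_X_null] by simp

lemma r'_nz: "z \<in> X \<Longrightarrow> r' z \<noteq> 0"
  by (simp add: X_def r'_def)

lemma r_deriv_X: "z \<in> X \<Longrightarrow> (r has_field_derivative r' z) (at z)"
  by (simp add: X_def r_deriv)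

lemma r_holomorphic: "S \<subseteq> {z. poly q z \<noteq> 0} \<Longrightarrow> r holomorphic_on S"
  unfolding r_def[abs_def] by (auto intro!: holomorphic_intros)

lemma r_holomorphic_X: "r holomorphic_on X"
  by (rule r_holomorphic) (auto simp: X_def)

lemma poly_borel [measurable]: "poly P \<in> borel_measurable (borel :: complex measure)"
  by (intro borel_measurable_continuous_onI continuous_intros)

lemma r_borel [measurable]: "r \<in> borel_measurable borel"
  unfolding r_def[abs_def] by measurable

lemma r'_borel [measurable]: "r' \<in> borel_measurable borel"
  unfolding r'_def[abs_def] by measurable

lemma X_borel [measurable]: "X \<in> sets borel"
  using open_X by simp

lemma finite_level: "finite {z. poly q z \<noteq> 0 \<and> r z = s}"
proof (rule finite_subset)
  show "{z. poly q z \<noteq> 0 \<and> r z = s} \<subseteq> {z. poly (p - smult s q) z = 0}"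
    by (auto simp: r_def divide_simps)
qed (rule poly_roots_finite[OF level_poly_nz])

lemma finite_fibre: "finite (fibre s)"
  by (rule finite_subset[OF _ finite_level[of s]]) (auto simp: fibre_def X_def)

lemma R_Fin: "poly q z \<noteq> 0 \<Longrightarrow> R (Fin z) = Fin (r z)"
  by (simp add: rat_map_def r_def)

lemma R_Fin_X: "z \<in> X \<Longrightarrow> R (Fin z) = Fin (r z)"
  by (simp add: R_Fin X_def)

lemma R_Fin_eq_Fin: "R (Fin z) = Fin s \<longleftrightarrow> poly q z \<noteq> 0 \<and> r z = s"
  by (simp add: rat_map_def r_def)

text \<open>The polynomial \<open>P\<close> in the coordinate \<open>w = 1 / z\<close>, made homogeneous of degree \<open>d\<close>.\<close>

definition rev_poly :: "complex poly \<Rightarrow> complex \<Rightarrow> complex" where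
  "rev_poly P w = (\<Sum>i\<le>d. coeff P i * w ^ (d - i))"

lemma rev_poly:
  assumes "w \<noteq> 0" "degree P \<le> d"
  shows "rev_poly P w = w ^ d * poly P (1 / w)"
proof -
  have "poly P (1 / w) = (\<Sum>i\<le>d. coeff P i * (1 / w) ^ i)"
    unfolding poly_altdef
    by (rule sum.mono_neutral_left) (use assms(2) in \<open>auto simp: coeff_eq_0\<close>)
  then show ?thesis
    using assms(1) by (simp add: rev_poly_def sum_distrib_left power_diff power_divide mult_ac)
qed

lemma rev_poly_0: "rev_poly P 0 = coeff P d"
proof -
  have "rev_poly P 0 = (\<Sum>i\<in>{d}. coeff P i * 0 ^ (d - i))"
    unfolding rev_poly_def by (rule sum.mono_neutral_right) auto
  then show ?thesis by simp
qed

lemma R_sph_Fin: "R (Fin z) = sph (poly p z) (poly q z)"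
  by (simp add: rat_map_def sph_def)

lemma R_sph_Infty: "R (sph 1 w) = sph (rev_poly p w) (rev_poly q w)"
proof (cases "w = 0")
  case True
  then show ?thesis by (simp add: sph_def rev_poly_0 rat_map_def deg[symmetric] Let_def)
next
  case False
  have "degree p \<le> d" "degree q \<le> d" using deg by auto
  then show ?thesis using False by (simp add: sph_def[of 1] R_sph_Fin rev_poly) (simp add: sph_def)
qed

lemma rev_poly_no_common_zero: "rev_poly p w \<noteq> 0 \<or> rev_poly q w \<noteq> 0"
proof (cases "w = 0")
  case True
  have "coeff p d \<noteq> 0 \<or> coeff q d \<noteq> 0"
    using deg p_nz q_nz by (auto simp: max_def) 
  then show ?thesis using True by (simp add: rev_poly_0)
next
  case False
  have "degree p \<le> d" "degree q \<le> d" using deg by auto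
  then show ?thesis using False no_common_zero[of "1 / w"] by (simp add: rev_poly)
qed

lemma continuous_on_R: "continuous_on UNIV R"
proof -
  have "isCont R x" for x
  proof (cases x)
    case (Fin z)
    have "continuous_on (- {Infty}) (\<lambda>x. R (Fin (fin_part x)))"
      unfolding continuous_on_def
    proof
      fix x :: csphere assume "x \<in> - {Infty}"
      then have "(fin_part \<longlongrightarrow> fin_part x) (at x within - {Infty})"
        using continuous_on_fin_part by (simp add: continuous_on_def)
      then show "((\<lambda>x. R (Fin (fin_part x))) \<longlongrightarrow> R (Fin (fin_part x))) (at x within - {Infty})"
        unfolding R_sph_Fin by (intro tendsto_sph no_common_zero tendsto_intros)
    qed
    also have "continuous_on (- {Infty}) (\<lambda>x. R (Fin (fin_part x))) \<longleftrightarrow> continuous_on (- {Infty}) R"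
      by (rule continuous_on_cong[OF refl]) (metis ComplD csphere.exhaust fin_part.simps(1) singletonI)
    finally have "continuous_on (- {Infty}) R" .
    then show ?thesis
      using Fin by (simp add: continuous_on_eq_continuous_at open_Compl)
  next
    case Infty
    have rp: "((\<lambda>x. rev_poly P (winv x)) \<longlongrightarrow> rev_poly P 0) (at Infty)" for P
      unfolding rev_poly_def by (intro tendsto_intros tendsto_winv_Infty)
    have "((\<lambda>x. sph (rev_poly p (winv x)) (rev_poly q (winv x))) \<longlongrightarrow> sph (rev_poly p 0) (rev_poly q 0)) (at Infty)"
      using rp[of p] rp[of q] by (intro tendsto_sph rev_poly_no_common_zero) auto
    moreover have "eventually (\<lambda>x. sph (rev_poly p (winv x)) (rev_poly q (winv x)) = R x) (at Infty)"
    proof -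
      have "eventually (\<lambda>x. x \<noteq> Fin 0) (at Infty)"
        using t1_space_nhds[of Infty "Fin 0"] by (simp add: eventually_at_filter) (auto elim: eventually_mono)
      then show ?thesis
        by eventually_elim (metis R_sph_Infty sph_winv)
    qed
    moreover have "sph (rev_poly p 0) (rev_poly q 0) = R Infty"
      using R_sph_Infty[of 0] by (simp add: sph_def)
    ultimately show ?thesis
      unfolding Infty isCont_def by (simp add: Lim_transform_eventually)
  qed
  then show ?thesis by (simp add: continuous_at_imp_continuous_on)
qed

lemma continuous_on_R_funpow: "continuous_on UNIV (R ^^ n)"
proof (induction n)
  case (Suc n)
  then show ?case
    using continuous_on_compose[of UNIV "R ^^ n" R] continuous_on_R
    by (simp add: continuous_on_subset)
qed (simp add: id_def)

lemma R_borel [measurable]: "R \<in> borel_measurable borel"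
  by (rule borel_measurable_continuous_onI[OF continuous_on_R])

lemma finite_R_vimage: "finite (R -` {y})"
proof -
  have "finite {z. R (Fin z) = y}"
  proof (cases y)
    case (Fin s)
    then show ?thesis using finite_level[of s] by (simp add: R_Fin_eq_Fin)
  next
    case Infty
    then have "{z. R (Fin z) = y} = {z. poly q z = 0}" by (auto simp: rat_map_def)
    then show ?thesis using finite_q_roots by simp
  qed
  then have "finite (insert Infty (Fin ` {z. R (Fin z) = y}))" by simp
  moreover have "R -` {y} \<subseteq> insert Infty (Fin ` {z. R (Fin z) = y})"
    by (auto simp: image_iff) (metis csphere.exhaust)
  ultimately show ?thesis by (rule finite_subset[rotated])
qed

lemma finite_R_funpow_vimage:
  assumes "finite A" shows "finite ((R ^^ n) -` A)"
  using assms
proof (induction n arbitrary: A)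
  case (Suc n)
  have "R -` A = (\<Union>y\<in>A. R -` {y})" by auto
  then have "finite (R -` A)" using Suc.prems finite_R_vimage by simp
  then have "finite ((R ^^ n) -` (R -` A))" by (rule Suc.IH)
  moreover have "(R ^^ Suc n) -` A = (R ^^ n) -` (R -` A)" by auto
  ultimately show ?case by (simp only:)
qed simp

lemma finite_Fin_vimage: "finite A \<Longrightarrow> finite (Fin -` A)"
  by (rule finite_vimageI) (auto simp: inj_def)

text \<open>A branch through \<open>w\<close> has derivative \<open>1 / r' w\<close> by the chain rule; conversely the inverse
function theorem supplies a branch through every point of the fibre.\<close>

lemma inverse_branch_jets: "inverse_branch_jets R z = (\<lambda>w. (w, 1 / r' w)) ` fibre z"
proof (intro equalityI subsetI)
  fix j assume "j \<in> inverse_branch_jets R z"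
  then obtain \<zeta> e where j: "j = (\<zeta> z, deriv \<zeta> z)" and e: "e > 0" and h: "\<zeta> holomorphic_on ball z e"
    and b: "\<And>u. u \<in> ball z e \<Longrightarrow> R (Fin (\<zeta> u)) = Fin u"
    unfolding inverse_branch_jets_def by blast
  have b': "poly q (\<zeta> u) \<noteq> 0 \<and> r (\<zeta> u) = u" if "u \<in> ball z e" for u
    using b[OF that] by (simp add: R_Fin_eq_Fin)
  have z: "z \<in> ball z e" using e by simp
  have d\<zeta>: "(\<zeta> has_field_derivative deriv \<zeta> z) (at z)" using holomorphic_derivI[OF h open_ball z] .
  have "((\<lambda>u. r (\<zeta> u)) has_field_derivative r' (\<zeta> z) * deriv \<zeta> z) (at z)"
    by (rule DERIV_chain2[OF r_deriv d\<zeta>]) (use b'[OF z] in simp)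
  moreover have "((\<lambda>u. r (\<zeta> u)) has_field_derivative 1) (at z)"
    by (rule has_field_derivative_transform_within_open[OF DERIV_ident open_ball z]) (use b' in simp)
  ultimately have one: "r' (\<zeta> z) * deriv \<zeta> z = 1" by (rule DERIV_unique)
  then have "poly wronskian (\<zeta> z) \<noteq> 0" by (auto simp: r'_def)
  then have "\<zeta> z \<in> fibre z" using b'[OF z] by (simp add: fibre_def X_def)
  moreover have "deriv \<zeta> z = 1 / r' (\<zeta> z)" using one by (metis mult.commute nonzero_eq_divide_eq mult_zero_left zero_neq_one)
  ultimately show "j \<in> (\<lambda>w. (w, 1 / r' w)) ` fibre z" using j by blast
next
  fix j assume "j \<in> (\<lambda>w. (w, 1 / r' w)) ` fibre z"
  then obtain w where j: "j = (w, 1 / r' w)" and w: "w \<in> X" "r w = z" by (auto simp: fibre_def)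
  have dr: "deriv r w = r' w" using r_deriv_X[OF w(1)] by (rule DERIV_imp_deriv)
  then have "deriv r w \<noteq> 0" using r'_nz[OF w(1)] by simp
  from has_complex_derivative_locally_invertible[OF r_holomorphic_X w(1) open_X this]
  obtain e where e: "e > 0" "ball w e \<subseteq> X" "open (r ` ball w e)" "inj_on r (ball w e)" by metis
  obtain g where g: "g holomorphic_on (r ` ball w e)"
    "\<And>u. u \<in> ball w e \<Longrightarrow> deriv r u * deriv g (r u) = 1" "\<And>u. u \<in> ball w e \<Longrightarrow> g (r u) = u"
    using holomorphic_has_inverse[OF holomorphic_on_subset[OF r_holomorphic_X e(2)] open_ball e(4)] by metis
  have "z \<in> r ` ball w e" using w(2) e(1) by (metis centre_in_ball imageI)
  then obtain s where s: "s > 0" "ball z s \<subseteq> r ` ball w e" using e(3) by (meson openE)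
  have "R (Fin (g u)) = Fin u" if "u \<in> ball z s" for u
  proof -
    obtain t where "t \<in> ball w e" "u = r t" using s(2) \<open>u \<in> ball z s\<close> by blast
    then show ?thesis using g(3) e(2) R_Fin_X by auto
  qed
  moreover have "g holomorphic_on ball z s" using g(1) s(2) by (rule holomorphic_on_subset)
  moreover have "j = (g z, deriv g z)"
  proof -
    have wb: "w \<in> ball w e" using e(1) by simp
    have "r' w * deriv g z = 1" using g(2)[OF wb] dr w(2) by simp
    then have "deriv g z = 1 / r' w" by (metis mult.commute nonzero_eq_divide_eq mult_zero_left zero_neq_one)
    then show ?thesis using g(3)[OF wb] w(2) j by simp
  qed
  ultimately show "j \<in> inverse_branch_jets R z" unfolding inverse_branch_jets_def using s(1) by blast
qed

lemma ruelle_eq: "ruelle R \<phi> z = (\<Sum>w\<in>fibre z. \<phi> w / (r' w)\<^sup>2)"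
  unfolding ruelle_def inverse_branch_jets
  by (subst sum.reindex) (auto simp: inj_on_def power_divide)

lemma
  assumes f: "f \<in> borel_measurable borel"
  shows transfer_borel: "(\<lambda>s. \<Sum>w\<in>fibre s. f w / ennreal ((cmod (r' w))\<^sup>2)) \<in> borel_measurable borel"
    and transfer: "(\<integral>\<^sup>+z. f z \<partial>lborel) = (\<integral>\<^sup>+s. (\<Sum>w\<in>fibre s. f w / ennreal ((cmod (r' w))\<^sup>2)) \<partial>lborel)"
  unfolding fibre_def
  by (rule nn_integral_fibres[OF open_X Compl_X_null r_deriv_X r'_nz r_borel r'_borel finite_fibre[unfolded fibre_def] f]; assumption)+

text \<open>Integrating the indicator of the preimage of a null set along the fibres gives zero.\<close>

lemma AE_pullback:
  assumes "AE s in lborel. P s" shows "AE z in lborel. P (r z)"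
proof -
  obtain N where N: "N \<in> null_sets lborel" "{s. \<not> P s} \<subseteq> N"
    using assms by (auto elim!: AE_E simp: null_sets_def)
  have [measurable]: "N \<in> sets borel" using N by auto
  have "(\<integral>\<^sup>+z. indicator (r -` N) z \<partial>lborel) = (\<integral>\<^sup>+s. (\<Sum>w\<in>fibre s. indicator (r -` N) w / ennreal ((cmod (r' w))\<^sup>2)) \<partial>lborel)"
    by (rule transfer) measurable
  also have "\<dots> = (\<integral>\<^sup>+s. 0 \<partial>(lborel :: complex measure))"
  proof (rule nn_integral_cong_AE, rule AE_mp[OF AE_not_in[OF N(1)]], intro AE_I2 impI sum.neutral ballI)
    fix s w assume "s \<notin> N" "w \<in> fibre s"
    then have "r w \<notin> N" by (simp add: fibre_def)
    then show "indicator (r -` N) w / ennreal ((cmod (r' w))\<^sup>2) = 0" by simp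
  qed
  finally have "emeasure lborel (r -` N) = 0"
    using measurable_sets_borel[OF r_borel, of N] by simp
  then have "r -` N \<in> null_sets lborel" using measurable_sets_borel[OF r_borel, of N] by auto
  from AE_not_in[OF this] show ?thesis
    by (rule AE_mp) (rule AE_I2, use N(2) in blast)
qed

text \<open>Dually, almost every fibre avoids a null set.\<close>

lemma AE_pushforward:
  assumes "AE z in lborel. P z" shows "AE s in lborel. \<forall>w\<in>fibre s. P w"
proof -
  obtain N where N: "N \<in> null_sets lborel" "{s. \<not> P s} \<subseteq> N"
    using assms by (auto elim!: AE_E simp: null_sets_def)
  have [measurable]: "N \<in> sets borel" using N by auto
  let ?g = "\<lambda>s. \<Sum>w\<in>fibre s. indicator N w / ennreal ((cmod (r' w))\<^sup>2)"
  have g[measurable]: "?g \<in> borel_measurable borel" by (rule transfer_borel) measurable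
  have "(\<integral>\<^sup>+s. ?g s \<partial>lborel) = (\<integral>\<^sup>+z. indicator N z \<partial>lborel)" by (rule transfer[symmetric]) measurable
  also have "\<dots> = 0" using N by auto
  finally have "AE s in lborel. ?g s = 0" by (subst (asm) nn_integral_0_iff_AE) auto
  then show ?thesis
  proof (rule AE_mp, intro AE_I2 impI ballI)
    fix s w assume "?g s = 0" and w: "w \<in> fibre s"
    then have "indicator N w / ennreal ((cmod (r' w))\<^sup>2) = 0"
      using finite_fibre by (simp add: sum_eq_0_iff)
    then have "w \<notin> N" using w by (auto simp: ennreal_divide_eq_0_iff)
    then show "P w" using N(2) by blast
  qed
qed

lemma julia_backward: "w \<in> X \<Longrightarrow> r w \<in> julia_plane R \<Longrightarrow> w \<in> julia_plane R"
proof -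
  assume w: "w \<in> X" and J: "r w \<in> julia_plane R"
  have dr: "deriv r w \<noteq> 0" using r_deriv_X[OF w] r'_nz[OF w] by (simp add: DERIV_imp_deriv)
  have "Fin w \<notin> fatou_set R"
  proof
    assume "Fin w \<in> fatou_set R"
    from fatou_set_forward[OF open_X w this r_holomorphic_X dr R_Fin_X]
    have "R (Fin w) \<in> fatou_set R" .
    then show False using J R_Fin_X[OF w] by (simp add: julia_plane_def julia_set_def)
  qed
  then show ?thesis by (simp add: julia_plane_def julia_set_def)
qed

text \<open>If \<open>p - s q\<close> had only one root, that root would be multiple and so a zero of the Wronskian.\<close>

lemma two_preimages:
  assumes s: "s \<notin> r ` {z. poly wronskian z = 0}" and cf: "degree (p - smult s q) = d"
  shows "\<exists>x y. x \<noteq> y \<and> poly q x \<noteq> 0 \<and> poly q y \<noteq> 0 \<and> r x = s \<and> r y = s"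
proof -
  let ?P = "p - smult s q"
  have nz: "?P \<noteq> 0" by (rule level_poly_nz)
  have root: "poly q z \<noteq> 0 \<and> r z = s" if "poly ?P z = 0" for z
    using that no_common_zero[of z] by (auto simp: r_def divide_simps)
  have "\<not> constant (poly ?P)" using cf d2 constant_degree[of ?P] by simp
  then obtain x where x: "poly ?P x = 0" using fundamental_theorem_of_algebra by blast
  then obtain Q where Q: "?P = [:- x, 1:] * Q" using poly_eq_0_iff_dvd by (metis dvdE)
  then have "Q \<noteq> 0" using nz by auto
  then have "degree ?P = Suc (degree Q)" unfolding Q by (subst degree_mult_eq) auto
  then have "degree Q \<noteq> 0" using cf d2 by simp
  then have "\<not> constant (poly Q)" using constant_degree[of Q] by simp
  then obtain y where y: "poly Q y = 0" using fundamental_theorem_of_algebra by blast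
  have "x \<noteq> y"
  proof
    assume "x = y"
    then obtain Q' where "Q = [:- x, 1:] * Q'" using y poly_eq_0_iff_dvd by (metis dvdE)
    then have PP: "?P = [:- x, 1:] * ([:- x, 1:] * Q')" using Q by simp
    have "poly (pderiv ?P) x = 0"
      unfolding PP by (simp only: pderiv_mult poly_add poly_mult) (simp add: pderiv_pCons)
    then have 1: "poly (pderiv p) x = s * poly (pderiv q) x" by (simp add: pderiv_diff pderiv_smult)
    have 2: "poly p x = s * poly q x" using x by simp
    have "poly wronskian x = 0" unfolding wronskian_def by (simp add: 1 2)
    then show False using s root[OF x] by blast
  qed
  moreover have "poly ?P y = 0" unfolding Q using y by simp
  ultimately show ?thesis using root[OF x] root by blast
qed

lemma finite_low_degree: "finite {s. degree (p - smult s q) \<noteq> d}"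
proof -
  have "s = coeff p d / coeff q d \<and> coeff q d \<noteq> 0" if "degree (p - smult s q) \<noteq> d" for s
  proof -
    have le: "degree (p - smult s q) \<le> d"
      using degree_diff_le[of p d "smult s q"] degree_smult_le[of s q] deg by (simp add: le_max_iff_disj max_def)
    then have "degree (p - smult s q) < d" using that by simp
    then have c: "coeff p d = s * coeff q d" using coeff_eq_0[of "p - smult s q" d] by simp
    have "coeff p d \<noteq> 0 \<or> coeff q d \<noteq> 0" using deg p_nz q_nz by (auto simp: max_def)
    then have "coeff q d \<noteq> 0" using c by auto
    then show ?thesis using c by simp
  qed
  then have "{s. degree (p - smult s q) \<noteq> d} \<subseteq> {coeff p d / coeff q d}" by blast
  then show ?thesis using finite_subset by blast
qed

lemma not_inj_on_cofinite:
  assumes "finite F" shows "\<exists>x y. x \<noteq> y \<and> x \<notin> F \<and> y \<notin> F \<and> poly q x \<noteq> 0 \<and> poly q y \<noteq> 0 \<and> r x = r y"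
proof -
  have "finite (r ` {z. poly wronskian z = 0} \<union> {s. degree (p - smult s q) \<noteq> d} \<union> r ` F)"
    using finite_wronskian_roots finite_low_degree assms by simp
  from ex_new_if_finite[OF infinite_UNIV_char_0[where 'a = complex] this]
  obtain s where s: "s \<notin> r ` {z. poly wronskian z = 0}" "degree (p - smult s q) = d" "s \<notin> r ` F"
    by auto
  obtain x y where xy: "x \<noteq> y" "poly q x \<noteq> 0" "poly q y \<noteq> 0" "r x = s" "r y = s"
    using two_preimages[OF s(1,2)] by blast
  moreover have "x \<notin> F" "y \<notin> F" using s(3) xy(4,5) by (metis imageI)+
  ultimately show ?thesis by (intro exI[of _ x] exI[of _ y]) simp
qed

end

lemma rational_map_of_degreeE:
  assumes "rational_map_of_degree d R" "d \<ge> 2"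
  obtains p q where "rational p q d" "R = rat_map p q"
  using assms unfolding rational_map_of_degree_def rational_def by blast

section \<open>Invariant Beltrami coefficients\<close>

context rational
begin

definition beltrami_invariant :: "(complex \<Rightarrow> complex) \<Rightarrow> bool" where
  "beltrami_invariant m \<longleftrightarrow> (AE t in lborel. m t = m (r t) * cnj (r' t) / r' t)"

text \<open>Invariance turns the Jacobian \<open>|r'|\<^sup>2\<close> into \<open>r'\<^sup>2\<close>: since \<open>m (r t) cnj r' = m t r'\<close>,
we have \<open>m (r t) |r'|\<^sup>2 = m t r'\<^sup>2\<close>.\<close>

lemma cauchy_transform_change:
  assumes mm[measurable]: "m \<in> borel_measurable borel" and inv: "beltrami_invariant m"
    and B: "open B" "bounded B" "B \<subseteq> X" "inj_on r B" and bd: "\<And>t. t \<in> B \<Longrightarrow> cmod (r' t) \<le> M"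
  shows "cauchy_transform (\<lambda>s. m s * indicator (r ` B) s) w
    = (LINT t|lborel. indicator B t * (m t * (r' t)\<^sup>2 / (r t - w)))"
proof -
  have op: "open (r ` B)"
    using open_mapping_thm3[OF holomorphic_on_subset[OF r_holomorphic_X B(3)] B(1) B(4)] .
  have [measurable]: "B \<in> sets borel" "r ` B \<in> sets borel" using B op by auto
  have eq: "distr (density lborel (\<lambda>z. ennreal ((cmod (r' z))\<^sup>2) * indicator B z)) borel r
       = density lborel (indicator (r ` B))"
    by (rule nn_integral_holomorphic_image(2)[OF B(1,2) _ B(4) r_borel r'_borel bd, of "\<lambda>_. 0"])
       (use B(3) r_deriv_X in auto)
  have "cauchy_transform (\<lambda>s. m s * indicator (r ` B) s) w
      = (LINT s|lborel. indicator (r ` B) s *\<^sub>R (m s / (s - w)))"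
    unfolding cauchy_transform_def
    by (intro Bochner_Integration.integral_cong) (auto simp: scaleR_conv_of_real indicator_def)
  also have "\<dots> = (LINT s|density lborel (\<lambda>s. ennreal (indicator (r ` B) s)). m s / (s - w))"
    by (subst integral_density) auto
  also have "density lborel (\<lambda>s. ennreal (indicator (r ` B) s)) = density lborel (indicator (r ` B))"
    by (simp add: ennreal_indicator)
  also have "\<dots> = distr (density lborel (\<lambda>z. ennreal ((cmod (r' z))\<^sup>2 * indicator B z))) borel r"
    unfolding eq[symmetric] by (auto simp: indicator_def intro!: arg_cong[of _ _ "\<lambda>f. distr (density lborel f) borel r"])
  also have "(LINT s|\<dots>. m s / (s - w)) = (LINT t|density lborel (\<lambda>z. ennreal ((cmod (r' z))\<^sup>2 * indicator B z)). m (r t) / (r t - w))"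
    by (subst integral_distr) auto
  also have "\<dots> = (LINT t|lborel. ((cmod (r' t))\<^sup>2 * indicator B t) *\<^sub>R (m (r t) / (r t - w)))"
    by (subst integral_density) auto
  also have "\<dots> = (LINT t|lborel. indicator B t * (m t * (r' t)\<^sup>2 / (r t - w)))"
  proof (rule integral_cong_AE)
    show "AE t in lborel. ((cmod (r' t))\<^sup>2 * indicator B t) *\<^sub>R (m (r t) / (r t - w))
        = indicator B t * (m t * (r' t)\<^sup>2 / (r t - w))"
      using inv unfolding beltrami_invariant_def
    proof (rule AE_mp, intro AE_I2 impI)
      fix t assume t: "m t = m (r t) * cnj (r' t) / r' t"
      show "((cmod (r' t))\<^sup>2 * indicator B t) *\<^sub>R (m (r t) / (r t - w))
        = indicator B t * (m t * (r' t)\<^sup>2 / (r t - w))"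
      proof (cases "t \<in> B")
        case True
        then have nz: "r' t \<noteq> 0" using B(3) r'_nz by blast
        have "m t * (r' t)\<^sup>2 = m (r t) * (r' t * cnj (r' t))"
          unfolding t using nz by (simp add: power2_eq_square)
        also have "r' t * cnj (r' t) = of_real ((cmod (r' t))\<^sup>2)" by (rule complex_norm_square[symmetric])
        finally show ?thesis using True by (simp add: scaleR_conv_of_real)
      qed simp
    qed
  qed measurable
  finally show ?thesis .
qed

text \<open>After the change of variables the singular parts of \<open>v \<circ> r\<close> and \<open>r' v\<close> combine into one integral
of \<open>m\<close> against \<open>r'(t)\<^sup>2 / (r t - r z) - r'(z) / (t - z)\<close>. As a function of \<open>z\<close> this kernel has a
removable singularity at \<open>t\<close>, where the two poles cancel, and the maximum principle bounds it
uniformly in \<open>t\<close> by its values on a circle around \<open>B\<close>.\<close>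

lemma eta_holomorphic_near:
  assumes mm[measurable]: "m \<in> borel_measurable borel" and K: "\<And>t. cmod (m t) \<le> K"
    and inv: "beltrami_invariant m" and a0: "a0 \<in> X"
  shows "\<exists>e>0. (\<lambda>z. potential m (r z) - r' z * potential m z) holomorphic_on ball a0 e"
proof -
  have K0: "K \<ge> 0" using K[of 0] norm_ge_zero order_trans by blast
  have dr: "deriv r z = r' z" if "z \<in> X" for z using r_deriv_X[OF that] by (rule DERIV_imp_deriv)
  have "deriv r a0 \<noteq> 0" using dr[OF a0] r'_nz[OF a0] by simp
  from has_complex_derivative_locally_invertible[OF r_holomorphic_X a0 open_X this]
  obtain e0 where e0: "e0 > 0" "ball a0 e0 \<subseteq> X" "inj_on r (ball a0 e0)" by metis
  let ?E = "ball a0 e0"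
  define \<epsilon> where "\<epsilon> = e0 / 4"
  have \<epsilon>: "\<epsilon> > 0" "\<epsilon> < e0" "2 * \<epsilon> < e0" using e0 by (auto simp: \<epsilon>_def)
  define B where "B = ball a0 \<epsilon>"
  have BE: "B \<subseteq> ?E" "B \<subseteq> X" "cball a0 (2 * \<epsilon>) \<subseteq> ?E" "cball a0 \<epsilon> \<subseteq> ?E" using \<epsilon> e0(2) by (auto simp: B_def)
  have B: "open B" "bounded B" "B \<subseteq> X" "inj_on r B"
    using BE e0(3) inj_on_subset by (auto simp: B_def)
  have [measurable]: "B \<in> sets borel" using B by simp
  have hE: "r holomorphic_on ?E" using r_holomorphic_X e0(2) by (rule holomorphic_on_subset)
  have h'E: "r' holomorphic_on ?E"
  proof -
    have "deriv r holomorphic_on ?E" by (rule holomorphic_deriv[OF hE open_ball])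
    then show ?thesis by (rule holomorphic_transform) (use dr e0(2) in auto)
  qed
  have cE: "continuous_on ?E r" "continuous_on ?E r'"
    using hE h'E by (simp_all add: holomorphic_on_imp_continuous_on)
  have bdr: "bounded (r ` B)"
  proof (rule bounded_subset)
    show "bounded (r ` cball a0 \<epsilon>)"
      by (intro compact_imp_bounded compact_continuous_image continuous_on_subset[OF cE(1) BE(4)]) auto
  qed (auto simp: B_def)
  obtain M0 where M0: "\<And>t. t \<in> B \<Longrightarrow> cmod (r' t) \<le> M0"
  proof -
    have "bounded (r' ` cball a0 \<epsilon>)"
      by (intro compact_imp_bounded compact_continuous_image continuous_on_subset[OF cE(2) BE(4)]) auto
    then obtain M where "\<And>x. x \<in> r' ` cball a0 \<epsilon> \<Longrightarrow> norm x \<le> M" using bounded_iff by metis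
    then show ?thesis using that[of M] by (auto simp: B_def)
  qed
  have oV: "open (r ` B)"
    using open_mapping_thm3[OF holomorphic_on_subset[OF r_holomorphic_X B(3)] B(1) B(4)] .
  obtain h1 where h1: "h1 holomorphic_on (r ` B)"
    "\<And>a. a \<in> r ` B \<Longrightarrow> potential m a = cauchy_transform (\<lambda>t. m t * indicator (r ` B) t) a + h1 a"
    by (rule potential_local[OF mm K oV bdr]) blast
  obtain h2 where h2: "h2 holomorphic_on B"
    "\<And>a. a \<in> B \<Longrightarrow> potential m a = cauchy_transform (\<lambda>t. m t * indicator B t) a + h2 a"
    by (rule potential_local[OF mm K B(1,2)]) blast
  define k where "k t z = (r' t)\<^sup>2 / (r t - r z) - r' z / (t - z)" for t z
  \<comment> \<open>the kernel is \<open>Nn t z / (t - z)\<close> with \<open>Nn t t = 0\<close>\<close>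
  define \<phi> where "\<phi> t z = (if z = t then deriv r t else (r z - r t) / (z - t))" for t z
  define Nn where "Nn t z = (r' t)\<^sup>2 / \<phi> t z - r' z" for t z
  define kk where "kk t z = (if z = t then - deriv (Nn t) t else k t z)" for t z
  have kk_hol: "kk t holomorphic_on ?E" if t: "t \<in> ?E" for t
  proof -
    have "\<phi> t holomorphic_on ?E"
      unfolding \<phi>_def by (rule pole_lemma_open[OF hE open_ball])
    moreover have phi0: "\<phi> t z \<noteq> 0" if "z \<in> ?E" for z
    proof (cases "z = t")
      case True
      then show ?thesis using t e0(2) dr[of t] r'_nz[of t] by (auto simp: \<phi>_def)
    next
      case False
      then have "r z \<noteq> r t" using e0(3) t that by (auto simp: inj_on_def)
      then show ?thesis using False by (simp add: \<phi>_def)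
    qed
    ultimately have "Nn t holomorphic_on ?E"
      unfolding Nn_def by (intro holomorphic_intros h'E) auto
    from pole_lemma_open[OF this open_ball, of t]
    have "(\<lambda>z. - (if z = t then deriv (Nn t) t else (Nn t z - Nn t t) / (z - t))) holomorphic_on ?E"
      by (intro holomorphic_intros)
    then show ?thesis
    proof (rule holomorphic_transform)
      fix z assume z: "z \<in> ?E"
      show "- (if z = t then deriv (Nn t) t else (Nn t z - Nn t t) / (z - t)) = kk t z"
      proof (cases "z = t")
        case False
        have tX: "t \<in> X" using t e0(2) by blast
        then have Ntt: "Nn t t = 0" using r'_nz dr by (simp add: Nn_def \<phi>_def power2_eq_square)
        have rr: "r z \<noteq> r t" using e0(3) t z False by (auto simp: inj_on_def)
        have "- ((Nn t z - Nn t t) / (z - t)) = - (((r' t)\<^sup>2 * (z - t) / (r z - r t) - r' z) / (z - t))"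
          using False by (simp only: Ntt) (simp add: Nn_def \<phi>_def)
        also have "\<dots> = k t z"
          using False rr by (simp add: k_def divide_simps) (simp add: algebra_simps)
        finally show ?thesis using False by (simp add: kk_def)
      qed (simp add: kk_def)
    qed
  qed
  obtain M where M: "\<And>t z. t \<in> cball a0 \<epsilon> \<Longrightarrow> z \<in> sphere a0 (2 * \<epsilon>) \<Longrightarrow> cmod (k t z) \<le> M"
  proof -
    let ?Q = "cball a0 \<epsilon> \<times> sphere a0 (2 * \<epsilon>)"
    have sE: "sphere a0 (2 * \<epsilon>) \<subseteq> ?E" using \<epsilon> by auto
    have ne: "fst x \<noteq> snd x" "r (fst x) \<noteq> r (snd x)" if "x \<in> ?Q" for x
    proof -
      show n: "fst x \<noteq> snd x" using that \<epsilon> by auto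
      have "fst x \<in> ?E" "snd x \<in> ?E" using that BE(4) sE by auto
      then show "r (fst x) \<noteq> r (snd x)" using n e0(3) by (auto simp: inj_on_def)
    qed
    have f: "fst ` ?Q \<subseteq> ?E" "snd ` ?Q \<subseteq> ?E" using BE(4) sE by (auto simp del: mem_sphere mem_cball)
    have cf: "continuous_on ?Q (\<lambda>x. g (fst x))" "continuous_on ?Q (\<lambda>x. g (snd x))"
      if "continuous_on ?E g" for g :: "complex \<Rightarrow> complex"
      using continuous_on_compose2[OF that _ f(1)] continuous_on_compose2[OF that _ f(2)]
      by (simp_all add: continuous_on_fst continuous_on_snd continuous_on_id)
    have "continuous_on ?Q (\<lambda>x. (r' (fst x))\<^sup>2 / (r (fst x) - r (snd x)) - r' (snd x) / (fst x - snd x))"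
      by (intro continuous_on_diff continuous_on_divide continuous_on_power cf cE
            continuous_on_fst continuous_on_snd continuous_on_id ballI)
         (use ne in \<open>metis right_minus_eq\<close>)+
    then have "compact ((\<lambda>x. (r' (fst x))\<^sup>2 / (r (fst x) - r (snd x)) - r' (snd x) / (fst x - snd x)) ` ?Q)"
      by (intro compact_continuous_image compact_Times) auto
    then have "bounded ((\<lambda>x. (r' (fst x))\<^sup>2 / (r (fst x) - r (snd x)) - r' (snd x) / (fst x - snd x)) ` ?Q)"
      by (rule compact_imp_bounded)
    then obtain M where bM: "\<forall>y \<in> (\<lambda>x. (r' (fst x))\<^sup>2 / (r (fst x) - r (snd x)) - r' (snd x) / (fst x - snd x)) ` ?Q. norm y \<le> M"
      unfolding bounded_iff by (elim exE)
    show ?thesis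
    proof (rule that[of M])
      fix t z assume "t \<in> cball a0 \<epsilon>" "z \<in> sphere a0 (2 * \<epsilon>)"
      then have tz: "(t, z) \<in> ?Q" by simp
      show "cmod (k t z) \<le> M" by (rule bM[rule_format], rule image_eqI[OF _ tz]) (simp add: k_def)
    qed
  qed
  have M0': "0 \<le> M"
  proof -
    have "a0 + of_real (2 * \<epsilon>) \<in> sphere a0 (2 * \<epsilon>)" using \<epsilon> by (simp add: dist_norm)
    then show ?thesis using M[of a0 "a0 + of_real (2 * \<epsilon>)"] \<epsilon> norm_ge_zero order_trans by (metis centre_in_cball less_imp_le)
  qed
  have kk_bd: "cmod (kk t z) \<le> M" if t: "t \<in> B" and z: "z \<in> B" for t z
  proof (rule maximum_modulus_frontier[of "kk t" "cball a0 (2 * \<epsilon>)"])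
    have tE: "t \<in> ?E" using t BE by blast
    show "kk t holomorphic_on interior (cball a0 (2 * \<epsilon>))"
      using kk_hol[OF tE] by (rule holomorphic_on_subset) (use BE(3) interior_subset in blast)
    show "continuous_on (closure (cball a0 (2 * \<epsilon>))) (kk t)"
      using kk_hol[OF tE] BE(3) by (auto intro: holomorphic_on_imp_continuous_on holomorphic_on_subset)
    show "cmod (kk t y) \<le> M" if "y \<in> frontier (cball a0 (2 * \<epsilon>))" for y
    proof -
      have y: "y \<in> sphere a0 (2 * \<epsilon>)" using that \<epsilon> by (simp add: frontier_cball)
      then have "y \<noteq> t" using t \<epsilon> by (auto simp: B_def)
      then show ?thesis using M[of t y] y t by (simp add: kk_def B_def)
    qed
    show "z \<in> cball a0 (2 * \<epsilon>)" using z \<epsilon> by (auto simp: B_def)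
  qed auto
  define I where "I z = (LINT t|lborel. indicator B t * m t * kk t z)" for z
  have bdI: "cmod (indicator B t * m t * kk t z) \<le> K * M * indicator B t" if "z \<in> B" for t z
  proof (cases "t \<in> B")
    case True
    have "cmod (m t) * cmod (kk t z) \<le> K * M" by (intro mult_mono K kk_bd True that K0) auto
    then show ?thesis using True by (simp add: norm_mult)
  qed simp
  have wi: "integrable lborel (\<lambda>t. K * M * indicator B t)"
    by (intro integrable_mult_right integrable_real_indicator) (auto simp: B_def emeasure_ball_complex \<epsilon> less_imp_le)
  have km: "(\<lambda>t. indicator B t * m t * kk t z) \<in> borel_measurable lborel" for z
  proof -
    have "(\<lambda>t. kk t z) = (\<lambda>t. if t = z then - deriv (Nn z) z else (r' t)\<^sup>2 / (r t - r z) - r' z / (t - z))"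
      by (auto simp: kk_def k_def fun_eq_iff)
    then have [measurable]: "(\<lambda>t. kk t z) \<in> borel_measurable borel" by simp
    show ?thesis by measurable
  qed
  have Ih: "I holomorphic_on B"
    unfolding I_def
  proof (rule holomorphic_on_lebesgue_integral[OF B(1) km _ bdI wi])
    show "(\<lambda>z. indicator B t * m t * kk t z) holomorphic_on B" for t
    proof (cases "t \<in> B")
      case True
      then have "kk t holomorphic_on B" using kk_hol BE(1) holomorphic_on_subset by blast
      then show ?thesis by (intro holomorphic_intros)
    qed simp
  qed
  have eta: "potential m (r z) - r' z * potential m z = I z + h1 (r z) - r' z * h2 z" if z: "z \<in> B" for z
  proof -
    let ?a = "\<lambda>t. indicator B t * (m t * (r' t)\<^sup>2 / (r t - r z))"
    let ?b = "\<lambda>t. m t * indicator B t / (t - z)"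
    have bi: "integrable lborel ?b"
    proof (rule integrable_cauchy_kernel[where \<rho> = "cmod a0 + \<epsilon>" and K = K])
      show "m t * indicator B t = 0" if "t \<notin> ball 0 (cmod a0 + \<epsilon>)" for t
      proof -
        have "t \<notin> B"
        proof
          assume "t \<in> B"
          then have "cmod (t - a0) < \<epsilon>" by (simp add: B_def dist_norm norm_minus_commute)
          then have "cmod t < cmod a0 + \<epsilon>" using norm_triangle_ineq2[of t a0] by linarith
          then show False using that by simp
        qed
        then show ?thesis by simp
      qed
      show "cmod (m t * indicator B t) \<le> K" for t using K[of t] K0 by (auto simp: indicator_def)
    qed (use \<epsilon> in auto)
    have Ii: "integrable lborel (\<lambda>t. indicator B t * m t * kk t z)"
      by (rule Bochner_Integration.integrable_bound[OF wi km])
         (auto intro!: AE_I2 order_trans[OF bdI[OF z] abs_ge_self])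
    have ab: "AE t in lborel. indicator B t * m t * kk t z + r' z * ?b t = ?a t"
      using AE_lborel_singleton[of z]
    proof (rule AE_mp, intro AE_I2 impI)
      fix t assume "t \<noteq> z"
      then show "indicator B t * m t * kk t z + r' z * ?b t = ?a t"
        by (auto simp: kk_def k_def indicator_def algebra_simps)
    qed
    have "cauchy_transform (\<lambda>s. m s * indicator (r ` B) s) (r z) = (LINT t|lborel. ?a t)"
      by (rule cauchy_transform_change[OF mm inv B M0])
    also have "\<dots> = (LINT t|lborel. indicator B t * m t * kk t z + r' z * ?b t)"
    proof (rule integral_cong_AE)
      show "?a \<in> borel_measurable lborel" by measurable
      show "(\<lambda>t. indicator B t * m t * kk t z + r' z * ?b t) \<in> borel_measurable lborel"
        using km[of z] by measurable
      show "AE t in lborel. ?a t = indicator B t * m t * kk t z + r' z * ?b t"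
        using ab by (rule AE_mp) (auto intro!: AE_I2)
    qed
    also have "\<dots> = I z + r' z * cauchy_transform (\<lambda>s. m s * indicator B s) z"
      unfolding I_def cauchy_transform_def
      using Bochner_Integration.integral_add[OF Ii integrable_mult_right[OF bi, of "r' z"]]
        integral_mult_right_zero[of lborel "r' z" ?b] by (simp only:)
    finally show ?thesis
      using h1(2)[of "r z"] h2(2)[OF z] z by (simp add: algebra_simps)
  qed
  have "(\<lambda>z. I z + h1 (r z) - r' z * h2 z) holomorphic_on B"
  proof -
    have "(h1 \<circ> r) holomorphic_on B"
      by (rule holomorphic_on_compose_gen[OF holomorphic_on_subset[OF r_holomorphic_X B(3)] h1(1)]) auto
    then show ?thesis
      by (intro holomorphic_intros Ih h2(1) holomorphic_on_subset[OF h'E BE(1)]) (simp add: comp_def)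
  qed
  then have "(\<lambda>z. potential m (r z) - r' z * potential m z) holomorphic_on B"
    by (rule holomorphic_transform) (use eta in auto)
  then show ?thesis using \<epsilon>(1) unfolding B_def by blast
qed

text \<open>This is \<open>q\<^sup>3 (v \<circ> r - r' v)\<close> for the potential \<open>v\<close> of \<open>m\<close>, extended by \<open>0\<close> to the poles of \<open>r\<close>.
A factor \<open>q\<^sup>2\<close> compensates the growth of \<open>v (r z)\<close> and the pole of \<open>r'\<close>; the third factor makes the
extension continuous.\<close>

definition variation :: "(complex \<Rightarrow> complex) \<Rightarrow> complex \<Rightarrow> complex" where
  "variation m z = poly q z ^ 3 * potential m (r z) - poly q z * poly wronskian z * potential m z"

definition variation_degree :: nat where "variation_degree = 3 * d + degree wronskian + 2"

lemma poly_growth: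
  obtains A where "A \<ge> 0" "\<And>z n. 1 \<le> cmod z \<Longrightarrow> degree P \<le> n \<Longrightarrow> cmod (poly P z) \<le> A * cmod z ^ n"
proof
  let ?A = "\<Sum>i\<le>degree P. cmod (coeff P i)"
  show "?A \<ge> 0" by (simp add: sum_nonneg)
  fix z n assume z: "1 \<le> cmod z" and n: "degree P \<le> n"
  have "cmod (poly P z) \<le> (\<Sum>i\<le>degree P. cmod (coeff P i * z ^ i))"
    unfolding poly_altdef by (rule norm_sum)
  also have "\<dots> \<le> (\<Sum>i\<le>degree P. cmod (coeff P i) * cmod z ^ n)"
    unfolding norm_mult norm_power
    by (intro sum_mono mult_left_mono power_increasing) (use z n in auto)
  finally show "cmod (poly P z) \<le> ?A * cmod z ^ n" by (simp add: sum_distrib_right)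
qed

text \<open>The zeros of the Wronskian and of \<open>q\<close> are isolated points at which the variation is
continuous, so it is entire. Since the potential is \<open>O(|z|\<^sup>2)\<close>, it has polynomial growth.\<close>

lemma variation_polynomial:
  assumes mm[measurable]: "m \<in> borel_measurable borel" and K: "\<And>t. cmod (m t) \<le> K"
    and inv: "beltrami_invariant m"
  shows "variation m z = (\<Sum>k\<le>variation_degree. (deriv ^^ k) (variation m) 0 / fact k * z ^ k)"
proof -
  have K0: "K \<ge> 0" using K[of 0] norm_ge_zero order_trans by blast
  let ?v = "potential m"
  let ?Y = "{z. poly q z \<noteq> 0}"
  have oY: "open ?Y"
  proof -
    have "?Y = - {z. poly q z = 0}" by auto
    then show ?thesis using finite_imp_closed[OF finite_q_roots] by (simp add: open_Compl)
  qed
  have vc: "continuous_on UNIV ?v" by (rule continuous_on_potential[OF mm K])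
  have rc: "continuous_on ?Y r" by (rule holomorphic_on_imp_continuous_on[OF r_holomorphic]) simp
  have r'c: "continuous_on ?Y r'" unfolding r'_def[abs_def] by (intro continuous_intros) auto
  have etac: "continuous_on ?Y (\<lambda>z. ?v (r z) - r' z * ?v z)"
    by (intro continuous_intros r'c continuous_on_compose2[OF vc rc] continuous_on_subset[OF vc]) auto
  have etaX: "(\<lambda>z. ?v (r z) - r' z * ?v z) holomorphic_on X"
    unfolding holomorphic_on_open[OF open_X]
    using eta_holomorphic_near[OF mm K inv] by (meson centre_in_ball holomorphic_on_open open_ball)
  have etaY: "(\<lambda>z. ?v (r z) - r' z * ?v z) holomorphic_on ?Y"
  proof (rule no_isolated_singularity[OF etac _ oY finite_wronskian_roots])
    have "?Y - {z. poly wronskian z = 0} = X" by (auto simp: X_def)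
    then show "(\<lambda>z. ?v (r z) - r' z * ?v z) holomorphic_on ?Y - {z. poly wronskian z = 0}"
      using etaX by simp
  qed
  have GY: "variation m holomorphic_on ?Y"
  proof -
    have "(\<lambda>z. poly q z ^ 3 * (?v (r z) - r' z * ?v z)) holomorphic_on ?Y"
      by (intro holomorphic_intros etaY)
    then show ?thesis
      by (rule holomorphic_transform)
         (auto simp: variation_def r'_def algebra_simps power2_eq_square power3_eq_cube)
  qed
  define C where "C = 20 * pi * K"
  have C0: "C \<ge> 0" using K0 by (simp add: C_def)
  have vb: "cmod (?v a) \<le> C * (1 + (cmod a)\<^sup>2)" for a
    unfolding C_def by (rule potential_bound[OF mm K])
  have Gb: "cmod (variation m z) \<le> C * (cmod (poly q z) * ((cmod (poly q z))\<^sup>2 + (cmod (poly p z))\<^sup>2 + cmod (poly wronskian z) * (1 + (cmod z)\<^sup>2)))" for z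
  proof (cases "poly q z = 0")
    case False
    have "cmod (poly q z ^ 3 * ?v (r z)) \<le> cmod (poly q z) ^ 3 * (C * (1 + (cmod (r z))\<^sup>2))"
      unfolding norm_mult norm_power by (intro mult_left_mono vb) auto
    also have "\<dots> = C * (cmod (poly q z) * ((cmod (poly q z))\<^sup>2 + (cmod (poly p z))\<^sup>2))"
      using False by (simp add: r_def norm_divide power_divide power2_eq_square power3_eq_cube field_simps)
    finally have 1: "cmod (poly q z ^ 3 * ?v (r z)) \<le> C * (cmod (poly q z) * ((cmod (poly q z))\<^sup>2 + (cmod (poly p z))\<^sup>2))" .
    have 2: "cmod (poly q z * poly wronskian z * ?v z) \<le> cmod (poly q z) * cmod (poly wronskian z) * (C * (1 + (cmod z)\<^sup>2))"
      unfolding norm_mult by (intro mult_left_mono vb) auto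
    have "cmod (variation m z) \<le> cmod (poly q z ^ 3 * ?v (r z)) + cmod (poly q z * poly wronskian z * ?v z)"
      unfolding variation_def by (rule norm_triangle_ineq4)
    then show ?thesis using 1 2 by (simp add: algebra_simps)
  qed (simp add: variation_def)
  have hol: "variation m holomorphic_on UNIV"
  proof (rule no_isolated_singularity'[OF _ _ open_UNIV finite_q_roots])
    show "variation m holomorphic_on UNIV - {z. poly q z = 0}"
      using GY by (simp add: Collect_neg_eq[symmetric] Compl_eq_Diff_UNIV[symmetric])
    fix z assume "z \<in> {z. poly q z = 0}"
    then have z: "poly q z = 0" by simp
    have "((\<lambda>w. C * (cmod (poly q w) * ((cmod (poly q w))\<^sup>2 + (cmod (poly p w))\<^sup>2 + cmod (poly wronskian w) * (1 + (cmod w)\<^sup>2)))) \<longlongrightarrow>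
       C * (cmod (poly q z) * ((cmod (poly q z))\<^sup>2 + (cmod (poly p z))\<^sup>2 + cmod (poly wronskian z) * (1 + (cmod z)\<^sup>2)))) (at z)"
      by (intro tendsto_intros)
    then have "((\<lambda>w. C * (cmod (poly q w) * ((cmod (poly q w))\<^sup>2 + (cmod (poly p w))\<^sup>2 + cmod (poly wronskian w) * (1 + (cmod w)\<^sup>2)))) \<longlongrightarrow> 0) (at z)"
      using z by simp
    then have "(variation m \<longlongrightarrow> 0) (at z)"
      by (rule Lim_null_comparison[rotated]) (auto intro!: always_eventually Gb)
    then show "(variation m \<longlongrightarrow> variation m z) (at z)" using z by (simp add: variation_def)
  qed
  obtain A1 where A1: "A1 \<ge> 0" "\<And>z n. 1 \<le> cmod z \<Longrightarrow> degree q \<le> n \<Longrightarrow> cmod (poly q z) \<le> A1 * cmod z ^ n" using poly_growth by blast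
  obtain A2 where A2: "A2 \<ge> 0" "\<And>z n. 1 \<le> cmod z \<Longrightarrow> degree p \<le> n \<Longrightarrow> cmod (poly p z) \<le> A2 * cmod z ^ n" using poly_growth by blast
  obtain A3 where A3: "A3 \<ge> 0" "\<And>z n. 1 \<le> cmod z \<Longrightarrow> degree wronskian \<le> n \<Longrightarrow> cmod (poly wronskian z) \<le> A3 * cmod z ^ n" using poly_growth by blast
  define B where "B = C * (A1 * (A1\<^sup>2 + A2\<^sup>2 + A3 * 2))"
  have "cmod (variation m z) \<le> B * cmod z ^ variation_degree" if z: "1 \<le> cmod z" for z
  proof -
    let ?n = "2 * d + degree wronskian + 2"
    have dq: "degree q \<le> d" "degree p \<le> d" using deg by auto
    have q: "cmod (poly q z) \<le> A1 * cmod z ^ d" "(cmod (poly q z))\<^sup>2 \<le> A1\<^sup>2 * cmod z ^ ?n"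
    proof -
      show 1: "cmod (poly q z) \<le> A1 * cmod z ^ d" using A1(2) z dq by blast
      have "(cmod (poly q z))\<^sup>2 \<le> (A1 * cmod z ^ d)\<^sup>2" using 1 by (intro power_mono) auto
      also have "\<dots> = A1\<^sup>2 * cmod z ^ (2 * d)" by (simp add: power_mult_distrib power_mult[symmetric] mult.commute)
      also have "\<dots> \<le> A1\<^sup>2 * cmod z ^ ?n" using z by (intro mult_left_mono power_increasing) auto
      finally show "(cmod (poly q z))\<^sup>2 \<le> A1\<^sup>2 * cmod z ^ ?n" .
    qed
    have p: "(cmod (poly p z))\<^sup>2 \<le> A2\<^sup>2 * cmod z ^ ?n"
    proof -
      have "(cmod (poly p z))\<^sup>2 \<le> (A2 * cmod z ^ d)\<^sup>2" using A2(2) z dq by (intro power_mono) auto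
      also have "\<dots> = A2\<^sup>2 * cmod z ^ (2 * d)" by (simp add: power_mult_distrib power_mult[symmetric] mult.commute)
      also have "\<dots> \<le> A2\<^sup>2 * cmod z ^ ?n" using z by (intro mult_left_mono power_increasing) auto
      finally show ?thesis .
    qed
    have w: "cmod (poly wronskian z) * (1 + (cmod z)\<^sup>2) \<le> A3 * 2 * cmod z ^ ?n"
    proof -
      have "1 + (cmod z)\<^sup>2 \<le> 2 * (cmod z)\<^sup>2" using z by (simp add: one_le_power)
      then have "cmod (poly wronskian z) * (1 + (cmod z)\<^sup>2) \<le> (A3 * cmod z ^ degree wronskian) * (2 * (cmod z)\<^sup>2)"
        using A3 z by (intro mult_mono) auto
      also have "\<dots> = A3 * 2 * cmod z ^ (degree wronskian + 2)" by (simp add: power_add power2_eq_square)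
      also have "\<dots> \<le> A3 * 2 * cmod z ^ ?n" using z A3(1) by (intro mult_left_mono power_increasing) auto
      finally show ?thesis .
    qed
    have "cmod (poly q z) * ((cmod (poly q z))\<^sup>2 + (cmod (poly p z))\<^sup>2 + cmod (poly wronskian z) * (1 + (cmod z)\<^sup>2))
      \<le> (A1 * cmod z ^ d) * ((A1\<^sup>2 + A2\<^sup>2 + A3 * 2) * cmod z ^ ?n)"
    proof (intro mult_mono q(1))
      show "(cmod (poly q z))\<^sup>2 + (cmod (poly p z))\<^sup>2 + cmod (poly wronskian z) * (1 + (cmod z)\<^sup>2)
          \<le> (A1\<^sup>2 + A2\<^sup>2 + A3 * 2) * cmod z ^ ?n"
        using q(2) p w unfolding distrib_right by linarith
    qed (use A1(1) in auto)
    then have "C * (cmod (poly q z) * ((cmod (poly q z))\<^sup>2 + (cmod (poly p z))\<^sup>2 + cmod (poly wronskian z) * (1 + (cmod z)\<^sup>2)))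
      \<le> C * ((A1 * cmod z ^ d) * ((A1\<^sup>2 + A2\<^sup>2 + A3 * 2) * cmod z ^ ?n))"
      using C0 by (rule mult_left_mono)
    also have "\<dots> = B * (cmod z ^ d * cmod z ^ ?n)" by (simp add: B_def mult_ac)
    also have "cmod z ^ d * cmod z ^ ?n = cmod z ^ variation_degree" unfolding power_add[symmetric] variation_degree_def by (rule arg_cong[of _ _ "power _"]) simp
    finally show ?thesis using Gb[of z] by simp
  qed
  then show ?thesis by (rule Liouville_polynomial[OF hol])
qed

end

section \<open>Underdetermined linear systems\<close>

text \<open>Gaussian elimination: if some unknown occurs in the last equation, solve for it.\<close>

lemma underdetermined_system:
  fixes A :: "nat \<Rightarrow> nat \<Rightarrow> complex"
  assumes "n < N"
  shows "\<exists>c. (\<exists>i<N. c i \<noteq> 0) \<and> (\<forall>k<n. (\<Sum>i<N. c i * A i k) = 0)"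
  using assms
proof (induction n arbitrary: N A)
  case 0
  then show ?case by (intro exI[of _ "\<lambda>_. 1"]) auto
next
  case (Suc n)
  show ?case
  proof (cases "\<forall>i<N. A i n = 0")
    case True
    obtain c where c: "\<exists>i<N. c i \<noteq> 0" "\<forall>k<n. (\<Sum>i<N. c i * A i k) = 0"
      using Suc.IH[of N A] Suc.prems by auto
    have "(\<Sum>i<N. c i * A i k) = 0" if "k < Suc n" for k
      using that c(2) True by (cases "k = n") auto
    then show ?thesis using c(1) by blast
  next
    case False
    then obtain j where j: "j < N" "A j n \<noteq> 0" by blast
    \<comment> \<open>eliminate the unknown \<open>j\<close> with the last equation and move the last unknown to its place\<close>
    obtain N' where N': "N = Suc N'" using Suc.prems by (cases N) auto
    define \<sigma> where "\<sigma> i = (if i = j then N' else i)" for i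
    define A' where "A' i k = A (\<sigma> i) k - A (\<sigma> i) n / A j n * A j k" for i k
    obtain c where c: "\<exists>i<N'. c i \<noteq> 0" "\<forall>k<n. (\<Sum>i<N'. c i * A' i k) = 0"
      using Suc.IH[of N' A'] Suc.prems N' by auto
    have bij: "bij_betw \<sigma> {..<N'} ({..<N} - {j})"
    proof (rule bij_betw_imageI)
      show "inj_on \<sigma> {..<N'}" by (auto simp: inj_on_def \<sigma>_def split: if_splits)
      show "\<sigma> ` {..<N'} = {..<N} - {j}"
        using j N' by (auto simp: \<sigma>_def image_iff split: if_splits)
    qed
    define \<tau> where "\<tau> = inv_into {..<N'} \<sigma>"
    have \<tau>: "\<tau> (\<sigma> i) = i" if "i < N'" for i
      unfolding \<tau>_def using bij that by (intro inv_into_f_f) (auto simp: bij_betw_def)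
    have \<sigma>j: "\<sigma> i \<noteq> j" "\<sigma> i < N" if "i < N'" for i
      using bij_betwE[OF bij] that by auto
    define b where "b i = (if i = j then - (\<Sum>i<N'. c i * (A (\<sigma> i) n / A j n)) else c (\<tau> i))" for i
    have sum_b: "(\<Sum>i<N. b i * A i k) = b j * A j k + (\<Sum>i<N'. c i * A (\<sigma> i) k)" for k
    proof -
      have "(\<Sum>i<N. b i * A i k) = b j * A j k + (\<Sum>i\<in>{..<N} - {j}. b i * A i k)"
        using j(1) by (intro sum.remove) auto
      also have "(\<Sum>i\<in>{..<N} - {j}. b i * A i k) = (\<Sum>i<N'. b (\<sigma> i) * A (\<sigma> i) k)"
        by (rule sum.reindex_bij_betw[OF bij, symmetric])
      also have "\<dots> = (\<Sum>i<N'. c i * A (\<sigma> i) k)"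
        by (intro sum.cong) (use \<sigma>j \<tau> in \<open>auto simp: b_def\<close>)
      finally show ?thesis .
    qed
    have bj: "b j = - (\<Sum>i<N'. c i * (A (\<sigma> i) n / A j n))" by (simp add: b_def)
    have "(\<Sum>i<N. b i * A i k) = 0" if "k < Suc n" for k
    proof -
      have eq: "(\<Sum>i<N. b i * A i k) = (\<Sum>i<N'. c i * A' i k)"
        unfolding sum_b bj A'_def
        by (simp add: sum_distrib_right right_diff_distrib sum_subtractf mult.assoc)
      show ?thesis
      proof (cases "k = n")
        case True
        have "A' i n = 0" for i using j(2) by (simp add: A'_def)
        then show ?thesis using eq True by simp
      next
        case False
        then show ?thesis unfolding eq using c(2) that by simp
      qed
    qed
    moreover have "\<exists>i<N. b i \<noteq> 0"
    proof -
      obtain i where i: "i < N'" "c i \<noteq> 0" using c(1) by blast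
      then show ?thesis using \<sigma>j[OF i(1)] \<tau>[OF i(1)] by (intro exI[of _ "\<sigma> i"]) (simp add: b_def)
    qed
    ultimately show ?thesis by blast
  qed
qed

context rational
begin

section \<open>Finite orbits\<close>

definition orb :: "nat \<Rightarrow> complex \<Rightarrow> complex" where
  "orb n z = fin_part ((R ^^ n) (Fin z))"

definition fin_orbit :: "nat \<Rightarrow> complex set" where
  "fin_orbit n = {z. \<forall>k\<le>n. (R ^^ k) (Fin z) \<noteq> Infty}"

lemma orb_0 [simp]: "orb 0 z = z"
  by (simp add: orb_def)

text \<open>This also holds at the poles of \<open>r\<close>, where both sides are \<open>0\<close> by convention.\<close>

lemma fin_part_R: "fin_part (R (Fin w)) = r w"
  by (simp add: rat_map_def r_def)

lemma Fin_fin_part: "x \<noteq> Infty \<Longrightarrow> Fin (fin_part x) = x"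
  by (cases x) auto

lemma R_funpow_Fin: "(R ^^ n) (Fin z) \<noteq> Infty \<Longrightarrow> (R ^^ n) (Fin z) = Fin (orb n z)"
  by (simp add: orb_def Fin_fin_part)

lemma orb_Suc: "(R ^^ n) (Fin z) \<noteq> Infty \<Longrightarrow> orb (Suc n) z = r (orb n z)"
proof -
  assume fin: "(R ^^ n) (Fin z) \<noteq> Infty"
  have "orb (Suc n) z = fin_part (R ((R ^^ n) (Fin z)))" by (simp add: orb_def)
  also have "\<dots> = fin_part (R (Fin (orb n z)))" by (simp only: R_funpow_Fin[OF fin])
  finally show ?thesis by (simp add: fin_part_R)
qed

lemma fin_orbit_Suc: "z \<in> fin_orbit (Suc n) \<Longrightarrow> z \<in> fin_orbit n"
  by (simp add: fin_orbit_def)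

lemma fin_orbitD: "z \<in> fin_orbit n \<Longrightarrow> (R ^^ n) (Fin z) \<noteq> Infty"
  by (simp add: fin_orbit_def)

lemma q_orb_nz: "z \<in> fin_orbit (Suc n) \<Longrightarrow> poly q (orb n z) \<noteq> 0"
proof
  assume z: "z \<in> fin_orbit (Suc n)" and 0: "poly q (orb n z) = 0"
  have "(R ^^ n) (Fin z) = Fin (orb n z)"
    using fin_orbitD[OF fin_orbit_Suc[OF z]] by (rule R_funpow_Fin)
  then have "(R ^^ Suc n) (Fin z) = Infty" using 0 by (simp add: rat_map_def)
  then show False using fin_orbitD[OF z] by simp
qed

lemma open_fin_orbit: "open (fin_orbit n)"
proof -
  have "fin_orbit n = (\<Inter>k\<in>{..n}. (\<lambda>z. (R ^^ k) (Fin z)) -` (- {Infty}))"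
    by (auto simp: fin_orbit_def)
  moreover have "open ((\<lambda>z. (R ^^ k) (Fin z)) -` (- {Infty}))" for k
    by (rule open_vimage)
       (auto intro!: continuous_on_compose2[OF continuous_on_R_funpow continuous_on_Fin] open_Compl)
  ultimately show ?thesis by (metis (no_types, lifting) finite_atMost open_INT)
qed

lemma finite_Compl_fin_orbit: "finite (- fin_orbit n)"
proof -
  have "- fin_orbit n = (\<Union>k\<in>{..n}. Fin -` ((R ^^ k) -` {Infty}))"
    by (auto simp: fin_orbit_def)
  moreover have "finite (Fin -` ((R ^^ k) -` {Infty}))" for k
    by (intro finite_Fin_vimage finite_R_funpow_vimage) simp
  ultimately show ?thesis by simp
qed

lemma orb_deriv: "z \<in> fin_orbit n \<Longrightarrow> (orb n has_field_derivative (\<Prod>k<n. r' (orb k z))) (at z)"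
proof (induction n)
  case 0
  then show ?case by (simp add: orb_def[abs_def])
next
  case (Suc n)
  have z: "z \<in> fin_orbit n" using Suc.prems by (rule fin_orbit_Suc)
  have "((\<lambda>w. r (orb n w)) has_field_derivative r' (orb n z) * (\<Prod>k<n. r' (orb k z))) (at z)"
    by (rule DERIV_chain2[OF r_deriv[OF q_orb_nz[OF Suc.prems]] Suc.IH[OF z]])
  then have "(orb (Suc n) has_field_derivative r' (orb n z) * (\<Prod>k<n. r' (orb k z))) (at z)"
    by (rule has_field_derivative_transform_within_open[OF _ open_fin_orbit z])
       (simp add: orb_Suc fin_orbitD)
  then show ?case by (simp add: mult.commute)
qed

section \<open>Invariant vector fields vanish on the Julia set\<close>

lemma invariant_field_orbit:
  assumes v: "\<And>z. poly q z \<noteq> 0 \<Longrightarrow> v (r z) = r' z * v z"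
  shows "z \<in> fin_orbit n \<Longrightarrow> v (orb n z) = (\<Prod>k<n. r' (orb k z)) * v z"
proof (induction n)
  case (Suc n)
  have z: "z \<in> fin_orbit n" using Suc.prems by (rule fin_orbit_Suc)
  have "v (orb (Suc n) z) = r' (orb n z) * v (orb n z)"
    using v[OF q_orb_nz[OF Suc.prems]] orb_Suc[OF fin_orbitD[OF z]] by simp
  then show ?case using Suc.IH[OF z] by simp
qed simp

text \<open>Suppose \<open>|v| \<ge> \<delta>\<close> on a ball. Iterating the equation gives \<open>v (R\<^sup>n z) = (R\<^sup>n)'(z) v z\<close>, hence
\<open>|(R\<^sup>n)'| \<le> C (1 + |R\<^sup>n|\<^sup>2) / \<delta>\<close> there. This is a bound on the spherical derivative that does not
depend on \<open>n\<close>, so the iterates are uniformly Lipschitz on the ball.\<close>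

lemma invariant_field_zero_on_julia:
  assumes v: "\<And>z. poly q z \<noteq> 0 \<Longrightarrow> v (r z) = r' z * v z"
    and vc: "continuous_on UNIV v" and vb: "\<And>a. cmod (v a) \<le> C * (1 + (cmod a)\<^sup>2)"
    and zJ: "z0 \<in> julia_plane R"
  shows "v z0 = 0"
proof (rule ccontr)
  assume nz: "v z0 \<noteq> 0"
  define \<delta> where "\<delta> = cmod (v z0) / 2"
  have \<delta>: "\<delta> > 0" using nz by (simp add: \<delta>_def)
  have C0: "C \<ge> 0" using order_trans[OF norm_ge_zero vb[of 0]] by simp
  have "isCont v z0" using vc by (simp add: continuous_on_eq_continuous_at)
  then obtain e where e: "e > 0" "\<And>z. dist z z0 < e \<Longrightarrow> dist (v z) (v z0) < \<delta>"
    using \<delta> unfolding continuous_at_eps_delta by blast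
  have low: "\<delta> \<le> cmod (v z)" if "z \<in> ball z0 e" for z
  proof -
    have "cmod (v z - v z0) < \<delta>" using e(2)[of z] that by (simp add: dist_norm norm_minus_commute)
    moreover have "cmod (v z0) \<le> cmod (v z) + cmod (v z - v z0)"
      using norm_triangle_ineq[of "v z" "v z0 - v z"] by (simp add: norm_minus_commute)
    ultimately show ?thesis by (simp add: \<delta>_def)
  qed
  define L where "L = 10 * C / \<delta>"
  have "Fin z0 \<in> fatou_set R"
  proof (rule equi_Lipschitz_imp_fatou[OF e(1), where L = L])
    fix n x y assume x: "x \<in> ball z0 e" and y: "y \<in> ball z0 e"
    show "dist ((R ^^ n) (Fin x)) ((R ^^ n) (Fin y)) \<le> L * dist x y"
    proof (cases "x = y")
      case ne: False
      define \<gamma> where "\<gamma> = linepath x y"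
      have \<gamma>b: "\<gamma> s \<in> ball z0 e" if "s \<in> {0..1}" for s
      proof -
        have "\<gamma> s \<in> closed_segment x y" using that by (simp add: \<gamma>_def linepath_in_path)
        then show ?thesis using closed_segment_subset[OF x y convex_ball] by blast
      qed
      have \<gamma>d: "(\<gamma> has_vector_derivative (y - x)) (at s)" for s
        unfolding \<gamma>_def by (rule has_vector_derivative_linepath_within)
      \<comment> \<open>the parameters at which the orbit hits \<open>Infty\<close>, finitely many, are harmless because \<open>R\<^sup>n\<close> is continuous there\<close>
      define S where "S = {s. \<gamma> s \<notin> fin_orbit n}"
      have inj: "inj \<gamma>"
      proof (rule injI)
        fix s t assume "\<gamma> s = \<gamma> t"
        then have "of_real (s - t) * (y - x) = 0" by (simp add: \<gamma>_def linepath_def scaleR_conv_of_real algebra_simps)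
        then show "s = t" using ne by simp
      qed
      have fS: "finite S"
      proof -
        have "S = \<gamma> -` (- fin_orbit n)" by (auto simp: S_def)
        then show ?thesis using finite_vimageI[OF finite_Compl_fin_orbit inj] by simp
      qed
      define f where "f s = stereo ((R ^^ n) (Fin (\<gamma> s)))" for s
      have ex: "\<exists>D. (f has_vector_derivative D) (at s) \<and> norm D \<le> L * cmod (y - x)"
        if s: "s \<in> {0..1} - S" for s
      proof -
        have sg: "\<gamma> s \<in> fin_orbit n" using s by (simp add: S_def)
        define P where "P = (\<Prod>k<n. r' (orb k (\<gamma> s)))"
        have "((orb n \<circ> \<gamma>) has_vector_derivative ((y - x) * P)) (at s)"
          unfolding P_def by (rule field_vector_diff_chain_at[OF \<gamma>d orb_deriv[OF sg]])
        then obtain D where D: "((\<lambda>s. stereo (Fin ((orb n \<circ> \<gamma>) s))) has_vector_derivative D) (at s)"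
          "norm D \<le> 10 * cmod ((y - x) * P) / (1 + (cmod ((orb n \<circ> \<gamma>) s))\<^sup>2)"
          by (rule stereo_vector_derivative)
        have o: "open (\<gamma> -` fin_orbit n)"
          unfolding \<gamma>_def by (rule open_vimage[OF open_fin_orbit continuous_on_linepath])
        have "(f has_vector_derivative D) (at s)"
          by (rule has_vector_derivative_transform_within_open[OF D(1) o])
             (use sg R_funpow_Fin[OF fin_orbitD] in \<open>auto simp: f_def\<close>)
        moreover have "norm D \<le> L * cmod (y - x)"
        proof -
          let ?h = "orb n (\<gamma> s)"
          have N: "1 + (cmod ?h)\<^sup>2 > 0" by (rule norm_sq_pos)
          have "cmod P * \<delta> \<le> cmod P * cmod (v (\<gamma> s))"
            using low[OF \<gamma>b] s by (intro mult_left_mono) auto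
          also have "\<dots> = cmod (v ?h)"
            using invariant_field_orbit[of v, OF v sg] by (simp add: P_def norm_mult)
          also have "\<dots> \<le> C * (1 + (cmod ?h)\<^sup>2)" by (rule vb)
          finally have "cmod P / (1 + (cmod ?h)\<^sup>2) \<le> C / \<delta>"
            using \<delta> N by (simp add: field_simps)
          then have "10 * cmod (y - x) * (cmod P / (1 + (cmod ?h)\<^sup>2)) \<le> 10 * cmod (y - x) * (C / \<delta>)"
            by (intro mult_left_mono) auto
          then show ?thesis using D(2) by (simp add: L_def norm_mult mult_ac)
        qed
        ultimately show ?thesis by blast
      qed
      define f' where "f' s = (if s \<in> {0..1} - S then SOME D. (f has_vector_derivative D) (at s) \<and> norm D \<le> L * cmod (y - x) else 0)" for s
      have f': "(f has_vector_derivative f' s) (at s) \<and> norm (f' s) \<le> L * cmod (y - x)"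
        if "s \<in> {0..1} - S" for s
        using someI_ex[OF ex[OF that]] that by (simp add: f'_def)
      have "continuous_on {0..1} f"
        unfolding f_def \<gamma>_def
        by (intro continuous_on_compose2[OF continuous_on_stereo] continuous_on_compose2[OF continuous_on_R_funpow]
              continuous_on_compose2[OF continuous_on_Fin] continuous_on_linepath) auto
      then have hi: "(f' has_integral (f 1 - f 0)) {0..1}"
        by (intro fundamental_theorem_of_calculus_strong[OF fS]) (use f' in auto)
      have "norm (f 1 - f 0) \<le> (L * cmod (y - x)) * measure lborel {0..1::real}"
        by (rule has_integral_bound_real[OF _ fS hi]) (use f' C0 \<delta> in \<open>auto simp: L_def\<close>)
      then have "norm (f 1 - f 0) \<le> L * cmod (y - x)" by simp
      then show ?thesis
        by (simp add: dist_csphere dist_norm f_def \<gamma>_def linepath_def norm_minus_commute)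
    qed simp
  qed
  then show False using zJ by (simp add: julia_plane_def julia_set_def)
qed

section \<open>Finite dimensionality\<close>

lemma factor_zero:
  assumes "v holomorphic_on U" "open U" "z0 \<in> U" "v z0 = 0"
  obtains g where "g holomorphic_on U" "\<And>z. z \<in> U \<Longrightarrow> v z = (z - z0) * g z"
proof -
  have "(\<lambda>z. if z = z0 then deriv v z0 else (v z - v z0) / (z - z0)) holomorphic_on U"
    by (rule pole_lemma_open) (use assms in auto)
  then show ?thesis by (rule that) (use assms(4) in auto)
qed

text \<open>Divide \<open>v\<close> by the cubic polynomial with zeros \<open>z1\<close>, \<open>z2\<close>, \<open>z3\<close>. The quotient \<open>F\<close> tends to \<open>0\<close> at
infinity, so \<open>|F|\<close> attains its maximum; where \<open>F \<noteq> 0\<close> it is holomorphic, so it would be locally and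
then globally constant.\<close>

lemma zero_outside_imp_zero:
  fixes v :: "complex \<Rightarrow> complex"
  assumes U: "open U" and h: "v holomorphic_on U" and c: "continuous_on UNIV v"
    and 0: "\<And>z. z \<notin> U \<Longrightarrow> v z = 0" and b: "\<And>a. cmod (v a) \<le> C * (1 + (cmod a)\<^sup>2)"
    and z: "z1 \<in> U" "z2 \<in> U" "z3 \<in> U" "z1 \<noteq> z2" "z1 \<noteq> z3" "z2 \<noteq> z3"
    and v: "v z1 = 0" "v z2 = 0" "v z3 = 0"
  shows "v a = 0"
proof -
  obtain g1 where g1: "g1 holomorphic_on U" "\<And>z. z \<in> U \<Longrightarrow> v z = (z - z1) * g1 z"
    using factor_zero[OF h U z(1) v(1)] by blast
  have "g1 z2 = 0" using g1(2)[OF z(2)] v(2) z(4) by simp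
  then obtain g2 where g2: "g2 holomorphic_on U" "\<And>z. z \<in> U \<Longrightarrow> g1 z = (z - z2) * g2 z"
    using factor_zero[OF g1(1) U z(2)] by blast
  have "g2 z3 = 0" using g1(2)[OF z(3)] g2(2)[OF z(3)] v(3) z(5,6) by simp
  then obtain g where g: "g holomorphic_on U" "\<And>z. z \<in> U \<Longrightarrow> g2 z = (z - z3) * g z"
    using factor_zero[OF g2(1) U z(3)] by blast
  define P where "P z = (z - z1) * (z - z2) * (z - z3)" for z
  have vg: "v z = P z * g z" if "z \<in> U" for z
    using g1(2)[OF that] g2(2)[OF that] g(2)[OF that] by (simp add: P_def)
  define F where "F z = (if z \<in> U then g z else 0)" for z
  have Fv: "F z = v z / P z" if "P z \<noteq> 0" for z
    using that vg[of z] 0[of z] by (auto simp: F_def)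
  have vF: "v z = P z * F z" for z using vg[of z] 0[of z] by (auto simp: F_def)
  let ?Z = "- {z1, z2, z3}"
  have PZ: "P z \<noteq> 0 \<longleftrightarrow> z \<in> ?Z" for z by (auto simp: P_def)
  have "continuous_on ?Z (\<lambda>z. v z / P z)"
    unfolding P_def by (intro continuous_intros continuous_on_subset[OF c]) auto
  then have c1: "continuous_on ?Z F"
    by (subst continuous_on_cong[OF refl]) (use PZ Fv in auto)
  have "continuous_on U g" using g(1) by (rule holomorphic_on_imp_continuous_on)
  then have c2: "continuous_on U F" by (subst continuous_on_cong[OF refl]) (auto simp: F_def)
  have "open ?Z" by (intro open_Compl) (simp add: finite_imp_closed)
  then have "continuous_on (?Z \<union> U) F" using continuous_on_open_Un[OF _ U c1 c2] by blast
  moreover have "?Z \<union> U = UNIV" using z by blast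
  ultimately have cF: "continuous_on UNIV F" by simp
  have hF: "F holomorphic_on U" by (rule holomorphic_transform[OF g(1)]) (simp add: F_def)
  have lim: "(F \<longlongrightarrow> 0) at_infinity"
  proof -
    have C0: "C \<ge> 0" using order_trans[OF norm_ge_zero b[of 0]] by simp
    define A where "A = cmod z1 + cmod z2 + cmod z3 + 1"
    have Fb: "cmod (F z) \<le> 16 * C / cmod z" if zA: "2 * A \<le> cmod z" for z
    proof -
      have A1: "A \<ge> 1" by (simp add: A_def)
      then have z0: "cmod z \<ge> 2" using zA by linarith
      then have zn: "z \<noteq> 0" by (metis norm_zero not_numeral_le_zero)
      have half: "cmod z / 2 \<le> cmod (z - w)" if "w \<in> {z1, z2, z3}" for w
      proof -
        have "cmod w \<le> A" using that by (auto simp: A_def)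
        then show ?thesis using norm_triangle_ineq2[of z w] zA by linarith
      qed
      have "(cmod z / 2) * (cmod z / 2) * (cmod z / 2) \<le> cmod (z - z1) * cmod (z - z2) * cmod (z - z3)"
        by (intro mult_mono half) auto
      then have P1: "cmod z ^ 3 / 8 \<le> cmod (P z)" by (simp add: P_def norm_mult power3_eq_cube)
      have pos: "0 < cmod z ^ 3 / 8" using zn by simp
      then have "P z \<noteq> 0" using P1 by auto
      then have "cmod (F z) = cmod (v z) / cmod (P z)" by (simp add: Fv norm_divide)
      also have "\<dots> \<le> (C * (1 + (cmod z)\<^sup>2)) / (cmod z ^ 3 / 8)"
        using P1 pos b C0 by (intro frac_le) auto
      also have "\<dots> \<le> (C * (2 * (cmod z)\<^sup>2)) / (cmod z ^ 3 / 8)"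
      proof (intro divide_right_mono mult_left_mono C0)
        have "1 \<le> (cmod z)\<^sup>2" using z0 by (simp add: one_le_power)
        then show "1 + (cmod z)\<^sup>2 \<le> 2 * (cmod z)\<^sup>2" by simp
      qed (use pos in auto)
      also have "\<dots> = 16 * C / cmod z" using zn by (simp add: power2_eq_square power3_eq_cube field_simps)
      finally show ?thesis .
    qed
    have "((\<lambda>z. 16 * C / cmod z) \<longlongrightarrow> 0) at_infinity"
      by (intro tendsto_divide_0[OF tendsto_const] filterlim_at_top_imp_at_infinity filterlim_norm_at_top)
    then show ?thesis
      by (rule Lim_null_comparison[rotated]) (use Fb in \<open>auto simp: eventually_at_infinity\<close>)
  qed
  have "F w = 0" for w
  proof (rule ccontr)
    assume w: "F w \<noteq> 0"
    then have "eventually (\<lambda>z. cmod (F z) < cmod (F w)) at_infinity"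
      using tendstoD[OF lim, of "cmod (F w)"] by simp
    then obtain \<rho> where \<rho>: "\<And>z. \<rho> \<le> cmod z \<Longrightarrow> cmod (F z) < cmod (F w)"
      unfolding eventually_at_infinity by blast
    have "\<not> \<rho> \<le> cmod w" using \<rho>[of w] by blast
    then have w\<rho>: "w \<in> cball 0 \<bar>\<rho>\<bar>" by simp
    have "\<exists>x\<in>cball 0 \<bar>\<rho>\<bar>. \<forall>y\<in>cball 0 \<bar>\<rho>\<bar>. cmod (F y) \<le> cmod (F x)"
      by (rule continuous_attains_sup)
         (use w\<rho> in \<open>auto intro!: continuous_intros continuous_on_subset[OF cF]\<close>)
    then obtain x where x: "\<And>y. y \<in> cball 0 \<bar>\<rho>\<bar> \<Longrightarrow> cmod (F y) \<le> cmod (F x)" by blast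
    have max: "cmod (F y) \<le> cmod (F x)" for y
    proof (cases "y \<in> cball 0 \<bar>\<rho>\<bar>")
      case False
      then have "\<rho> \<le> cmod y" by simp
      then show ?thesis using \<rho>[of y] x[OF w\<rho>] by linarith
    qed (rule x)
    have xn: "F x \<noteq> 0" using max[of w] w by auto
    define T where "T = F -` {F x}"
    have "closed T" unfolding T_def by (rule closed_vimage[OF closed_singleton cF])
    moreover have "open T"
      unfolding open_contains_ball
    proof
      fix y assume y: "y \<in> T"
      then have Fy: "F y = F x" by (simp add: T_def)
      then have "y \<in> U" using xn by (auto simp: F_def split: if_splits)
      then obtain e where e: "e > 0" "ball y e \<subseteq> U" using U by (meson openE)
      have "F constant_on ball y e"
        by (rule maximum_modulus_principle[where \<xi> = y, OF holomorphic_on_subset[OF hF e(2)] open_ball connected_ball open_ball order_refl])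
           (use e max Fy in auto)
      then have "ball y e \<subseteq> T" using e(1) Fy unfolding constant_on_def T_def by auto
      then show "\<exists>e>0. ball y e \<subseteq> T" using e(1) by blast
    qed
    moreover have "x \<in> T" by (simp add: T_def)
    ultimately have "T = UNIV" using clopen[of T] by blast
    have "F x = F y" for y
    proof -
      have "y \<in> T" unfolding \<open>T = UNIV\<close> by simp
      then show ?thesis by (simp add: T_def)
    qed
    then have Fc: "(\<lambda>_. F x) = F" by (rule ext)
    have "((\<lambda>_. F x) \<longlongrightarrow> 0) (at_infinity :: complex filter)" unfolding Fc by (rule lim)
    then show False using xn tendsto_const_iff[OF trivial_limit_at_infinity] by blast
  qed
  then show ?thesis using vF by simp
qed

text \<open>The linear conditions imposed on the coefficients \<open>c\<close> are \<open>variation_degree + 1\<close> for the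
vanishing of the variation and three for the zeros that the maximum principle requires of the
potential in the Fatou set.\<close>

theorem invariant_beltrami_dependent:
  fixes m :: "nat \<Rightarrow> complex \<Rightarrow> complex"
  defines "N \<equiv> variation_degree + 5"
  assumes mm[measurable]: "\<And>i. m i \<in> borel_measurable borel" and K: "\<And>i t. cmod (m i t) \<le> 1"
    and inv: "\<And>i. beltrami_invariant (m i)"
    and supp: "\<And>i. AE t in lborel. t \<notin> julia_plane R \<longrightarrow> m i t = 0"
  shows "\<exists>c. (\<exists>i<N. c i \<noteq> 0) \<and> (AE t in lborel. (\<Sum>i<N. c i * m i t) = 0)"
proof -
  let ?J = "julia_plane R"
  have oU: "open (- ?J)" using closed_julia_plane by (simp add: open_Compl)
  \<comment> \<open>if the Fatou set has finite points, infinitely many of them are available for the zeros\<close>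
  obtain z :: "nat \<Rightarrow> complex" where z: "?J = UNIV \<or> (inj z \<and> range z \<subseteq> - ?J)"
  proof (cases "?J = UNIV")
    case False
    then obtain a where "a \<in> - ?J" by blast
    then have "infinite (- ?J)" using oU by (metis finite_imp_not_open empty_iff)
    then have "\<exists>z :: nat \<Rightarrow> complex. inj z \<and> range z \<subseteq> - ?J" using infinite_countable_subset by blast
    then show ?thesis using that by blast
  qed (use that in blast)
  define A where "A i k = (if k \<le> variation_degree then (deriv ^^ k) (variation (m i)) 0 / fact k
      else potential (m i) (z (k - Suc variation_degree)))" for i k
  obtain c where c: "\<exists>i<N. c i \<noteq> 0" "\<forall>k<variation_degree + 4. (\<Sum>i<N. c i * A i k) = 0"
    using underdetermined_system[of "variation_degree + 4" N A] by (auto simp: N_def)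
  define \<mu> where "\<mu> t = (\<Sum>i<N. c i * m i t)" for t
  have mum[measurable]: "\<mu> \<in> borel_measurable borel" unfolding \<mu>_def[abs_def] by measurable
  define K' where "K' = (\<Sum>i<N. cmod (c i))"
  have muK: "cmod (\<mu> t) \<le> K'" for t
  proof -
    have "cmod (\<mu> t) \<le> (\<Sum>i<N. cmod (c i * m i t))" unfolding \<mu>_def by (rule norm_sum)
    also have "\<dots> \<le> (\<Sum>i<N. cmod (c i) * 1)"
      unfolding norm_mult by (intro sum_mono mult_left_mono K) auto
    finally show ?thesis by (simp add: K'_def)
  qed
  have pot: "potential \<mu> a = (\<Sum>i<N. c i * potential (m i) a)" for a
    unfolding \<mu>_def[abs_def] by (rule potential_sum) (use K in auto)
  have Gmu: "variation \<mu> a = 0" for a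
  proof -
    have "variation \<mu> a = (\<Sum>i<N. c i * variation (m i) a)"
      unfolding variation_def pot by (simp add: sum_distrib_left sum_subtractf right_diff_distrib mult_ac)
    also have "\<dots> = (\<Sum>i<N. \<Sum>k\<le>variation_degree. c i * A i k * a ^ k)"
      by (intro sum.cong refl) (simp add: variation_polynomial[OF mm K inv] sum_distrib_left A_def mult_ac)
    also have "\<dots> = (\<Sum>k\<le>variation_degree. (\<Sum>i<N. c i * A i k) * a ^ k)"
      by (subst sum.swap) (simp add: sum_distrib_right)
    also have "\<dots> = 0" using c(2) by (intro sum.neutral) auto
    finally show ?thesis .
  qed
  have v: "potential \<mu> (r a) = r' a * potential \<mu> a" if qa: "poly q a \<noteq> 0" for a
  proof -
    have "poly q a ^ 3 * (potential \<mu> (r a) - r' a * potential \<mu> a) = variation \<mu> a"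
      using qa by (simp add: variation_def r'_def field_simps power2_eq_square power3_eq_cube)
    then show ?thesis using qa Gmu by simp
  qed
  have vc: "continuous_on UNIV (potential \<mu>)" by (rule continuous_on_potential[OF mum muK])
  have vb: "cmod (potential \<mu> a) \<le> 20 * pi * K' * (1 + (cmod a)\<^sup>2)" for a by (rule potential_bound[OF mum muK])
  have vJ: "potential \<mu> a = 0" if "a \<in> ?J" for a
    by (rule invariant_field_zero_on_julia[OF v vc vb that])
  have "potential \<mu> a = 0" for a
  proof (cases "?J = UNIV")
    case True
    then show ?thesis using vJ by blast
  next
    case False
    then have z': "inj z" "z k \<in> - ?J" for k using z by auto
    have vz: "potential \<mu> (z k) = 0" if "k < 3" for k
    proof -
      have "(\<Sum>i<N. c i * A i (k + Suc variation_degree)) = 0" using c(2) that by simp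
      then show ?thesis unfolding pot by (simp add: A_def)
    qed
    have "AE t in lborel. \<forall>i. (t \<notin> ?J \<longrightarrow> m i t = 0)" unfolding AE_all_countable using supp by blast
    then have "AE t in lborel. t \<in> - ?J \<longrightarrow> \<mu> t = 0"
      by (rule AE_mp) (auto intro!: AE_I2 simp: \<mu>_def)
    then have h: "potential \<mu> holomorphic_on - ?J" by (rule holomorphic_on_potential[OF mum muK oU])
    show ?thesis
      by (rule zero_outside_imp_zero[OF oU h vc _ vb z'(2)[of 0] z'(2)[of 1] z'(2)[of 2]])
         (use vJ vz z'(1) in \<open>auto simp: inj_eq\<close>)
  qed
  then have "AE t in lborel. \<mu> t = 0" by (rule potential_eq_0_imp_AE_0[OF mum muK])
  then show ?thesis using c(1) unfolding \<mu>_def by blast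
qed

end

section \<open>Fixed points of the Ruelle operator\<close>

text \<open>A sequence of this kind is zero up to some index and constant from there on.\<close>

lemma lim_eventually_constant:
  fixes u :: "nat \<Rightarrow> complex"
  assumes u: "\<And>n. u n \<noteq> 0 \<Longrightarrow> u (Suc n) = u n"
  shows "u \<longlonglongrightarrow> lim u" and "u N \<noteq> 0 \<Longrightarrow> lim u = u N"
    and "lim u \<noteq> 0 \<Longrightarrow> \<exists>n. u n = lim u"
proof -
  have const: "u \<longlonglongrightarrow> u N" if "u N \<noteq> 0" for N
  proof -
    have "u (N + k) = u N" for k
    proof (induction k)
      case (Suc k)
      then show ?case using u[of "N + k"] that by simp
    qed simp
    then show ?thesis by (intro LIMSEQ_offset[of u N]) (simp add: add.commute)
  qed
  have "\<exists>c. u \<longlonglongrightarrow> c \<and> (c \<noteq> 0 \<longrightarrow> (\<exists>n. u n = c))"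
  proof (cases "\<exists>N. u N \<noteq> 0")
    case True
    then show ?thesis using const by blast
  next
    case False
    then have "u = (\<lambda>_. 0)" by auto
    then show ?thesis by (intro exI[of _ 0]) simp
  qed
  then obtain c where c: "u \<longlonglongrightarrow> c" "c \<noteq> 0 \<longrightarrow> (\<exists>n. u n = c)" by blast
  have "lim u = c" using c(1) by (rule limI)
  then show "u \<longlonglongrightarrow> lim u" and "lim u \<noteq> 0 \<Longrightarrow> \<exists>n. u n = lim u"
    using c by simp_all
  show "u N \<noteq> 0 \<Longrightarrow> lim u = u N" using const limI by blast
qed

text \<open>The case of equality in the triangle inequality: compare the real parts of the terms rotated
by the argument of the sum.\<close>

lemma sgn_eq_if_norm_sum_eq:
  fixes z :: "'a \<Rightarrow> complex"
  assumes fin: "finite I" and eq: "(\<Sum>i\<in>I. cmod (z i)) = cmod (\<Sum>i\<in>I. z i)" and i: "i \<in> I" "z i \<noteq> 0"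
  shows "sgn (z i) = sgn (\<Sum>i\<in>I. z i)" and "(\<Sum>i\<in>I. z i) \<noteq> 0"
proof -
  define s where "s = (\<Sum>i\<in>I. z i)"
  have "0 < cmod (z i)" using i by simp
  also have "\<dots> \<le> (\<Sum>i\<in>I. cmod (z i))" using fin i by (intro member_le_sum) auto
  finally have pos: "0 < cmod s" using eq by (simp add: s_def)
  then have ne: "s \<noteq> 0" by auto
  then show "(\<Sum>i\<in>I. z i) \<noteq> 0" by (simp add: s_def)
  define u where "u = cnj (sgn s)"
  have u1: "cmod u = 1" using ne by (simp add: u_def norm_sgn)
  have us: "u * s = of_real (cmod s)"
  proof -
    have "cnj s * s = of_real ((cmod s)\<^sup>2)" by (subst complex_norm_square) (rule mult.commute)
    then show ?thesis using pos
      by (simp add: u_def sgn_eq power2_eq_square)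
  qed
  have le: "Re (u * z j) \<le> cmod (z j)" for j
    using complex_Re_le_cmod[of "u * z j"] u1 by (simp add: norm_mult)
  have "(\<Sum>j\<in>I. cmod (z j) - Re (u * z j)) = 0"
  proof -
    have "(\<Sum>j\<in>I. Re (u * z j)) = Re (u * s)" by (simp add: s_def sum_distrib_left)
    also have "\<dots> = cmod s" unfolding us by simp
    finally show ?thesis using eq by (simp add: sum_subtractf s_def)
  qed
  then have "cmod (z i) - Re (u * z i) = 0"
    using le fin i by (subst (asm) sum_nonneg_eq_0_iff) auto
  then have Re: "Re (u * z i) = cmod (u * z i)" using u1 by (simp add: norm_mult)
  then have "(Im (u * z i))\<^sup>2 = 0"
    using cmod_power2[of "u * z i"] by simp
  then have "u * z i = of_real (cmod (z i))"
    using Re u1 by (simp add: complex_eq_iff norm_mult)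
  then have "cnj u * (u * z i) = cnj u * of_real (cmod (z i))" by simp
  moreover have "cnj u * u = 1" using u1 by (metis complex_norm_square mult.commute of_real_1 power_one)
  ultimately have "z i = cnj u * of_real (cmod (z i))" by (simp add: mult.assoc[symmetric])
  moreover have "of_real (cmod (z i)) \<noteq> (0::complex)" using i(2) by simp
  ultimately have "z i / of_real (cmod (z i)) = cnj u" by (subst nonzero_divide_eq_eq)
  then have "sgn (z i) = cnj u" by (simp only: sgn_eq)
  then show "sgn (z i) = sgn (\<Sum>i\<in>I. z i)" by (simp add: u_def s_def)
qed

lemma cnj_borel [measurable]: "cnj \<in> borel_measurable borel"
  by (intro borel_measurable_continuous_onI continuous_intros)

context rational
begin

text \<open>The properties of a fixed point of the Ruelle operator that the proof uses: the line field
\<open>cnj (sgn f)\<close> is invariant on the support of \<open>f\<close>, which lies in the Julia set, and \<open>|f|\<close> is the density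
of an invariant measure.\<close>

definition aligned :: "(complex \<Rightarrow> complex) \<Rightarrow> bool" where
  "aligned f \<longleftrightarrow> f \<in> borel_measurable borel \<and> integrable lborel f \<and>
     (AE t in lborel. f t \<noteq> 0 \<longrightarrow> t \<in> julia_plane R \<and> f (r t) \<noteq> 0 \<and>
        cnj (sgn (f t)) = cnj (sgn (f (r t))) * cnj (r' t) / r' t) \<and>
     (\<forall>A\<in>sets borel. (\<integral>\<^sup>+t\<in>r -` A. ennreal (cmod (f t)) \<partial>lborel) = (\<integral>\<^sup>+t\<in>A. ennreal (cmod (f t)) \<partial>lborel))"

lemma julia_plane_borel [measurable]: "julia_plane R \<in> sets borel"
  using closed_julia_plane by simp

lemma lebesgue_ex_borel_complex:
  fixes g :: "complex \<Rightarrow> complex"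
  assumes "g \<in> borel_measurable lebesgue"
  shows "\<exists>g'\<in>borel_measurable borel. AE x in lborel. g x = g' x"
proof -
  have "(\<lambda>x. Re (g x)) \<in> borel_measurable lebesgue" "(\<lambda>x. Im (g x)) \<in> borel_measurable lebesgue"
    using assms by measurable
  note Re_Im = this
  obtain a where a: "a \<in> borel_measurable lborel" "AE x in lborel. Re (g x) = a x"
    using completion_ex_borel_measurable_real[OF Re_Im(1)] by (elim bexE)
  obtain b where b: "b \<in> borel_measurable lborel" "AE x in lborel. Im (g x) = b x"
    using completion_ex_borel_measurable_real[OF Re_Im(2)] by (elim bexE)
  have m: "(\<lambda>x. Complex (a x) (b x)) \<in> borel_measurable borel"
    using a(1) b(1) by (simp add: borel_measurable_complex_iff)
  have "AE x in lborel. g x = Complex (a x) (b x)"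
    using a(2) b(2) by eventually_elim (simp add: complex_eq_iff)
  then show ?thesis using m by (rule bexI)
qed

text \<open>Let \<open>Q s\<close> be the sum of the moduli over the fibre of \<open>s\<close>. It has the same integral as \<open>|f|\<close>, and
\<open>|f| \<le> Q\<close> by the triangle inequality, so \<open>Q = |f|\<close> almost everywhere. Off the Julia set \<open>f\<close> is \<open>0\<close> by
definition; replacing \<open>\<phi>\<close> by \<open>f\<close> keeps the equation because the Julia set is backward invariant.\<close>

lemma ruelle_fixed_imp_aligned:
  assumes int: "set_integrable lebesgue (julia_plane R) \<phi>"
    and nz: "\<not> (AE z in lebesgue. z \<in> julia_plane R \<longrightarrow> \<phi> z = 0)"
    and fix': "AE z in lebesgue. z \<in> julia_plane R \<longrightarrow> ruelle R \<phi> z = \<phi> z"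
  shows "\<exists>f. aligned f \<and> \<not> (AE t in lborel. f t = 0)"
proof -
  let ?J = "julia_plane R"
  define \<psi> where "\<psi> z = indicator ?J z *\<^sub>R \<phi> z" for z
  have pi: "integrable lebesgue \<psi>" using int by (simp add: set_integrable_def \<psi>_def[abs_def])
  obtain f1 where f1[measurable]: "f1 \<in> borel_measurable borel" and f1ae: "AE x in lborel. \<psi> x = f1 x"
    using lebesgue_ex_borel_complex[OF borel_measurable_integrable[OF pi]] by (elim bexE)
  define f where "f t = f1 t * indicator ?J t" for t
  have fm[measurable]: "f \<in> borel_measurable borel" unfolding f_def by measurable
  have fJ: "f t = 0" if "t \<notin> ?J" for t using that by (simp add: f_def)
  have fae: "AE x in lborel. \<psi> x = f x"
    using f1ae by eventually_elim (auto simp: f_def \<psi>_def indicator_def)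
  have fi: "integrable lborel f"
  proof -
    have "integrable lebesgue f"
      using pi fae by (subst integrable_cong_AE[of f lebesgue \<psi>]) (auto simp: AE_completion_iff intro!: measurable_completion)
    then show ?thesis by (simp add: integrable_completion)
  qed
  have fnz: "\<not> (AE t in lborel. f t = 0)"
  proof
    assume "AE t in lborel. f t = 0"
    then have "AE z in lborel. z \<in> ?J \<longrightarrow> \<phi> z = 0"
      using fae by eventually_elim (auto simp: \<psi>_def)
    then show False using nz by (simp add: AE_completion_iff)
  qed
  have fixf: "AE s in lborel. s \<in> ?J \<longrightarrow> f s = (\<Sum>w\<in>fibre s. f w / (r' w)\<^sup>2)"
  proof -
    have "AE z in lborel. z \<in> ?J \<longrightarrow> ruelle R \<phi> z = \<phi> z" using fix' by (simp add: AE_completion_iff)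
    moreover note fae
    moreover have "AE s in lborel. \<forall>w\<in>fibre s. \<psi> w = f w" by (rule AE_pushforward[OF fae])
    ultimately show ?thesis
    proof eventually_elim
      case (elim s)
      show ?case
      proof
        assume s: "s \<in> ?J"
        have "w \<in> ?J" if "w \<in> fibre s" for w using that s julia_backward[of w] by (auto simp: fibre_def)
        then have "\<phi> w = f w" if "w \<in> fibre s" for w using elim(3) that by (auto simp: \<psi>_def)
        then have "(\<Sum>w\<in>fibre s. f w / (r' w)\<^sup>2) = ruelle R \<phi> s" by (simp add: ruelle_eq)
        also have "\<dots> = f s" using elim(1,2) s by (simp add: \<psi>_def)
        finally show "f s = (\<Sum>w\<in>fibre s. f w / (r' w)\<^sup>2)" by simp
      qed
    qed
  qed
  define Q where "Q s = (\<Sum>w\<in>fibre s. cmod (f w / (r' w)\<^sup>2))" for s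
  have Q0: "Q s \<ge> 0" for s by (simp add: Q_def sum_nonneg)
  have QP: "ennreal (Q s) = (\<Sum>w\<in>fibre s. ennreal (cmod (f w)) / ennreal ((cmod (r' w))\<^sup>2))" for s
  proof -
    have "ennreal (Q s) = (\<Sum>w\<in>fibre s. ennreal (cmod (f w / (r' w)\<^sup>2)))"
      unfolding Q_def by (rule sum_ennreal[symmetric]) simp
    also have "\<dots> = (\<Sum>w\<in>fibre s. ennreal (cmod (f w)) / ennreal ((cmod (r' w))\<^sup>2))"
      by (intro sum.cong refl) (simp add: fibre_def r'_nz norm_divide norm_power divide_ennreal)
    finally show ?thesis .
  qed
  have Qm[measurable]: "(\<lambda>s. ennreal (Q s)) \<in> borel_measurable borel"
    unfolding QP by (rule transfer_borel) measurable
  have Qint: "(\<integral>\<^sup>+s. ennreal (Q s) \<partial>lborel) = (\<integral>\<^sup>+t. ennreal (cmod (f t)) \<partial>lborel)"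
    unfolding QP by (rule transfer[symmetric]) measurable
  have fle: "AE s in lborel. ennreal (cmod (f s)) \<le> ennreal (Q s)"
    using fixf
  proof eventually_elim
    case (elim s)
    show ?case
    proof (rule ennreal_leI, cases "s \<in> ?J")
      case True
      then have "f s = (\<Sum>w\<in>fibre s. f w / (r' w)\<^sup>2)" using elim by blast
      then show "cmod (f s) \<le> Q s" unfolding Q_def by (metis norm_sum)
    qed (simp add: fJ Q0)
  qed
  have ffin: "(\<integral>\<^sup>+t. ennreal (cmod (f t)) \<partial>lborel) \<noteq> \<infinity>"
    using fi by (simp add: integrable_iff_bounded)
  have "(\<integral>\<^sup>+s. ennreal (Q s) - ennreal (cmod (f s)) \<partial>lborel) = 0"
  proof -
    have "(\<integral>\<^sup>+s. ennreal (Q s) - ennreal (cmod (f s)) \<partial>lborel)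
      = (\<integral>\<^sup>+s. ennreal (Q s) \<partial>lborel) - (\<integral>\<^sup>+s. ennreal (cmod (f s)) \<partial>lborel)"
      by (rule nn_integral_diff[OF _ _ ffin fle]) auto
    then show ?thesis unfolding Qint using ffin by simp
  qed
  then have "AE s in lborel. ennreal (Q s) - ennreal (cmod (f s)) = 0"
    by (subst (asm) nn_integral_0_iff_AE) auto
  then have Qeq: "AE s in lborel. Q s = cmod (f s)"
    using fle
  proof eventually_elim
    case (elim s)
    then have "ennreal (Q s) \<le> ennreal (cmod (f s))" by (simp add: ennreal_minus_eq_0)
    then show ?case using elim(2) Q0 by (simp add: ennreal_le_iff)
  qed
  define good where "good s \<longleftrightarrow> (\<forall>w\<in>fibre s. f w \<noteq> 0 \<longrightarrow> f s \<noteq> 0 \<and> sgn (f w / (r' w)\<^sup>2) = sgn (f s))" for s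
  have "AE s in lborel. good s"
    using fixf Qeq
  proof eventually_elim
    case (elim s)
    show ?case
      unfolding good_def
    proof (intro ballI impI)
      fix w assume w: "w \<in> fibre s" "f w \<noteq> 0"
      have nzw: "f w / (r' w)\<^sup>2 \<noteq> 0" using w r'_nz by (auto simp: fibre_def)
      have "s \<in> ?J"
      proof (rule ccontr)
        assume "s \<notin> ?J"
        then have "Q s = 0" using elim(2) fJ by simp
        then have "cmod (f w / (r' w)\<^sup>2) = 0"
          unfolding Q_def using finite_fibre w(1) by (subst (asm) sum_nonneg_eq_0_iff) auto
        then show False using nzw by simp
      qed
      then have fs: "f s = (\<Sum>w\<in>fibre s. f w / (r' w)\<^sup>2)" using elim(1) by blast
      have "(\<Sum>w\<in>fibre s. cmod (f w / (r' w)\<^sup>2)) = cmod (\<Sum>w\<in>fibre s. f w / (r' w)\<^sup>2)"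
        using elim(2) fs by (simp add: Q_def)
      from sgn_eq_if_norm_sum_eq[OF finite_fibre this w(1) nzw]
      show "f s \<noteq> 0 \<and> sgn (f w / (r' w)\<^sup>2) = sgn (f s)" unfolding fs by simp
    qed
  qed
  then have "AE t in lborel. good (r t)" by (rule AE_pullback)
  then have phase: "AE t in lborel. f t \<noteq> 0 \<longrightarrow> t \<in> ?J \<and> f (r t) \<noteq> 0 \<and>
        cnj (sgn (f t)) = cnj (sgn (f (r t))) * cnj (r' t) / r' t"
    using AE_X
  proof eventually_elim
    case (elim t)
    show ?case
    proof
      assume ft: "f t \<noteq> 0"
      have tf: "t \<in> fibre (r t)" using elim(2) by (simp add: fibre_def)
      have g: "f (r t) \<noteq> 0" "sgn (f t / (r' t)\<^sup>2) = sgn (f (r t))"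
        using elim(1) tf ft unfolding good_def by auto
      have n: "r' t \<noteq> 0" using r'_nz elim(2) by blast
      have "sgn (f t / (r' t)\<^sup>2) = sgn (f t) / (sgn (r' t))\<^sup>2"
        by (simp add: sgn_eq norm_divide norm_power power_divide)
      then have "sgn (f t) / (sgn (r' t))\<^sup>2 = sgn (f (r t))" using g(2) by (simp only:)
      then have "sgn (f t) = sgn (f (r t)) * (sgn (r' t))\<^sup>2"
        using n by (simp add: field_simps sgn_zero_iff)
      then have "cnj (sgn (f t)) = cnj (sgn (f (r t))) * (cnj (sgn (r' t)))\<^sup>2" by simp
      also have "(cnj (sgn (r' t)))\<^sup>2 = cnj (r' t) / r' t"
      proof -
        have "(cnj (sgn (r' t)))\<^sup>2 = (cnj (r' t))\<^sup>2 / of_real ((cmod (r' t))\<^sup>2)"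
          by (simp add: sgn_eq power_divide)
        also have "of_real ((cmod (r' t))\<^sup>2) = r' t * cnj (r' t)" by (rule complex_norm_square)
        finally show ?thesis using n by (simp add: power2_eq_square)
      qed
      finally show "t \<in> ?J \<and> f (r t) \<noteq> 0 \<and> cnj (sgn (f t)) = cnj (sgn (f (r t))) * cnj (r' t) / r' t"
        using g(1) fJ ft by auto
    qed
  qed
  have inv: "(\<integral>\<^sup>+t\<in>r -` A. ennreal (cmod (f t)) \<partial>lborel) = (\<integral>\<^sup>+t\<in>A. ennreal (cmod (f t)) \<partial>lborel)"
    if A[measurable]: "A \<in> sets borel" for A
  proof -
    have [measurable]: "r -` A \<in> sets borel" using measurable_sets_borel[OF r_borel A] .
    have "(\<integral>\<^sup>+t\<in>r -` A. ennreal (cmod (f t)) \<partial>lborel)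
      = (\<integral>\<^sup>+s. (\<Sum>w\<in>fibre s. ennreal (cmod (f w)) * indicator (r -` A) w / ennreal ((cmod (r' w))\<^sup>2)) \<partial>lborel)"
      by (rule transfer) measurable
    also have "\<dots> = (\<integral>\<^sup>+s. ennreal (Q s) * indicator A s \<partial>lborel)"
    proof (rule nn_integral_cong)
      fix s
      show "(\<Sum>w\<in>fibre s. ennreal (cmod (f w)) * indicator (r -` A) w / ennreal ((cmod (r' w))\<^sup>2)) = ennreal (Q s) * indicator A s"
        unfolding QP sum_distrib_right by (intro sum.cong) (auto simp: fibre_def indicator_def)
    qed
    also have "\<dots> = (\<integral>\<^sup>+t\<in>A. ennreal (cmod (f t)) \<partial>lborel)"
      by (rule nn_integral_cong_AE) (use Qeq in \<open>eventually_elim, simp\<close>)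
    finally show ?thesis .
  qed
  have "aligned f" unfolding aligned_def using fm fi phase inv by blast
  then show ?thesis using fnz by blast
qed

lemma alignedD:
  assumes "aligned f"
  shows "f \<in> borel_measurable borel" "integrable lborel f"
    "AE t in lborel. f t \<noteq> 0 \<longrightarrow> t \<in> julia_plane R \<and> f (r t) \<noteq> 0 \<and>
        cnj (sgn (f t)) = cnj (sgn (f (r t))) * cnj (r' t) / r' t"
    "A \<in> sets borel \<Longrightarrow> (\<integral>\<^sup>+t\<in>r -` A. ennreal (cmod (f t)) \<partial>lborel) = (\<integral>\<^sup>+t\<in>A. ennreal (cmod (f t)) \<partial>lborel)"
  using assms unfolding aligned_def by blast+

lemma aligned_restrict:
  assumes f: "aligned f" and B[measurable]: "B \<in> sets borel"
    and inv: "AE t in lborel. t \<in> B \<longleftrightarrow> r t \<in> B"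
  shows "aligned (\<lambda>t. f t * indicator B t)"
  unfolding aligned_def
proof (intro conjI ballI)
  note [measurable] = alignedD(1)[OF f]
  show "(\<lambda>t. f t * indicator B t) \<in> borel_measurable borel" by measurable
  show "integrable lborel (\<lambda>t. f t * indicator B t)"
    by (rule Bochner_Integration.integrable_bound[OF alignedD(2)[OF f]]) (auto simp: indicator_def)
  show "AE t in lborel. f t * indicator B t \<noteq> 0 \<longrightarrow> t \<in> julia_plane R \<and> f (r t) * indicator B (r t) \<noteq> 0 \<and>
        cnj (sgn (f t * indicator B t)) = cnj (sgn (f (r t) * indicator B (r t))) * cnj (r' t) / r' t"
    using alignedD(3)[OF f] inv by eventually_elim (auto simp: indicator_def)
  fix A :: "complex set" assume A[measurable]: "A \<in> sets borel"
  have "(\<integral>\<^sup>+t\<in>r -` A. ennreal (cmod (f t * indicator B t)) \<partial>lborel)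
     = (\<integral>\<^sup>+t\<in>r -` (A \<inter> B). ennreal (cmod (f t)) \<partial>lborel)"
    by (rule nn_integral_cong_AE) (use inv in \<open>eventually_elim, auto simp: indicator_def\<close>)
  also have "\<dots> = (\<integral>\<^sup>+t\<in>A \<inter> B. ennreal (cmod (f t)) \<partial>lborel)"
    by (rule alignedD(4)[OF f]) measurable
  also have "\<dots> = (\<integral>\<^sup>+t\<in>A. ennreal (cmod (f t * indicator B t)) \<partial>lborel)"
    by (rule nn_integral_cong) (auto simp: indicator_def)
  finally show "(\<integral>\<^sup>+t\<in>r -` A. ennreal (cmod (f t * indicator B t)) \<partial>lborel)
      = (\<integral>\<^sup>+t\<in>A. ennreal (cmod (f t * indicator B t)) \<partial>lborel)" .
qed

text \<open>The support \<open>S\<close> of \<open>f\<close> satisfies \<open>S \<subseteq> R\<^sup>-\<^sup>1 S\<close>, possibly strictly, so \<open>cnj (sgn f)\<close> need not be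
invariant as a function on the plane. Pulling it back \<open>n\<close> times defines it on \<open>R\<^sup>-\<^sup>n S\<close>, and these
pullbacks stabilise to an invariant coefficient.\<close>

lemma aligned_extension:
  assumes f: "aligned f"
  obtains \<mu> where "\<mu> \<in> borel_measurable borel" "\<And>t. cmod (\<mu> t) \<le> 1" "beltrami_invariant \<mu>"
    "AE t in lborel. t \<notin> julia_plane R \<longrightarrow> \<mu> t = 0" "AE t in lborel. f t \<noteq> 0 \<longrightarrow> \<mu> t \<noteq> 0"
proof -
  note [measurable] = alignedD(1)[OF f]
  define \<kappa> where "\<kappa> t = cnj (r' t) / r' t" for t
  have \<kappa>m[measurable]: "\<kappa> \<in> borel_measurable borel" unfolding \<kappa>_def[abs_def] by measurable
  have \<kappa>1: "cmod (\<kappa> t) \<le> 1" for t by (simp add: \<kappa>_def norm_divide)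
  define U where "U n = ((\<lambda>m t. m (r t) * \<kappa> t) ^^ n) (\<lambda>t. cnj (sgn (f t)))" for n
  have U0: "U 0 t = cnj (sgn (f t))" for t by (simp add: U_def)
  have US: "U (Suc n) t = U n (r t) * \<kappa> t" for n t by (simp add: U_def)
  have sgn_m: "(\<lambda>t. sgn (f t)) \<in> borel_measurable borel" unfolding sgn_div_norm by measurable
  have Um[measurable]: "U n \<in> borel_measurable borel" for n
  proof (induction n)
    case 0
    have "U 0 = (\<lambda>t. cnj (sgn (f t)))" by (auto simp: U0)
    then show ?case using sgn_m by simp
  next
    case (Suc n)
    note [measurable] = Suc
    have "U (Suc n) = (\<lambda>t. U n (r t) * \<kappa> t)" by (auto simp: US)
    then show ?case by simp
  qed
  have U1: "cmod (U n t) \<le> 1" for n t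
  proof (induction n arbitrary: t)
    case 0
    then show ?case by (simp add: U0 norm_sgn)
  next
    case (Suc n)
    have "cmod (U n (r t)) * cmod (\<kappa> t) \<le> 1 * 1" by (intro mult_mono Suc \<kappa>1) auto
    then show ?case by (simp add: US norm_mult)
  qed
  have stab: "AE t in lborel. U n t \<noteq> 0 \<longrightarrow> U (Suc n) t = U n t" for n
  proof (induction n)
    case 0
    show ?case using alignedD(3)[OF f]
    proof eventually_elim
      case (elim t)
      show ?case
      proof
        assume "U 0 t \<noteq> 0"
        then have "f t \<noteq> 0" by (auto simp: U0 sgn_zero_iff)
        with elim have "cnj (sgn (f t)) = cnj (sgn (f (r t))) * cnj (r' t) / r' t" by blast
        then show "U (Suc 0) t = U 0 t" by (simp add: US U0 \<kappa>_def)
      qed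
    qed
  next
    case (Suc n)
    from AE_pullback[OF this] show ?case
      by eventually_elim (auto simp: US)
  qed
  have suppJ: "AE t in lborel. U n t \<noteq> 0 \<longrightarrow> t \<in> julia_plane R" for n
  proof (induction n)
    case 0
    show ?case using alignedD(3)[OF f] by eventually_elim (auto simp: U0 sgn_zero_iff)
  next
    case (Suc n)
    from AE_pullback[OF this] AE_X show ?case
      by eventually_elim (use julia_backward in \<open>auto simp: US\<close>)
  qed
  have stab': "AE t in lborel. \<forall>n. U n t \<noteq> 0 \<longrightarrow> U (Suc n) t = U n t"
    unfolding AE_all_countable using stab by blast
  have suppJ': "AE t in lborel. \<forall>n. U n t \<noteq> 0 \<longrightarrow> t \<in> julia_plane R"
    unfolding AE_all_countable using suppJ by blast
  define V where "V t = lim (\<lambda>n. U n t)" for t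
  have Vm[measurable]: "V \<in> borel_measurable borel" unfolding V_def[abs_def] by measurable
  \<comment> \<open>where the sequence does not converge, \<open>lim\<close> is unspecified and may violate the bound\<close>
  define \<mu> where "\<mu> t = (if cmod (V t) \<le> 1 then V t else 0)" for t
  have \<mu>V: "AE t in lborel. \<mu> t = V t"
    using stab'
  proof eventually_elim
    case (elim t)
    have "(\<lambda>n. U n t) \<longlonglongrightarrow> V t" unfolding V_def using lim_eventually_constant(1)[of "\<lambda>n. U n t"] elim by blast
    then have "cmod (V t) \<le> 1" by (rule tendsto_norm[THEN LIMSEQ_le_const2]) (use U1 in blast)
    then show ?case by (simp add: \<mu>_def)
  qed
  show ?thesis
  proof (rule that)
    show "\<mu> \<in> borel_measurable borel" unfolding \<mu>_def[abs_def] by measurable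
    show "cmod (\<mu> t) \<le> 1" for t by (simp add: \<mu>_def)
    show "beltrami_invariant \<mu>"
      unfolding beltrami_invariant_def
      using stab' AE_pullback[OF stab'] \<mu>V AE_pullback[OF \<mu>V]
    proof eventually_elim
      case (elim t)
      have "(\<lambda>n. U n t) \<longlonglongrightarrow> V t" unfolding V_def using lim_eventually_constant(1)[of "\<lambda>n. U n t"] elim(1) by blast
      then have 1: "(\<lambda>n. U (Suc n) t) \<longlonglongrightarrow> V t" by (rule LIMSEQ_Suc)
      have "(\<lambda>n. U n (r t)) \<longlonglongrightarrow> V (r t)" unfolding V_def using lim_eventually_constant(1)[of "\<lambda>n. U n (r t)"] elim(2) by blast
      then have "(\<lambda>n. U (Suc n) t) \<longlonglongrightarrow> V (r t) * \<kappa> t" unfolding US by (intro tendsto_intros)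
      then have "V t = V (r t) * \<kappa> t" using 1 LIMSEQ_unique by blast
      then show ?case using elim(3,4) by (simp add: \<kappa>_def)
    qed
    show "AE t in lborel. t \<notin> julia_plane R \<longrightarrow> \<mu> t = 0"
      using stab' suppJ' \<mu>V
    proof eventually_elim
      case (elim t)
      show ?case
      proof (intro impI, rule ccontr)
        assume t: "t \<notin> julia_plane R" and "\<mu> t \<noteq> 0"
        then have "lim (\<lambda>n. U n t) \<noteq> 0" using elim(3) by (simp add: V_def)
        then obtain n where "U n t \<noteq> 0"
          using lim_eventually_constant(3)[of "\<lambda>n. U n t"] elim(1) by metis
        then show False using t elim(2) by blast
      qed
    qed
    show "AE t in lborel. f t \<noteq> 0 \<longrightarrow> \<mu> t \<noteq> 0"
      using stab' \<mu>V
    proof eventually_elim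
      case (elim t)
      show ?case
      proof
        assume "f t \<noteq> 0"
        then have "U 0 t \<noteq> 0" by (simp add: U0 sgn_zero_iff)
        then have "V t = U 0 t" unfolding V_def using lim_eventually_constant(2)[of "\<lambda>n. U n t" 0] elim(1) by blast
        then show "\<mu> t \<noteq> 0" using \<open>U 0 t \<noteq> 0\<close> elim(2) by simp
      qed
    qed
  qed
qed

definition mass :: "(complex \<Rightarrow> complex) \<Rightarrow> csphere set \<Rightarrow> ennreal" where
  "mass f E = (\<integral>\<^sup>+t\<in>Fin -` E. ennreal (cmod (f t)) \<partial>lborel)"

definition invariant_set :: "csphere set \<Rightarrow> bool" where
  "invariant_set E \<longleftrightarrow> E \<in> sets borel \<and> R -` E = E"

lemma mass_0_iff:
  assumes [measurable]: "f \<in> borel_measurable borel" "E \<in> sets borel"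
  shows "mass f E = 0 \<longleftrightarrow> (AE t in lborel. Fin t \<in> E \<longrightarrow> f t = 0)"
proof -
  have [measurable]: "Fin -` E \<in> sets borel" using measurable_sets_borel[OF Fin_measurable assms(2)] .
  show ?thesis
    unfolding mass_def
    by (subst nn_integral_0_iff_AE) (auto simp: indicator_def intro!: AE_cong)
qed

lemma invariant_set_r: "invariant_set E \<Longrightarrow> t \<in> X \<Longrightarrow> Fin (r t) \<in> E \<longleftrightarrow> Fin t \<in> E"
  unfolding invariant_set_def by (metis R_Fin_X vimage_eq)

text \<open>Otherwise splitting would produce more disjoint invariant sets of positive mass than the
dimension of the space of invariant Beltrami coefficients on the Julia set allows.\<close>

lemma ex_minimal_invariant_set:
  assumes f: "aligned f" and nz: "\<not> (AE t in lborel. f t = 0)"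
  shows "\<exists>E. invariant_set E \<and> mass f E > 0 \<and>
     (\<forall>E'. invariant_set E' \<and> E' \<subseteq> E \<longrightarrow> mass f E' = 0 \<or> mass f (E - E') = 0)"
proof (rule ccontr)
  note fm[measurable] = alignedD(1)[OF f]
  assume no: "\<not> ?thesis"
  have split: "\<exists>E'. invariant_set E' \<and> E' \<subseteq> E \<and> mass f E' > 0 \<and> mass f (E - E') > 0 \<and> invariant_set (E - E')"
    if "invariant_set E" "mass f E > 0" for E
  proof -
    have "\<not> (\<forall>E'. invariant_set E' \<and> E' \<subseteq> E \<longrightarrow> mass f E' = 0 \<or> mass f (E - E') = 0)"
      using no that by blast
    then obtain E' where "invariant_set E'" "E' \<subseteq> E" "mass f E' \<noteq> 0" "mass f (E - E') \<noteq> 0"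
      by blast
    moreover have "invariant_set (E - E')"
      using that(1) \<open>invariant_set E'\<close> by (auto simp: invariant_set_def vimage_Diff)
    ultimately show ?thesis by (auto simp: zero_less_iff_neq_zero)
qed
  have "\<exists>D :: nat \<Rightarrow> csphere set. disjoint_family D \<and> (\<forall>i. invariant_set (D i)) \<and> (\<forall>i\<le>n. mass f (D i) > 0) \<and> (\<forall>i>n. D i = {})" for n
  proof (induction n)
    case 0
    have "mass f UNIV > 0"
      using nz mass_0_iff[OF fm, of UNIV] by (auto simp: zero_less_iff_neq_zero)
    then show ?case
      by (intro exI[of _ "\<lambda>i. if i = 0 then UNIV else {}"])
         (auto simp: disjoint_family_on_def invariant_set_def)
  next
    case (Suc n)
    then obtain D :: "nat \<Rightarrow> csphere set" where D: "disjoint_family D" "\<And>i. invariant_set (D i)"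
      "\<And>i. i \<le> n \<Longrightarrow> mass f (D i) > 0" "\<And>i. i > n \<Longrightarrow> D i = {}" by blast
    obtain E' where E': "invariant_set E'" "E' \<subseteq> D 0" "mass f E' > 0" "mass f (D 0 - E') > 0" "invariant_set (D 0 - E')"
      using split[OF D(2) D(3)[of 0]] by blast
    define D' where "D' = D(0 := E', Suc n := D 0 - E')"
    have sub: "i \<noteq> 0 \<Longrightarrow> i \<noteq> Suc n \<Longrightarrow> D i \<inter> D 0 = {}" for i
      using D(1) by (auto simp: disjoint_family_on_def)
    have "disjoint_family D'"
      unfolding disjoint_family_on_def
    proof (intro ballI impI)
      fix i j :: nat assume "i \<noteq> j"
      then show "D' i \<inter> D' j = {}"
        using D(1) E'(2) sub[of i] sub[of j] unfolding D'_def disjoint_family_on_def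
        by (cases "i = 0"; cases "j = 0"; cases "i = Suc n"; cases "j = Suc n") (simp_all, blast+)
    qed
    moreover have "invariant_set (D' i)" for i using D(2) E' by (simp add: D'_def)
    moreover have "mass f (D' i) > 0" if "i \<le> Suc n" for i using D(3)[of i] E' that by (auto simp: D'_def)
    moreover have "D' i = {}" if "i > Suc n" for i using D(4)[of i] that by (simp add: D'_def)
    ultimately show ?case by blast
  qed
  from this[of "variation_degree + 5"] obtain D :: "nat \<Rightarrow> csphere set"
    where D': "disjoint_family D \<and> (\<forall>i. invariant_set (D i)) \<and> (\<forall>i\<le>variation_degree + 5. mass f (D i) > 0) \<and> (\<forall>i>variation_degree + 5. D i = {})"
    by (elim exE)
  then have D: "disjoint_family D" "\<And>i. invariant_set (D i)"
    "\<And>i. i \<le> variation_degree + 5 \<Longrightarrow> mass f (D i) > 0" by simp_all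
  have Db: "D i \<in> sets borel" for i using D(2) by (simp add: invariant_set_def)
  have [measurable]: "Fin -` D i \<in> sets borel" for i using measurable_sets_borel[OF Fin_measurable Db] .
  obtain \<mu> where \<mu>[measurable]: "\<mu> \<in> borel_measurable borel" and \<mu>': "\<And>t. cmod (\<mu> t) \<le> 1" "beltrami_invariant \<mu>"
    "AE t in lborel. t \<notin> julia_plane R \<longrightarrow> \<mu> t = 0" "AE t in lborel. f t \<noteq> 0 \<longrightarrow> \<mu> t \<noteq> 0"
    by (rule aligned_extension[OF f]) blast
  define m where "m i t = \<mu> t * indicator (Fin -` D i) t" for i t
  have "\<exists>c. (\<exists>i<variation_degree + 5. c i \<noteq> 0) \<and> (AE t in lborel. (\<Sum>i<variation_degree + 5. c i * m i t) = 0)"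
  proof (rule invariant_beltrami_dependent)
    show "m i \<in> borel_measurable borel" for i unfolding m_def[abs_def] by measurable
    show "cmod (m i t) \<le> 1" for i t using \<mu>'(1)[of t] by (simp add: m_def indicator_def)
    show "beltrami_invariant (m i)" for i
      unfolding beltrami_invariant_def
      using \<mu>'(2)[unfolded beltrami_invariant_def] AE_X
    proof eventually_elim
      case (elim t)
      have "Fin (r t) \<in> D i \<longleftrightarrow> Fin t \<in> D i" by (rule invariant_set_r[OF D(2) elim(2)])
      then show ?case using elim(1) by (auto simp: m_def indicator_def)
    qed
    show "AE t in lborel. t \<notin> julia_plane R \<longrightarrow> m i t = 0" for i
      using \<mu>'(3) by eventually_elim (auto simp: m_def)
  qed
  then obtain c where c': "(\<exists>i<variation_degree + 5. c i \<noteq> 0) \<and> (AE t in lborel. (\<Sum>i<variation_degree + 5. c i * m i t) = 0)"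
    by (elim exE)
  from conjunct1[OF c'] obtain i where i: "i < variation_degree + 5 \<and> c i \<noteq> 0" by (elim exE)
  then have c: "i < variation_degree + 5" "c i \<noteq> 0" "AE t in lborel. (\<Sum>i<variation_degree + 5. c i * m i t) = 0"
    using c' by simp_all
  have "AE t in lborel. Fin t \<in> D i \<longrightarrow> f t = 0"
    using c(3) \<mu>'(4)
  proof eventually_elim
    case (elim t)
    show ?case
    proof (intro impI, rule ccontr)
      assume t: "Fin t \<in> D i" and "f t \<noteq> 0"
      then have mt: "\<mu> t \<noteq> 0" using elim(2) by blast
      have "(\<Sum>j<variation_degree + 5. c j * m j t) = (\<Sum>j<variation_degree + 5. if j = i then c i * \<mu> t else 0)"
      proof (intro sum.cong refl)
        fix j
        have "Fin t \<notin> D j" if "j \<noteq> i" using D(1) t that by (auto simp: disjoint_family_on_def)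
        then show "c j * m j t = (if j = i then c i * \<mu> t else 0)" using t by (auto simp: m_def)
      qed
      also have "\<dots> = c i * \<mu> t" using c(1) by simp
      finally show False using elim(1) c(2) mt by simp
    qed
  qed
  then have "mass f (D i) = 0" using mass_0_iff[OF fm Db] by blast
  then show False using D(3)[of i] c(1) by simp
qed

end

section \<open>Mixing and precompactness\<close>

text \<open>Countably many balls of radius \<open>\<epsilon>\<close> cover the plane, so the preimage of one of them is not null.\<close>

lemma ex_essential_value:
  fixes f :: "'a \<Rightarrow> complex"
  assumes fin: "finite_measure M" and f[measurable]: "f \<in> borel_measurable M"
    and S[measurable]: "S \<in> sets M" and pos: "measure M S > 0" and e: "\<epsilon> > 0"
  shows "\<exists>c. measure M {x \<in> S. dist (f x) c < \<epsilon>} > 0"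
proof (rule ccontr)
  interpret finite_measure M by (rule fin)
  assume "\<not> ?thesis"
  then have 0: "measure M {x \<in> S. dist (f x) c < \<epsilon>} = 0" for c
    by (metis less_eq_real_def measure_nonneg)
  obtain D :: "complex set" where D: "countable D" "\<And>X. open X \<Longrightarrow> X \<noteq> {} \<Longrightarrow> \<exists>d\<in>D. d \<in> X"
    by (rule countable_dense_setE) blast
  have m: "{x \<in> S. dist (f x) c < \<epsilon>} \<in> sets M" for c
  proof -
    have "{x \<in> S. dist (f x) c < \<epsilon>} = S \<inter> {x \<in> space M. dist (f x) c < \<epsilon>}"
      using sets.sets_into_space[OF S] by auto
    then show ?thesis by simp
  qed
  have "{x \<in> S. dist (f x) c < \<epsilon>} \<in> null_sets M" for c
    using 0[of c] m[of c] by (auto simp: null_sets_def emeasure_eq_measure)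
  then have "(\<Union>c\<in>D. {x \<in> S. dist (f x) c < \<epsilon>}) \<in> null_sets M"
    using D(1) by (intro null_sets_UN') auto
  moreover have "S \<subseteq> (\<Union>c\<in>D. {x \<in> S. dist (f x) c < \<epsilon>})"
  proof
    fix x assume "x \<in> S"
    moreover obtain d where "d \<in> D" "d \<in> ball (f x) \<epsilon>" using D(2)[of "ball (f x) \<epsilon>"] e by auto
    ultimately show "x \<in> (\<Union>c\<in>D. {x \<in> S. dist (f x) c < \<epsilon>})" by auto
  qed
  ultimately have "S \<in> null_sets M" using null_sets_subset[OF _ S] by blast
  then show False using pos by (simp add: null_sets_def measure_def)
qed

lemma min_one_triangle: "0 \<le> a \<Longrightarrow> 0 \<le> b \<Longrightarrow> c \<le> a + b \<Longrightarrow> min 1 c \<le> min 1 a + min 1 (b :: real)"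
  by (auto simp: min_def)

text \<open>If no function were a cluster point of the sequence, every point of the compact closure would
have a neighbourhood that contains \<open>\<rho> n\<close> for finitely many \<open>n\<close> only. The neighbourhoods used are balls
for \<open>\<integral> min 1 |f - g|\<close>, whose triangle inequality makes them open in the topology of convergence in
measure.\<close>

lemma precompact_in_measure_cluster:
  fixes \<rho> :: "nat \<Rightarrow> 'a \<Rightarrow> complex"
  assumes pc: "precompact_in_measure \<mu> (range \<rho>)" and le1: "emeasure \<mu> (space \<mu>) \<le> 1"
  shows "\<exists>h\<in>borel_measurable \<mu>. \<forall>\<epsilon>>0. \<forall>N. \<exists>n\<ge>N. emeasure \<mu> {x\<in>space \<mu>. \<epsilon> \<le> dist (h x) (\<rho> n x)} < ennreal \<epsilon>"
proof (rule ccontr)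
  let ?T = "topology_in_measure \<mu>"
  have \<rho>m: "\<rho> n \<in> borel_measurable \<mu>" for n using pc unfolding precompact_in_measure_def by auto
  have bo: "openin ?T (borel_measurable \<mu>)"
    unfolding openin_topology_in_measure open_in_measure_def by (auto intro!: exI[of _ 1])
  have ts: "topspace ?T = borel_measurable \<mu>"
  proof
    show "topspace ?T \<subseteq> borel_measurable \<mu>"
      unfolding topspace_def openin_topology_in_measure open_in_measure_def by auto
    show "borel_measurable \<mu> \<subseteq> topspace ?T" using openin_subset[OF bo] .
  qed
  define I where "I f g = (\<integral>\<^sup>+x. ennreal (min 1 (dist (f x) (g x))) \<partial>\<mu>)" for f g :: "'a \<Rightarrow> complex"
  have tri: "I f g' \<le> I f g + I g g'"
    if [measurable]: "f \<in> borel_measurable \<mu>" "g \<in> borel_measurable \<mu>" "g' \<in> borel_measurable \<mu>" for f g g'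
  proof -
    have "I f g' \<le> (\<integral>\<^sup>+x. ennreal (min 1 (dist (f x) (g x))) + ennreal (min 1 (dist (g x) (g' x))) \<partial>\<mu>)"
      unfolding I_def
    proof (rule nn_integral_mono)
      fix x
      have "min 1 (dist (f x) (g' x)) \<le> min 1 (dist (f x) (g x)) + min 1 (dist (g x) (g' x))"
        by (rule min_one_triangle) (auto intro: dist_triangle)
      then have "ennreal (min 1 (dist (f x) (g' x))) \<le> ennreal (min 1 (dist (f x) (g x)) + min 1 (dist (g x) (g' x)))"
        by (rule ennreal_leI)
      also have "\<dots> = ennreal (min 1 (dist (f x) (g x))) + ennreal (min 1 (dist (g x) (g' x)))"
        by (rule ennreal_plus) auto
      finally show "ennreal (min 1 (dist (f x) (g' x))) \<le> ennreal (min 1 (dist (f x) (g x))) + ennreal (min 1 (dist (g x) (g' x)))" .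
    qed
    also have "\<dots> = I f g + I g g'" unfolding I_def by (rule nn_integral_add) measurable
    finally show ?thesis .
  qed
  have Ismall: "I g g' \<le> ennreal (2 * \<epsilon>)"
    if [measurable]: "g \<in> borel_measurable \<mu>" "g' \<in> borel_measurable \<mu>" and \<epsilon>: "\<epsilon> > 0"
      and s: "emeasure \<mu> {x\<in>space \<mu>. \<epsilon> \<le> dist (g x) (g' x)} < ennreal \<epsilon>" for g g' \<epsilon>
  proof -
    let ?S = "{x\<in>space \<mu>. \<epsilon> \<le> dist (g x) (g' x)}"
    have [measurable]: "?S \<in> sets \<mu>" by measurable
    have "I g g' \<le> (\<integral>\<^sup>+x. ennreal \<epsilon> + indicator ?S x \<partial>\<mu>)"
      unfolding I_def
    proof (rule nn_integral_mono)
      fix x assume "x \<in> space \<mu>"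
      show "ennreal (min 1 (dist (g x) (g' x))) \<le> ennreal \<epsilon> + indicator ?S x"
      proof (cases "\<epsilon> \<le> dist (g x) (g' x)")
        case True
        then have "indicator ?S x = (1::ennreal)" using \<open>x \<in> space \<mu>\<close> by simp
        moreover have "ennreal (min 1 (dist (g x) (g' x))) \<le> 1" using ennreal_leI[of "min 1 (dist (g x) (g' x))" 1] by simp
        ultimately show ?thesis by (simp add: add_increasing)
      next
        case False
        then have "ennreal (min 1 (dist (g x) (g' x))) \<le> ennreal \<epsilon>" by (intro ennreal_leI) auto
        then show ?thesis by (simp add: add_increasing2)
      qed
    qed
    also have "\<dots> = ennreal \<epsilon> * emeasure \<mu> (space \<mu>) + emeasure \<mu> ?S"
      by (subst nn_integral_add) auto
    also have "\<dots> \<le> ennreal \<epsilon> * 1 + ennreal \<epsilon>"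
      using s le1 by (intro add_mono mult_left_mono) auto
    also have "\<dots> = ennreal (2 * \<epsilon>)" using \<epsilon> by (simp add: ennreal_plus[symmetric] del: ennreal_plus)
    finally show ?thesis .
  qed
  define U where "U h \<epsilon> = {g \<in> borel_measurable \<mu>. I h g < ennreal (\<epsilon>\<^sup>2)}" for h and \<epsilon> :: real
  have Uo: "openin ?T (U h \<epsilon>)" if h: "h \<in> borel_measurable \<mu>" for h \<epsilon>
    unfolding openin_topology_in_measure open_in_measure_def
  proof (intro conjI ballI)
    fix g assume g: "g \<in> U h \<epsilon>"
    then have gm: "g \<in> borel_measurable \<mu>" and lt: "I h g < ennreal (\<epsilon>\<^sup>2)" by (auto simp: U_def)
    obtain a where a: "I h g = ennreal a" "0 \<le> a" using lt by (cases "I h g") auto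
    then have a2: "a < \<epsilon>\<^sup>2" using lt by (simp add: ennreal_less_iff)
    define \<delta> where "\<delta> = (\<epsilon>\<^sup>2 - a) / 3"
    have \<delta>: "\<delta> > 0" using a2 by (simp add: \<delta>_def)
    have "g' \<in> U h \<epsilon>" if g': "g' \<in> borel_measurable \<mu>"
      and s: "emeasure \<mu> {x\<in>space \<mu>. \<delta> \<le> dist (g x) (g' x)} < ennreal \<delta>" for g'
    proof -
      have "I h g' \<le> I h g + I g g'" by (rule tri[OF h gm g'])
      also have "\<dots> \<le> ennreal a + ennreal (2 * \<delta>)" using a Ismall[OF gm g' \<delta> s] by (intro add_mono) auto
      also have "\<dots> = ennreal (a + 2 * \<delta>)" using a \<delta> by simp
      also have "\<dots> < ennreal (\<epsilon>\<^sup>2)" using a(2) a2 \<delta> by (intro ennreal_lessI) (auto simp: \<delta>_def field_simps)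
      finally show ?thesis using g' by (simp add: U_def)
    qed
    then show "\<exists>\<epsilon>'>0. \<forall>g'\<in>borel_measurable \<mu>. emeasure \<mu> {x\<in>space \<mu>. \<epsilon>' \<le> dist (g x) (g' x)} < ennreal \<epsilon>' \<longrightarrow> g' \<in> U h \<epsilon>"
      using \<delta> by blast
  qed (auto simp: U_def)
  have Umarkov: "emeasure \<mu> {x\<in>space \<mu>. \<epsilon> \<le> dist (h x) (g x)} < ennreal \<epsilon>"
    if hm[measurable]: "h \<in> borel_measurable \<mu>" and gU: "g \<in> U h (min \<epsilon> 1)" and \<epsilon>: "\<epsilon> > 0" for h g \<epsilon>
  proof (rule ccontr)
    let ?S = "{x\<in>space \<mu>. \<epsilon> \<le> dist (h x) (g x)}"
    let ?e = "min \<epsilon> 1"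
    have [measurable]: "g \<in> borel_measurable \<mu>" using gU by (simp add: U_def)
    have [measurable]: "?S \<in> sets \<mu>" by measurable
    assume "\<not> emeasure \<mu> ?S < ennreal \<epsilon>"
    then have "ennreal \<epsilon> \<le> emeasure \<mu> ?S" by simp
    then have "ennreal ?e \<le> emeasure \<mu> ?S" using ennreal_leI[of ?e \<epsilon>] by (meson min.cobounded1 order_trans)
    then have "ennreal ?e * ennreal ?e \<le> ennreal ?e * emeasure \<mu> ?S" by (rule mult_left_mono) simp
    also have "\<dots> = (\<integral>\<^sup>+x. ennreal ?e * indicator ?S x \<partial>\<mu>)" by (simp add: nn_integral_cmult_indicator)
    also have "\<dots> \<le> I h g"
      unfolding I_def by (rule nn_integral_mono) (auto split: split_indicator intro!: ennreal_leI)
    finally have "ennreal (?e\<^sup>2) \<le> I h g" using \<epsilon> by (simp add: ennreal_mult[symmetric] power2_eq_square)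
    then show False using gU by (simp add: U_def)
  qed
  assume no: "\<not> ?thesis"
  have "\<exists>\<epsilon> N. \<epsilon> > 0 \<and> (\<forall>n\<ge>N. \<rho> n \<notin> U h (min \<epsilon> 1))" if h: "h \<in> borel_measurable \<mu>" for h
  proof -
    obtain \<epsilon> N where "\<epsilon> > 0" "\<And>n. n \<ge> N \<Longrightarrow> \<not> emeasure \<mu> {x\<in>space \<mu>. \<epsilon> \<le> dist (h x) (\<rho> n x)} < ennreal \<epsilon>"
      using no h by blast
    then show ?thesis using Umarkov[OF h] by blast
  qed
  then obtain \<epsilon> N where \<epsilon>N: "\<And>h. h \<in> borel_measurable \<mu> \<Longrightarrow> \<epsilon> h > 0"
    "\<And>h n. h \<in> borel_measurable \<mu> \<Longrightarrow> n \<ge> N h \<Longrightarrow> \<rho> n \<notin> U h (min (\<epsilon> h) 1)" by metis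
  let ?K = "?T closure_of (range \<rho>)"
  have K: "compactin ?T ?K" using pc unfolding precompact_in_measure_def by blast
  have Ksub: "?K \<subseteq> borel_measurable \<mu>" using compactin_subset_topspace[OF K] ts by simp
  let ?UU = "(\<lambda>h. U h (min (\<epsilon> h) 1)) ` ?K"
  have "?K \<subseteq> \<Union>?UU"
  proof
    fix h assume h: "h \<in> ?K"
    then have "I h h = 0" by (simp add: I_def)
    then have "h \<in> U h (min (\<epsilon> h) 1)" using h Ksub \<epsilon>N(1)[of h] by (auto simp: U_def)
    then show "h \<in> \<Union>?UU" using h by blast
  qed
  moreover have "\<And>V. V \<in> ?UU \<Longrightarrow> openin ?T V" using Uo Ksub by blast
  ultimately obtain \<F> where \<F>: "finite \<F>" "\<F> \<subseteq> ?UU" "?K \<subseteq> \<Union>\<F>"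
    using K unfolding compactin_def by meson
  then obtain H where H: "finite H" "H \<subseteq> ?K" "\<F> = (\<lambda>h. U h (min (\<epsilon> h) 1)) ` H"
    by (meson finite_subset_image)
  define n where "n = (if H = {} then 0 else Max (N ` H))"
  have "\<rho> n \<in> ?K" using closure_of_subset[of "range \<rho>" ?T] \<rho>m ts by auto
  then obtain h where h: "h \<in> H" "\<rho> n \<in> U h (min (\<epsilon> h) 1)" using \<F>(3) H(3) by blast
  have "N h \<le> n" using h(1) H(1) by (auto simp: n_def)
  then show False using \<epsilon>N(2)[of h n] h H(2) Ksub by blast
qed

text \<open>Let \<open>h\<close> be a cluster point of \<open>\<rho>\<close> and \<open>H = \<psi> cnj h\<close>, so that \<open>\<psi> \<circ> T n\<close> is close to \<open>H\<close> on most of \<open>A\<close> for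
infinitely many \<open>n\<close>. Fix \<open>B\<close> of positive measure on which \<open>H\<close> is close to a constant \<open>c\<close>. If \<open>\<psi>\<close> is
close to \<open>c'\<close> on some \<open>A'\<close> of positive measure, then by mixing a definite part of \<open>B\<close> is mapped
into \<open>A'\<close> by \<open>T n\<close> for large \<open>n\<close>, and at a point of this part \<open>c\<close> and \<open>c'\<close> are close. So all
essential values of \<open>\<psi>\<close> on \<open>A\<close> coincide with \<open>c\<close> up to a multiple of \<open>\<epsilon>\<close>.\<close>

lemma mixing_precompact_imp_constant:
  fixes \<psi> :: "'a \<Rightarrow> complex" and T :: "nat \<Rightarrow> 'a \<Rightarrow> 'a" and \<rho> :: "nat \<Rightarrow> 'a \<Rightarrow> complex"
  assumes pr: "prob_space M" and A[measurable]: "A \<in> sets M" and Apos: "measure M A > 0"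
    and \<psi>m[measurable]: "\<psi> \<in> borel_measurable M"
    and mix: "\<And>A' B. A' \<in> sets M \<Longrightarrow> B \<in> sets M \<Longrightarrow> A' \<subseteq> A \<Longrightarrow> B \<subseteq> A \<Longrightarrow>
        (\<lambda>n. measure M (B \<inter> T n -` A')) \<longlonglongrightarrow> measure M A' * measure M B"
    and pc: "precompact_in_measure (restrict_space M A) (range \<rho>)"
    and rel: "AE x in M. \<forall>n. \<psi> x = \<psi> (T n x) * \<rho> n x \<and> cmod (\<psi> x) = 1 \<and> cmod (\<rho> n x) = 1"
  shows "\<exists>c. AE x in M. x \<in> A \<longrightarrow> \<psi> x = c"
proof -
  interpret prob_space M by (rule pr)
  let ?MA = "restrict_space M A"
  have fm: "finite_measure M" by unfold_locales
  have AS: "A \<subseteq> space M" using sets.sets_into_space[OF A] .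
  have sp: "space ?MA = A" using AS by (auto simp: space_restrict_space)
  have em: "emeasure ?MA S = emeasure M S" if "S \<subseteq> A" for S
    using that AS by (intro emeasure_restrict_space) auto
  have le1: "emeasure ?MA (space ?MA) \<le> 1" unfolding sp em[OF order_refl] by (rule emeasure_le_1)
  obtain h where hm: "h \<in> borel_measurable ?MA"
    and h: "\<And>\<epsilon> N. \<epsilon> > 0 \<Longrightarrow> \<exists>n\<ge>N. emeasure ?MA {x\<in>space ?MA. \<epsilon> \<le> dist (h x) (\<rho> n x)} < ennreal \<epsilon>"
    using precompact_in_measure_cluster[OF pc le1] by blast
  have \<rho>m: "\<rho> n \<in> borel_measurable ?MA" for n using pc unfolding precompact_in_measure_def by auto
  have hs: "{x\<in>A. \<epsilon> \<le> dist (h x) (\<rho> n x)} \<in> sets M" for \<epsilon> n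
  proof -
    note [measurable] = hm \<rho>m
    have "{x\<in>space ?MA. \<epsilon> \<le> dist (h x) (\<rho> n x)} \<in> sets ?MA" by measurable
    then show ?thesis unfolding sp using A AS by (simp add: sets_restrict_space_iff)
  qed
  define H where "H x = \<psi> x * cnj (if x \<in> A then h x else 0)" for x
  have "(\<lambda>x. if x \<in> A then h x else 0) \<in> borel_measurable M"
    using hm AS by (subst (asm) measurable_restrict_space_iff[where c = 0]) auto
  then have [measurable]: "H \<in> borel_measurable M" unfolding H_def by measurable
  have near: "\<exists>c. AE x in M. x \<in> A \<longrightarrow> dist (\<psi> x) c \<le> 4 * \<epsilon>" if \<epsilon>: "\<epsilon> > 0" for \<epsilon>
  proof -
    obtain c where c: "measure M {x \<in> A. dist (H x) c < \<epsilon>} > 0"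
      using ex_essential_value[OF fm _ A Apos \<epsilon>, of H] by auto
    let ?B = "{x \<in> A. dist (H x) c < \<epsilon>}"
    have B: "?B \<in> sets M"
    proof -
      have "?B = A \<inter> {x \<in> space M. dist (H x) c < \<epsilon>}" using AS by auto
      then show ?thesis by simp
    qed
    have key: "dist c' c < 3 * \<epsilon>" if c': "measure M {x \<in> A. dist (\<psi> x) c' < \<epsilon>} > 0" for c'
    proof -
      let ?A' = "{x \<in> A. dist (\<psi> x) c' < \<epsilon>}"
      have A': "?A' \<in> sets M"
      proof -
        have "?A' = A \<inter> {x \<in> space M. dist (\<psi> x) c' < \<epsilon>}" using AS by auto
        then show ?thesis by simp
      qed
      define \<delta> where "\<delta> = measure M ?A' * measure M ?B"
      have \<delta>: "\<delta> > 0" using c c' by (simp add: \<delta>_def)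
      have "(\<lambda>n. measure M (?B \<inter> T n -` ?A')) \<longlonglongrightarrow> \<delta>" unfolding \<delta>_def by (rule mix[OF A' B]) auto
      then have "eventually (\<lambda>n. \<delta> / 2 < measure M (?B \<inter> T n -` ?A')) sequentially"
        using \<delta> by (intro order_tendstoD) auto
      then obtain N where N: "\<And>n. n \<ge> N \<Longrightarrow> \<delta> / 2 < measure M (?B \<inter> T n -` ?A')"
        unfolding eventually_sequentially by blast
      define \<eta> where "\<eta> = min \<epsilon> (\<delta> / 2)"
      have \<eta>: "\<eta> > 0" "\<eta> \<le> \<epsilon>" "\<eta> \<le> \<delta> / 2" using \<epsilon> \<delta> by (auto simp: \<eta>_def)
      obtain n where n: "n \<ge> N" "emeasure ?MA {x\<in>space ?MA. \<eta> \<le> dist (h x) (\<rho> n x)} < ennreal \<eta>"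
        using h[OF \<eta>(1), of N] by blast
      let ?S = "{x\<in>A. \<eta> \<le> dist (h x) (\<rho> n x)}"
      have "emeasure M ?S < ennreal \<eta>" using n(2) em[of ?S] unfolding sp by simp
      then have S: "measure M ?S < \<eta>" using \<eta>(1) by (simp add: emeasure_eq_measure ennreal_less_iff)
      let ?Y = "?B \<inter> T n -` ?A'"
      have Ypos: "measure M ?S < measure M ?Y" using S N[OF n(1)] \<eta>(3) by simp
      \<comment> \<open>a set that is not measurable has measure \<open>0\<close> by convention\<close>
      have Ym: "?Y \<in> sets M"
        using N[OF n(1)] \<delta> measure_notin_sets[of ?Y M] by (cases "?Y \<in> sets M") auto
      have "\<exists>x\<in>?Y - ?S. \<psi> x = \<psi> (T n x) * \<rho> n x \<and> cmod (\<psi> x) = 1 \<and> cmod (\<rho> n x) = 1"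
      proof (rule ccontr)
        assume no: "\<not> ?thesis"
        have "AE x in M. x \<notin> ?Y - ?S" using rel by eventually_elim (use no in blast)
        then have "AE x in M. x \<in> ?Y \<longrightarrow> x \<in> ?S" by eventually_elim blast
        then have "measure M ?Y \<le> measure M ?S" by (intro finite_measure_mono_AE hs)
        then show False using Ypos by simp
      qed
      then obtain x where x: "x \<in> ?B" "T n x \<in> ?A'" "x \<notin> ?S" "\<psi> x = \<psi> (T n x) * \<rho> n x"
        "cmod (\<psi> x) = 1" "cmod (\<rho> n x) = 1" by blast
      have xA: "x \<in> A" using x(1) by simp
      have "\<rho> n x * cnj (\<rho> n x) = 1" using x(6) by (metis complex_norm_square of_real_1 power_one)
      then have "\<psi> (T n x) = \<psi> x * cnj (\<rho> n x)" unfolding x(4) by (simp add: mult.assoc)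
      then have "\<psi> (T n x) - H x = \<psi> x * cnj (\<rho> n x - h x)" using xA by (simp add: H_def algebra_simps)
      then have "cmod (\<psi> (T n x) - H x) = cmod (\<rho> n x - h x)" using x(5) by (simp only: norm_mult complex_mod_cnj mult_1_left)
      then have "dist (\<psi> (T n x)) (H x) = dist (h x) (\<rho> n x)" by (simp add: dist_norm norm_minus_commute)
      also have "\<dots> < \<epsilon>" using x(3) xA \<eta>(2) by auto
      finally have 1: "dist (\<psi> (T n x)) (H x) < \<epsilon>" .
      have 2: "dist (H x) c < \<epsilon>" using x(1) by simp
      have 3: "dist (\<psi> (T n x)) c' < \<epsilon>" using x(2) by simp
      have "dist c' c \<le> dist c' (\<psi> (T n x)) + dist (\<psi> (T n x)) c" by (rule dist_triangle)
      also have "dist (\<psi> (T n x)) c \<le> dist (\<psi> (T n x)) (H x) + dist (H x) c" by (rule dist_triangle)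
      finally show ?thesis using 1 2 3 by (simp add: dist_commute)
    qed
    let ?S = "{x \<in> A. 4 * \<epsilon> < dist (\<psi> x) c}"
    have S: "?S \<in> sets M"
    proof -
      have "?S = A \<inter> {x \<in> space M. 4 * \<epsilon> < dist (\<psi> x) c}" using AS by auto
      then show ?thesis by simp
    qed
    have "measure M ?S = 0"
    proof (rule ccontr)
      assume "measure M ?S \<noteq> 0"
      then have "measure M ?S > 0" by (simp add: zero_less_measure_iff)
      then obtain c' where c': "measure M {x \<in> ?S. dist (\<psi> x) c' < \<epsilon>} > 0"
        using ex_essential_value[OF fm \<psi>m S _ \<epsilon>] by blast
      have A': "{x \<in> A. dist (\<psi> x) c' < \<epsilon>} \<in> sets M"
      proof -
        have "{x \<in> A. dist (\<psi> x) c' < \<epsilon>} = A \<inter> {x \<in> space M. dist (\<psi> x) c' < \<epsilon>}" using AS by auto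
        then show ?thesis by simp
      qed
      have "measure M {x \<in> ?S. dist (\<psi> x) c' < \<epsilon>} \<le> measure M {x \<in> A. dist (\<psi> x) c' < \<epsilon>}"
        by (rule finite_measure_mono[OF _ A']) auto
      then have d: "dist c' c < 3 * \<epsilon>" using c' by (intro key) simp
      have "{x \<in> ?S. dist (\<psi> x) c' < \<epsilon>} \<noteq> {}"
      proof
        assume e: "{x \<in> ?S. dist (\<psi> x) c' < \<epsilon>} = {}"
        show False using c' unfolding e by simp
      qed
      then obtain x where "4 * \<epsilon> < dist (\<psi> x) c" "dist (\<psi> x) c' < \<epsilon>" by blast
      then show False using d dist_triangle[of "\<psi> x" c c'] by linarith
    qed
    then have "?S \<in> null_sets M" using S by (auto simp: null_sets_def emeasure_eq_measure)
    from AE_not_in[OF this] have "AE x in M. x \<in> A \<longrightarrow> dist (\<psi> x) c \<le> 4 * \<epsilon>"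
      by eventually_elim auto
    then show ?thesis by blast
  qed
  have "\<exists>c. AE x in M. x \<in> A \<longrightarrow> dist (\<psi> x) c \<le> 4 * (1 / real (Suc k))" for k by (rule near) simp
  then obtain c where c: "\<And>k. AE x in M. x \<in> A \<longrightarrow> dist (\<psi> x) (c k) \<le> 4 * (1 / real (Suc k))" by metis
  then have ae: "AE x in M. \<forall>k. x \<in> A \<longrightarrow> dist (\<psi> x) (c k) \<le> 4 * (1 / real (Suc k))"
    unfolding AE_all_countable by blast
  have "\<exists>x0\<in>A. \<forall>k. dist (\<psi> x0) (c k) \<le> 4 * (1 / real (Suc k))"
  proof (rule ccontr)
    assume no: "\<not> ?thesis"
    have "AE x in M. x \<notin> A" using ae by eventually_elim (use no in blast)
    then have "A \<in> null_sets M" using A AE_iff_null_sets by blast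
    then show False using Apos by (simp add: null_sets_def measure_def)
  qed
  then obtain x0 where x0: "\<And>k. dist (\<psi> x0) (c k) \<le> 4 * (1 / real (Suc k))" by blast
  have "AE x in M. x \<in> A \<longrightarrow> \<psi> x = \<psi> x0"
    using ae
  proof eventually_elim
    case (elim x)
    show ?case
    proof
      assume "x \<in> A"
      then have "dist (\<psi> x) (c k) \<le> 4 * (1 / real (Suc k))" for k using elim by blast
      then have "dist (\<psi> x) (\<psi> x0) \<le> 8 * (1 / real (Suc k))" for k
        using x0[of k] dist_triangle2[of "\<psi> x" "\<psi> x0" "c k"] by (smt (verit))
      moreover have "(\<lambda>k. 8 * (1 / real (Suc k))) \<longlonglongrightarrow> 8 * 0"
        by (intro tendsto_intros LIMSEQ_inverse_real_of_nat[unfolded inverse_eq_divide])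
      ultimately have "dist (\<psi> x) (\<psi> x0) \<le> 8 * 0" by (intro LIMSEQ_le_const) auto
      then show "\<psi> x = \<psi> x0" by simp
    qed
  qed
  then show ?thesis by blast
qed

section \<open>Real derivatives of iterates\<close>

text \<open>Away from its countably many critical points \<open>f\<close> is locally biholomorphic, and the real line
is a null set.\<close>

lemma holomorphic_real_preimage_null:
  fixes f :: "complex \<Rightarrow> complex"
  assumes hol: "f holomorphic_on S" and S: "open S" "connected S" and nc: "\<not> f constant_on S"
  shows "negligible {z \<in> S. f z \<in> \<real>}"
proof -
  have crit: "countable {z \<in> S. deriv f z = 0}"
  proof -
    have h': "deriv f holomorphic_on S" by (rule holomorphic_deriv[OF hol S(1)])
    have nz: "\<exists>z\<in>S. deriv f z \<noteq> 0"
    proof (rule ccontr)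
      assume "\<not> ?thesis"
      then have "f constant_on S"
        using DERIV_zero_connected_constant_on[OF S(2,1) finite.emptyI holomorphic_on_imp_continuous_on[OF hol]]
          holomorphic_derivI[OF hol S(1)] by fastforce
      then show False using nc by contradiction
    qed
    then obtain b where b: "b \<in> S" "deriv f b \<noteq> 0" by blast
    show ?thesis
    proof (cases "deriv f constant_on S")
      case True
      then have "{z \<in> S. deriv f z = 0} = {}" using b unfolding constant_on_def by auto
      then show ?thesis by (simp only: countable_empty)
    next
      case False
      obtain C :: "nat \<Rightarrow> complex set" where C: "\<And>n. compact (C n)" "\<Union>(range C) = S"
        using open_Union_compact_subsets[OF S(1)] by metis
      have "fsigma (\<Union>(range C))" using C(1) by (intro fsigma.intros compact_imp_closed)
      then show ?thesis using holomorphic_countable_zeros[OF h' S _ False] C(2) by simp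
    qed
  qed
  have "negligible {z \<in> S. deriv f z \<noteq> 0 \<and> f z \<in> \<real>}"
  proof (subst locally_negligible_alt, rule ballI)
    let ?T = "{z \<in> S. deriv f z \<noteq> 0 \<and> f z \<in> \<real>}"
    fix z assume z: "z \<in> ?T"
    obtain e where e: "e > 0" "ball z e \<subseteq> S" "open (f ` ball z e)" "inj_on f (ball z e)"
      using has_complex_derivative_locally_invertible[OF hol _ S(1)] z by blast
    obtain g where g: "g holomorphic_on (f ` ball z e)" "\<And>w. w \<in> ball z e \<Longrightarrow> g (f w) = w"
      using holomorphic_has_inverse[OF holomorphic_on_subset[OF hol e(2)] open_ball e(4)] by metis
    have "negligible (\<real> :: complex set)"
    proof -
      have "\<real> = {w :: complex. \<i> \<bullet> w = 0}" by (auto simp: complex_is_Real_iff inner_complex_def)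
      then show ?thesis using negligible_hyperplane[of \<i> 0] by simp
    qed
    then have "negligible (\<real> \<inter> f ` ball z e)" by (rule negligible_subset) auto
    moreover have "g differentiable_on (\<real> \<inter> f ` ball z e)"
      using holomorphic_on_imp_differentiable_on[OF g(1)] by (rule differentiable_on_subset) auto
    ultimately have "negligible (g ` (\<real> \<inter> f ` ball z e))"
      by (intro negligible_differentiable_image_negligible) auto
    then have "negligible (?T \<inter> ball z e)"
      by (rule negligible_subset) (use g(2) in force)
    moreover have "openin (top_of_set ?T) (?T \<inter> ball z e)" by (simp add: openin_open_Int)
    ultimately show "\<exists>U. openin (top_of_set ?T) U \<and> z \<in> U \<and> negligible U" using z e(1) by force
  qed
  then have "negligible ({z \<in> S. deriv f z = 0} \<union> {z \<in> S. deriv f z \<noteq> 0 \<and> f z \<in> \<real>})"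
    using countable_imp_null_set_lborel[OF crit]
    by (intro negligible_Un) (auto simp: negligible_iff_null_sets intro: null_sets_completionI)
  then show ?thesis by (rule negligible_subset) auto
qed

context rational
begin

text \<open>Otherwise the derivative of \<open>R\<^sup>n\<close> would be constant and \<open>R\<^sup>n\<close> affine on the cofinite set
\<open>fin_orbit n\<close>. It would be constant or injective there; but \<open>R\<^sup>n\<close> has finite fibres, and already \<open>R\<close>
identifies two points of this set.\<close>

lemma orb_deriv_real_null:
  assumes n: "n \<ge> 1"
  shows "negligible {z \<in> fin_orbit n. (\<Prod>k<n. r' (orb k z)) \<in> \<real>}"
proof -
  let ?O = "fin_orbit n"
  have hol: "orb n holomorphic_on ?O"
    unfolding holomorphic_on_open[OF open_fin_orbit] using orb_deriv by blast
  have con: "connected ?O"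
    using connected_open_delete_finite[of UNIV "- ?O"] finite_Compl_fin_orbit[of n] connected_UNIV
    by (simp add: Compl_eq_Diff_UNIV[symmetric])
  have d: "deriv (orb n) z = (\<Prod>k<n. r' (orb k z))" if "z \<in> ?O" for z
    using orb_deriv[OF that] by (rule DERIV_imp_deriv)
  have "\<not> deriv (orb n) constant_on ?O"
  proof
    assume "deriv (orb n) constant_on ?O"
    then obtain c where c: "\<And>z. z \<in> ?O \<Longrightarrow> deriv (orb n) z = c" unfolding constant_on_def by blast
    have "((\<lambda>z. orb n z - c * z) has_field_derivative 0) (at z)" if "z \<in> ?O" for z
      using holomorphic_derivI[OF hol open_fin_orbit that] c[OF that]
      by (auto intro!: derivative_eq_intros)
    moreover have "continuous_on ?O (\<lambda>z. orb n z - c * z)"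
      using holomorphic_on_imp_continuous_on[OF hol] by (intro continuous_intros)
    ultimately have "(\<lambda>z. orb n z - c * z) constant_on ?O"
      using DERIV_zero_connected_constant_on[OF con open_fin_orbit finite.emptyI] by blast
    then obtain e where "\<And>z. z \<in> ?O \<Longrightarrow> orb n z - c * z = e" unfolding constant_on_def by blast
    then have aff: "\<And>z. z \<in> ?O \<Longrightarrow> orb n z = c * z + e" by (metis add_diff_cancel_left' diff_add_cancel add.commute)
    show False
    proof (cases "c = 0")
      case True
      have "?O \<subseteq> Fin -` ((R ^^ n) -` {Fin e})"
        using aff True R_funpow_Fin[OF fin_orbitD] by auto
      moreover have "finite (Fin -` ((R ^^ n) -` {Fin e}))"
        by (intro finite_Fin_vimage finite_R_funpow_vimage) simp
      ultimately have "finite ?O" by (rule finite_subset)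
      then have "finite (?O \<union> - ?O)" using finite_Compl_fin_orbit by blast
      then show False using infinite_UNIV_char_0[where 'a = complex] by simp
    next
      case False
      obtain x y where xy: "x \<noteq> y" "x \<in> ?O" "y \<in> ?O" "poly q x \<noteq> 0" "poly q y \<noteq> 0" "r x = r y"
        using not_inj_on_cofinite[OF finite_Compl_fin_orbit[of n]] by auto
      obtain k where k: "n = Suc k" using n by (cases n) auto
      have "R (Fin x) = R (Fin y)" using xy by (simp add: R_Fin)
      then have "(R ^^ n) (Fin x) = (R ^^ n) (Fin y)" unfolding k by (simp add: funpow_swap1)
      then have "orb n x = orb n y" by (simp add: orb_def)
      then show False using aff xy False by simp
    qed
  qed
  from holomorphic_real_preimage_null[OF holomorphic_deriv[OF hol open_fin_orbit] open_fin_orbit con this]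
  have "negligible {z \<in> ?O. deriv (orb n) z \<in> \<real>}" .
  then show ?thesis by (rule negligible_subset) (use d in auto)
qed

section \<open>The ergodic measure\<close>

lemma mass_finite: "aligned f \<Longrightarrow> mass f E < \<infinity>"
proof -
  assume f: "aligned f"
  have "mass f E \<le> (\<integral>\<^sup>+t. ennreal (cmod (f t)) \<partial>lborel)"
    unfolding mass_def by (rule nn_integral_mono) (auto split: split_indicator)
  also have "\<dots> < \<infinity>" using alignedD(2)[OF f] by (simp add: integrable_iff_bounded)
  finally show ?thesis .
qed

lemma aligned_scale:
  assumes f: "aligned f" and c: "c > 0"
  shows "aligned (\<lambda>t. of_real c * f t)"
  unfolding aligned_def
proof (intro conjI ballI)
  note [measurable] = alignedD(1)[OF f]
  show "(\<lambda>t. of_real c * f t) \<in> borel_measurable borel" by measurable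
  show "integrable lborel (\<lambda>t. of_real c * f t)" using alignedD(2)[OF f] by simp
  have sg: "sgn (of_real c * z) = sgn z" for z :: complex
    using sgn_scaleR[of c z] c by (simp add: scaleR_conv_of_real)
  show "AE t in lborel. of_real c * f t \<noteq> 0 \<longrightarrow> t \<in> julia_plane R \<and> of_real c * f (r t) \<noteq> 0 \<and>
        cnj (sgn (of_real c * f t)) = cnj (sgn (of_real c * f (r t))) * cnj (r' t) / r' t"
    unfolding sg using alignedD(3)[OF f] by eventually_elim (use c in auto)
  fix A :: "complex set" assume A[measurable]: "A \<in> sets borel"
  have [measurable]: "r -` A \<in> sets borel" using measurable_sets_borel[OF r_borel A] .
  have "(\<integral>\<^sup>+t\<in>B. ennreal (cmod (of_real c * f t)) \<partial>lborel) = ennreal c * (\<integral>\<^sup>+t\<in>B. ennreal (cmod (f t)) \<partial>lborel)"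
    if [measurable]: "B \<in> sets borel" for B
    using c by (subst nn_integral_cmult[symmetric]) (auto simp: norm_mult ennreal_mult mult.assoc)
  then show "(\<integral>\<^sup>+t\<in>r -` A. ennreal (cmod (of_real c * f t)) \<partial>lborel) = (\<integral>\<^sup>+t\<in>A. ennreal (cmod (of_real c * f t)) \<partial>lborel)"
    using alignedD(4)[OF f A] by simp
qed

lemma ex_ergodic_aligned:
  assumes f: "aligned f" and nz: "\<not> (AE t in lborel. f t = 0)"
  obtains g where "aligned g" "mass g UNIV = 1"
    "\<And>E. invariant_set E \<Longrightarrow> mass g E = 0 \<or> mass g (- E) = 0"
proof -
  note fm[measurable] = alignedD(1)[OF f]
  obtain E where E: "invariant_set E" "mass f E > 0"
    and min: "\<And>E'. invariant_set E' \<Longrightarrow> E' \<subseteq> E \<Longrightarrow> mass f E' = 0 \<or> mass f (E - E') = 0"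
    using ex_minimal_invariant_set[OF f nz] by blast
  have Eb[measurable]: "E \<in> sets borel" using E(1) by (simp add: invariant_set_def)
  have FE[measurable]: "Fin -` E \<in> sets borel" using measurable_sets_borel[OF Fin_measurable Eb] .
  obtain a where a: "mass f E = ennreal a" "0 \<le> a" using mass_finite[OF f, of E] by (cases "mass f E") auto
  then have a0: "a > 0" using E(2) by simp
  define g where "g t = of_real (1 / a) * (f t * indicator (Fin -` E) t)" for t
  have ag: "aligned g"
    unfolding g_def
  proof (intro aligned_scale aligned_restrict[OF f FE])
    show "AE t in lborel. (t \<in> Fin -` E) = (r t \<in> Fin -` E)"
      using AE_X by eventually_elim (simp add: invariant_set_r[OF E(1)])
  qed (use a0 in simp)
  have mg: "mass g E' = ennreal (1 / a) * mass f (E \<inter> E')" if [measurable]: "E' \<in> sets borel" for E'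
  proof -
    have [measurable]: "Fin -` (E \<inter> E') \<in> sets borel" using measurable_sets_borel[OF Fin_measurable] by simp
    have "mass g E' = (\<integral>\<^sup>+t. ennreal (1 / a) * (ennreal (cmod (f t)) * indicator (Fin -` (E \<inter> E')) t) \<partial>lborel)"
      unfolding mass_def g_def
      by (intro nn_integral_cong) (use a0 in \<open>auto simp: norm_mult norm_divide ennreal_mult[symmetric] split: split_indicator\<close>)
    also have "\<dots> = ennreal (1 / a) * mass f (E \<inter> E')"
      unfolding mass_def by (rule nn_integral_cmult) measurable
    finally show ?thesis .
  qed
  show ?thesis
  proof (rule that[OF ag])
    show "mass g UNIV = 1" using mg[of UNIV] a a0 by (simp add: ennreal_mult[symmetric])
    fix E' assume E': "invariant_set E'"
    then have [measurable]: "E' \<in> sets borel" by (simp add: invariant_set_def)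
    have "invariant_set (E \<inter> E')" using E(1) E' by (auto simp: invariant_set_def)
    moreover have "E - E \<inter> E' = E \<inter> - E'" by auto
    ultimately have "mass f (E \<inter> E') = 0 \<or> mass f (E \<inter> - E') = 0"
      using min[of "E \<inter> E'"] by simp
    then show "mass g E' = 0 \<or> mass g (- E') = 0" using mg[of E'] mg[of "- E'"] by auto
  qed
qed

definition nu :: "(complex \<Rightarrow> complex) \<Rightarrow> csphere measure" where
  "nu f = distr (density lborel (\<lambda>t. ennreal (cmod (f t)))) borel Fin"

lemma sets_nu [simp, measurable_cong]: "sets (nu f) = sets borel"
  and space_nu [simp]: "space (nu f) = UNIV"
  by (simp_all add: nu_def)

lemma emeasure_nu:
  assumes "f \<in> borel_measurable borel" "A \<in> sets borel"
  shows "emeasure (nu f) A = mass f A"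
proof -
  have "Fin -` A \<in> sets borel" using measurable_sets_borel[OF Fin_measurable assms(2)] .
  then show ?thesis using assms by (simp add: nu_def mass_def emeasure_distr emeasure_density)
qed

lemma AE_nu:
  assumes f[measurable]: "f \<in> borel_measurable borel" and ae: "AE t in lborel. f t \<noteq> 0 \<longrightarrow> Q (Fin t)"
  shows "AE x in nu f. Q x"
proof -
  obtain N where N: "N \<in> null_sets lborel" "{t. \<not> (f t \<noteq> 0 \<longrightarrow> Q (Fin t))} \<subseteq> N"
    using ae by (auto elim!: AE_E simp: null_sets_def)
  have [measurable]: "N \<in> sets borel" using N by auto
  define Z where "Z = insert Infty (- {Infty} \<inter> fin_part -` (N \<union> {t. f t = 0}))"
  have "fin_part -` (N \<union> {t. f t = 0}) \<in> sets borel"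
    by (rule measurable_sets_borel[OF fin_part_measurable]) measurable
  moreover have "{Infty} \<in> sets borel" by (intro borel_closed) simp
  ultimately have Zb: "Z \<in> sets borel" unfolding Z_def by auto
  have FZ: "Fin -` Z = N \<union> {t. f t = 0}" by (auto simp: Z_def)
  have "emeasure (nu f) Z = 0"
    unfolding emeasure_nu[OF f Zb]
    unfolding mass_0_iff[OF f Zb]
    using AE_not_in[OF N(1)] by eventually_elim (use FZ in auto)
  moreover have "{x \<in> space (nu f). \<not> Q x} \<subseteq> Z"
  proof
    fix x assume "x \<in> {x \<in> space (nu f). \<not> Q x}"
    then have x: "\<not> Q x" by simp
    show "x \<in> Z"
    proof (cases x)
      case (Fin t)
      then have "t \<in> N \<union> {t. f t = 0}" using x N(2) by auto
      then have "t \<in> Fin -` Z" unfolding FZ .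
      then show ?thesis by (simp add: Fin)
    qed (simp add: Z_def)
  qed
  ultimately show ?thesis using Zb by (intro AE_I[of _ _ Z]) auto
qed

lemma nu_invariant:
  assumes f: "aligned f" and A: "A \<in> sets borel"
  shows "R -` A \<in> sets borel" "emeasure (nu f) (R -` A) = emeasure (nu f) A"
proof -
  note fm = alignedD(1)[OF f]
  show RA: "R -` A \<in> sets borel" using measurable_sets_borel[OF R_borel A] .
  have FA: "Fin -` A \<in> sets borel" using measurable_sets_borel[OF Fin_measurable A] .
  have "mass f (R -` A) = (\<integral>\<^sup>+t\<in>r -` (Fin -` A). ennreal (cmod (f t)) \<partial>lborel)"
    unfolding mass_def
    by (rule nn_integral_cong_AE) (use AE_X in \<open>eventually_elim, simp add: indicator_def R_Fin_X\<close>)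
  also have "\<dots> = mass f A" unfolding mass_def by (rule alignedD(4)[OF f FA])
  finally show "emeasure (nu f) (R -` A) = emeasure (nu f) A"
    by (simp add: emeasure_nu[OF fm] A RA)
qed

lemma AE_nu_funpow:
  assumes f: "aligned f" and ae: "AE x in nu f. P x"
  shows "AE x in nu f. P ((R ^^ n) x)"
proof -
  obtain N where N: "N \<in> null_sets (nu f)" "{x. \<not> P x} \<subseteq> N"
    using ae by (auto elim!: AE_E simp: null_sets_def)
  have "(R ^^ n) -` N \<in> sets borel \<and> emeasure (nu f) ((R ^^ n) -` N) = 0"
  proof (induction n)
    case 0
    then show ?case using N(1) by (auto simp: null_sets_def)
  next
    case (Suc n)
    have "(R ^^ Suc n) -` N = R -` ((R ^^ n) -` N)" by (auto simp: funpow_swap1)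
    then show ?case using nu_invariant[OF f, of "(R ^^ n) -` N"] Suc by (simp only:)
  qed
  then show ?thesis using N(2) by (intro AE_I[of _ _ "(R ^^ n) -` N"]) auto
qed

lemma nu_ergodic:
  assumes g: "aligned g" and one: "mass g UNIV = 1"
    and erg: "\<And>E. invariant_set E \<Longrightarrow> mass g E = 0 \<or> mass g (- E) = 0"
  shows "invariant_ergodic_prob R (nu g)" "absolutely_continuous sphere_lborel (nu g)"
    "emeasure (nu g) (- julia_set R) = 0"
proof -
  note gm = alignedD(1)[OF g]
  have pr: "prob_space (nu g)"
    by (rule prob_spaceI) (simp add: emeasure_nu[OF gm] one)
  show "invariant_ergodic_prob R (nu g)"
    unfolding invariant_ergodic_prob_def
  proof (intro conjI ballI impI)
    fix A assume A: "A \<in> sets (nu g)"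
    then show "R -` A \<in> sets (nu g)" "emeasure (nu g) (R -` A) = emeasure (nu g) A"
      using nu_invariant[OF g, of A] by simp_all
    assume RA: "R -` A = A"
    then have "invariant_set A" using A by (simp add: invariant_set_def)
    from erg[OF this] show "emeasure (nu g) A = 0 \<or> emeasure (nu g) A = 1"
    proof
      assume "mass g (- A) = 0"
      then have "emeasure (nu g) (- A) = 0" using A by (simp add: emeasure_nu[OF gm])
      then have "AE x in nu g. x \<in> A" using A by (intro AE_I[of _ _ "- A"]) auto
      then show ?thesis using A prob_space.emeasure_eq_1_AE[OF pr] by blast
    qed (use A in \<open>simp add: emeasure_nu[OF gm]\<close>)
  qed (use pr in simp_all)
  show "absolutely_continuous sphere_lborel (nu g)"
    unfolding absolutely_continuous_def
  proof
    fix A assume A: "A \<in> null_sets sphere_lborel"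
    then have Ab: "A \<in> sets borel" by (auto simp: null_sets_def sphere_lborel_def)
    have "emeasure lborel (Fin -` A) = 0"
      using A emeasure_sphere_lborel[OF Ab] by (simp add: null_sets_def vimage_def)
    then have "Fin -` A \<in> null_sets lborel"
      using measurable_sets_borel[OF Fin_measurable Ab] by auto
    from AE_not_in[OF this] have "mass g A = 0"
      unfolding mass_0_iff[OF gm Ab] by eventually_elim simp
    then show "A \<in> null_sets (nu g)" using Ab by (simp add: null_sets_def emeasure_nu[OF gm])
  qed
  have Jb: "- julia_set R \<in> sets borel" using closed_julia_set[of R] by auto
  show "emeasure (nu g) (- julia_set R) = 0"
    unfolding emeasure_nu[OF gm Jb] mass_0_iff[OF gm Jb]
    using alignedD(3)[OF g] by eventually_elim (auto simp: julia_plane_def)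
qed

lemma AE_pullback_funpow: "AE t in lborel. P t \<Longrightarrow> AE t in lborel. P ((r ^^ n) t)"
proof (induction n)
  case (Suc n)
  from AE_pullback[OF Suc.IH[OF Suc.prems]] show ?case by (simp add: funpow_swap1)
qed simp

lemma iterate_deriv_orb: "t \<in> fin_orbit n \<Longrightarrow> iterate_deriv R n (Fin t) = (\<Prod>k<n. r' (orb k t))"
  using DERIV_imp_deriv[OF orb_deriv, of t n] by (simp add: iterate_deriv_def orb_def[abs_def])

text \<open>The invariance of the line field along a whole orbit: the derivative of \<open>R\<^sup>n\<close> is the product of
\<open>r'\<close> along the orbit.\<close>

lemma aligned_orbit:
  assumes g: "aligned g"
  shows "AE t in lborel. g t \<noteq> 0 \<longrightarrow> (\<forall>n. t \<in> fin_orbit n \<and> g (orb n t) \<noteq> 0 \<and>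
     (\<Prod>k<n. r' (orb k t)) \<noteq> 0 \<and>
     cnj (sgn (g t)) = cnj (sgn (g (orb n t))) * (cnj (\<Prod>k<n. r' (orb k t)) / (\<Prod>k<n. r' (orb k t))))"
proof -
  define good where "good t \<longleftrightarrow> t \<in> X \<and> (g t \<noteq> 0 \<longrightarrow> g (r t) \<noteq> 0 \<and>
        cnj (sgn (g t)) = cnj (sgn (g (r t))) * cnj (r' t) / r' t)" for t
  have "AE t in lborel. good t"
    using alignedD(3)[OF g] AE_X by eventually_elim (auto simp: good_def)
  then have "AE t in lborel. \<forall>n. good ((r ^^ n) t)"
    unfolding AE_all_countable using AE_pullback_funpow by blast
  then show ?thesis
  proof eventually_elim
    case (elim t)
    show ?case
    proof
      assume gt: "g t \<noteq> 0"
      have *: "t \<in> fin_orbit n \<and> orb n t = (r ^^ n) t \<and> g (orb n t) \<noteq> 0 \<and> (\<Prod>k<n. r' (orb k t)) \<noteq> 0 \<and>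
        cnj (sgn (g t)) = cnj (sgn (g (orb n t))) * (cnj (\<Prod>k<n. r' (orb k t)) / (\<Prod>k<n. r' (orb k t)))" for n
      proof (induction n)
        case 0
        then show ?case using gt by (simp add: fin_orbit_def)
      next
        case (Suc n)
        let ?s = "orb n t" and ?P = "\<Prod>k<n. r' (orb k t)"
        have gs: "good ?s" using elim Suc.IH by simp
        then have sX: "?s \<in> X" by (simp add: good_def)
        have Rn: "(R ^^ n) (Fin t) = Fin ?s" using R_funpow_Fin[OF fin_orbitD] Suc.IH by blast
        have RS: "(R ^^ Suc n) (Fin t) = Fin (r ?s)" using Rn R_Fin_X[OF sX] by simp
        have o: "orb (Suc n) t = r ?s" by (rule orb_Suc) (simp add: Rn)
        have "t \<in> fin_orbit (Suc n)"
          using Suc.IH RS by (auto simp: fin_orbit_def le_Suc_eq)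
        moreover have "orb (Suc n) t = (r ^^ Suc n) t" using o Suc.IH by simp
        moreover have ph: "g (r ?s) \<noteq> 0" "cnj (sgn (g ?s)) = cnj (sgn (g (r ?s))) * cnj (r' ?s) / r' ?s"
          using gs Suc.IH by (auto simp: good_def)
        moreover have "cnj (sgn (g t)) = cnj (sgn (g (r ?s))) * (cnj (?P * r' ?s) / (?P * r' ?s))"
        proof -
          have "cnj (sgn (g t)) = cnj (sgn (g ?s)) * (cnj ?P / ?P)" using Suc.IH by blast
          also have "\<dots> = cnj (sgn (g (r ?s))) * cnj (r' ?s) / r' ?s * (cnj ?P / ?P)" unfolding ph(2) ..
          finally show ?thesis by (simp add: mult_ac)
        qed
        ultimately show ?case using Suc.IH r'_nz[OF sX] o by simp
      qed
      show "\<forall>n. t \<in> fin_orbit n \<and> g (orb n t) \<noteq> 0 \<and> (\<Prod>k<n. r' (orb k t)) \<noteq> 0 \<and>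
        cnj (sgn (g t)) = cnj (sgn (g (orb n t))) * (cnj (\<Prod>k<n. r' (orb k t)) / (\<Prod>k<n. r' (orb k t)))"
        using * by blast
    qed
  qed
qed

text \<open>Mixing is used twice: to make the line field constant on \<open>A\<close>, and to find \<open>n\<close> such that a set
of positive measure in \<open>A\<close> returns to \<open>A\<close> at time \<open>n\<close>.\<close>

lemma ergodic_contradiction:
  assumes g: "aligned g" and one: "mass g UNIV = 1"
    and erg: "\<And>E. invariant_set E \<Longrightarrow> mass g E = 0 \<or> mass g (- E) = 0"
    and M: "M_condition R"
  shows False
proof -
  note gm[measurable] = alignedD(1)[OF g]
  let ?C = "completion (nu g)"
  have nu: "invariant_ergodic_prob R (nu g)" "absolutely_continuous sphere_lborel (nu g)"
    "emeasure (nu g) (- julia_set R) = 0"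
    by (rule nu_ergodic[OF g one], rule erg, assumption)+
  have pr: "prob_space (nu g)" using nu(1) by (simp add: invariant_ergodic_prob_def)
  have prC: "prob_space ?C"
    using pr by (intro prob_spaceI) (simp add: prob_space.emeasure_space_1[OF pr, simplified])
  interpret C: prob_space ?C by (rule prC)
  let ?\<rho> = "\<lambda>n x. cnj (iterate_deriv R n x) / iterate_deriv R n x"
  note MM = mp[OF spec[OF M[unfolded M_condition_def], of "nu g"] conjI[OF nu(1) conjI[OF nu(2,3)]]]
  have M1: "(\<lambda>n. measure ?C (B \<inter> (R ^^ n) -` A)) \<longlonglongrightarrow> measure ?C A * measure ?C B"
    if "A \<in> sets ?C" "B \<in> sets ?C" "A \<subseteq> SC_set R \<inter> julia_set R" "B \<subseteq> SC_set R \<inter> julia_set R" for A B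
    using conjunct1[OF MM] that by blast
  from conjunct2[OF MM] obtain A where A': "A \<in> sets ?C"
    "A \<subseteq> SC_set R \<inter> julia_set R \<and> measure ?C A > 0 \<and> precompact_in_measure (restrict_space ?C A) (range ?\<rho>)"
    by (elim bexE)
  then have A: "A \<in> sets ?C" "A \<subseteq> SC_set R \<inter> julia_set R" "measure ?C A > 0"
    "precompact_in_measure (restrict_space ?C A) (range ?\<rho>)" by simp_all
  define \<psi> where "\<psi> x = cnj (sgn (g (fin_part x)))" for x
  have \<psi>b: "\<psi> \<in> borel_measurable borel" unfolding \<psi>_def sgn_div_norm by measurable
  then have \<psi>m: "\<psi> \<in> borel_measurable ?C" by (intro measurable_completion) simp
  have rel: "AE x in nu g. \<forall>n. \<psi> x = \<psi> ((R ^^ n) x) * ?\<rho> n x \<and> cmod (\<psi> x) = 1 \<and> cmod (?\<rho> n x) = 1"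
  proof (rule AE_nu[OF gm])
    show "AE t in lborel. g t \<noteq> 0 \<longrightarrow> (\<forall>n. \<psi> (Fin t) = \<psi> ((R ^^ n) (Fin t)) * ?\<rho> n (Fin t) \<and>
        cmod (\<psi> (Fin t)) = 1 \<and> cmod (?\<rho> n (Fin t)) = 1)"
      using aligned_orbit[OF g]
    proof eventually_elim
      case (elim t)
      show ?case
      proof (intro impI allI)
        fix n assume gt: "g t \<noteq> 0"
        define P where "P = (\<Prod>k<n. r' (orb k t))"
        have o: "t \<in> fin_orbit n" "P \<noteq> 0" "cnj (sgn (g t)) = cnj (sgn (g (orb n t))) * (cnj P / P)"
          using elim gt unfolding P_def by blast+
        show "\<psi> (Fin t) = \<psi> ((R ^^ n) (Fin t)) * ?\<rho> n (Fin t) \<and> cmod (\<psi> (Fin t)) = 1 \<and> cmod (?\<rho> n (Fin t)) = 1"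
          unfolding iterate_deriv_orb[OF o(1)] R_funpow_Fin[OF fin_orbitD[OF o(1)]] \<psi>_def fin_part.simps
            P_def[symmetric]
          using o(2) gt by (intro conjI o(3)) (simp_all add: norm_sgn norm_divide)
      qed
    qed
  qed
  have "\<exists>c. AE x in ?C. x \<in> A \<longrightarrow> \<psi> x = c"
  proof (rule mixing_precompact_imp_constant[OF prC A(1,3) \<psi>m _ A(4)])
    show "(\<lambda>n. measure ?C (B \<inter> (R ^^ n) -` A')) \<longlonglongrightarrow> measure ?C A' * measure ?C B"
      if "A' \<in> sets ?C" "B \<in> sets ?C" "A' \<subseteq> A" "B \<subseteq> A" for A' B
      using M1 that A(2) by blast
    show "AE x in ?C. \<forall>n. \<psi> x = \<psi> ((R ^^ n) x) * ?\<rho> n x \<and> cmod (\<psi> x) = 1 \<and> cmod (?\<rho> n x) = 1"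
      using rel by (rule AE_completion)
  qed
  then obtain c where c: "AE x in nu g. x \<in> A \<longrightarrow> \<psi> x = c" by (auto simp: AE_completion_iff)
  have "(\<lambda>n. measure ?C (A \<inter> (R ^^ n) -` A)) \<longlonglongrightarrow> measure ?C A * measure ?C A" by (rule M1[OF A(1,1,2,2)])
  then have "eventually (\<lambda>n. 0 < measure ?C (A \<inter> (R ^^ n) -` A)) sequentially"
    by (rule order_tendstoD(1)) (rule mult_pos_pos[OF A(3) A(3)])
  then obtain N where N: "\<And>n. n \<ge> N \<Longrightarrow> 0 < measure ?C (A \<inter> (R ^^ n) -` A)"
    unfolding eventually_sequentially by blast
  define n where "n = Suc N"
  let ?Y = "A \<inter> (R ^^ n) -` A"
  have Ypos: "0 < measure ?C ?Y" using N[of n] by (simp add: n_def)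
  have real: "AE x in nu g. x \<in> ?Y \<longrightarrow> iterate_deriv R n x \<in> \<real>"
    using c AE_nu_funpow[OF g c, of n] rel
  proof eventually_elim
    case (elim x)
    show ?case
    proof
      assume x: "x \<in> ?Y"
      then have "\<psi> x = c" "\<psi> ((R ^^ n) x) = c" using elim(1,2) by auto
      moreover have "\<psi> x = \<psi> ((R ^^ n) x) * ?\<rho> n x" "cmod (\<psi> x) = 1" "cmod (?\<rho> n x) = 1" using elim(3) by blast+
      ultimately have "c = c * ?\<rho> n x" "c \<noteq> 0" "iterate_deriv R n x \<noteq> 0" by auto
      then have "?\<rho> n x = 1" by (metis mult_cancel_left2)
      then have "cnj (iterate_deriv R n x) = iterate_deriv R n x" using \<open>iterate_deriv R n x \<noteq> 0\<close> by simp
      then show "iterate_deriv R n x \<in> \<real>" by (simp add: Reals_cnj_iff)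
    qed
  qed
  have notreal: "AE x in nu g. iterate_deriv R n x \<notin> \<real>"
  proof (rule AE_nu[OF gm])
    have "{z \<in> fin_orbit n. (\<Prod>k<n. r' (orb k z)) \<in> \<real>} \<in> null_sets lebesgue"
      using orb_deriv_real_null[of n] by (simp add: n_def negligible_iff_null_sets)
    from AE_not_in[OF this] have "AE t in lborel. t \<notin> {z \<in> fin_orbit n. (\<Prod>k<n. r' (orb k z)) \<in> \<real>}"
      by (simp only: AE_completion_iff)
    then show "AE t in lborel. g t \<noteq> 0 \<longrightarrow> iterate_deriv R n (Fin t) \<notin> \<real>"
      using aligned_orbit[OF g]
    proof eventually_elim
      case (elim t)
      show ?case
      proof
        assume "g t \<noteq> 0"
        then have t: "t \<in> fin_orbit n" using elim(2) by blast
        then show "iterate_deriv R n (Fin t) \<notin> \<real>" using elim(1) by (simp add: iterate_deriv_orb)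
      qed
    qed
  qed
  have "AE x in nu g. x \<notin> ?Y" using real notreal by eventually_elim blast
  then have "AE x in ?C. x \<notin> ?Y" by (rule AE_completion)
  moreover have "?Y \<in> sets ?C" using Ypos measure_notin_sets[of ?Y ?C] by (cases "?Y \<in> sets ?C") auto
  ultimately have "?Y \<in> null_sets ?C" using AE_iff_null_sets by blast
  then show False using Ypos by (simp add: null_sets_def measure_def)
qed

end

theorem theorem9p2:
  fixes R :: "csphere \<Rightarrow> csphere" and d :: nat
  assumes "rational_map_of_degree d R" and "d \<ge> 2"
    and "\<not> lattes_map R"
    and "M_condition R"
    and "postcritical_set R \<noteq> UNIV"
  shows "\<not> (\<exists>\<phi> :: complex \<Rightarrow> complex.
           set_integrable lebesgue (julia_plane R) \<phi> \<and>
           \<not> (AE z in lebesgue. z \<in> julia_plane R \<longrightarrow> \<phi> z = 0) \<and>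
           (AE z in lebesgue. z \<in> julia_plane R \<longrightarrow> ruelle R \<phi> z = \<phi> z))"
proof
  obtain p q where pq: "rational p q d" "R = rat_map p q" by (rule rational_map_of_degreeE[OF assms(1,2)])
  interpret rational p q d by (rule pq(1))
  assume "\<exists>\<phi> :: complex \<Rightarrow> complex.
           set_integrable lebesgue (julia_plane R) \<phi> \<and>
           \<not> (AE z in lebesgue. z \<in> julia_plane R \<longrightarrow> \<phi> z = 0) \<and>
           (AE z in lebesgue. z \<in> julia_plane R \<longrightarrow> ruelle R \<phi> z = \<phi> z)"
  then obtain f where f: "aligned f" "\<not> (AE t in lborel. f t = 0)"
    unfolding pq(2) using ruelle_fixed_imp_aligned by blast
  obtain g where "aligned g" "mass g UNIV = 1"
    "\<And>E. invariant_set E \<Longrightarrow> mass g E = 0 \<or> mass g (- E) = 0"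
    by (rule ex_ergodic_aligned[OF f]) blast
  then show False using assms(4) unfolding pq(2) by (rule ergodic_contradiction)
qed

end
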